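(* Let $\Gamma\subset\mathrm{PGL}_2(K)$ be a Schottky group with $g\ge1$ generators, with domain of regular points $\Omega$ and compact clopen fundamental domain $\mathscr{F}\subset K$, and let $\mathcal{U}\in\mathrm{Cov}(\mathscr{F})$ be verticial. Let the $\mathcal{U}$-matrix $A$ be symmetric with non-negative real entries and $A_{UU}=0$ for all $U\in\mathcal{U}$, and let $\alpha\in\mathbb{R}$, $s>1$. Then the operator $\mathcal{D}^\alpha_{A,\Gamma}$ is a self-adjoint bounded linear operator on $L^2_s(\Omega)^\Gamma$.
   Context: $K$ is a non-archimedean local field with absolute value $|\cdot|_K$, Haar measure $\mu$ (also $dx$) with $\mu(O_K)=1$; $1_U$ is the indicator function of $U$. $\gamma\in\mathrm{PGL}_2(K)$ is hyperbolic if $|\mathrm{Tr}(A_\gamma)|_K^2>1$ for a representative $A_\gamma$ of determinant $1$. A Schottky group is a discrete subgroup of $\mathrm{PGL}_2(K)$ freely generated by $g\ge1$ hyperbolic transformations. $\Omega\subset\mathbb{P}^1(K)$ is the complement of the closure of the set of limit points of $\Gamma$, and $\mathscr{F}\subset\Omega$ is a fundamental domain for the action of $\Gamma$, chosen to be a compact clopen subset of $K$. $\mathrm{Cov}(\mathscr{F})$ is the set of coverings of $\mathscr{F}$ by mutually disjoint holed discs (discs with finitely many pairwise disjoint subdiscs removed); a covering is verticial if each member is an intersection of spheres $\{x:|x-a|_K=r\}$ of equal radius $r$ (which may depend on the member). A $\mathcal{U}$-matrix is a matrix indexed by $\mathcal{U}$. A $\Gamma$-periodic function has the form $f(x)=\sum_{\gamma\in\Gamma}\sum_{U\in\mathcal{U}}f_U(\gamma^{-1}x)1_{\gamma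 U}(x)$. With $m_{\gamma,U}=\max\{1,\max_U|\gamma'|_K\}$ its weighted integral is $\int_{\Omega,s}f(x)\,dx=\sum_{U\in\mathcal{U}}\sum_{\gamma\in\Gamma}m_{\gamma,U}^{-s}\int_{\gamma U}f_U(\gamma^{-1}x)\,dx$. Put $\langle f,g\rangle_s=\int_{\Omega,s}f\overline{g}\,dx$, $\|f\|_s=\sqrt{\langle f,f\rangle_s}$, and let $L^2_s(\Omega)^\Gamma$ be the space of $\Gamma$-periodic $f\colon\Omega\to\mathbb{C}$ with $\|f\|_s<\infty$. The operator is $\mathcal{D}^\alpha_{A,\Gamma}f(x)=\int_{\Omega,s}A^\alpha_\Gamma(x,y)(f(y)-f(x))\,dy$ with kernel $A^\alpha_\Gamma(x,y)=\sum_{U,V\in\mathcal{U}}A_{UV}\sum_{\gamma,\delta\in\Gamma}|\gamma^{-1}x-\delta^{-1}y|_K^\alpha 1_{\gamma U}(x)1_{\delta V}(y)$. *)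

theory Defs
  imports "HOL-Analysis.Analysis" "HOL-Algebra.Coset" "HOL-Algebra.Generated_Groups"
begin

text \<open>
  \<open>absK\<close> is the absolute value of the field \<open>K\<close> (here the type \<open>'a\<close>). It is not required to be
  normalised by the order of the residue field.
\<close>

class nonarch_local_field = field + metric_space +
  fixes absK :: "'a \<Rightarrow> real"
  assumes dist_absK: "dist x y = absK (x - y)"
    and absK_mult: "absK (x * y) = absK x * absK y"
    and absK_ultrametric: "absK (x + y) \<le> max (absK x) (absK y)"
    and absK_nontrivial: "\<exists>x. absK x \<noteq> 0 \<and> absK x \<noteq> 1"
    and locally_compact: "\<exists>U C. open U \<and> compact C \<and> x \<in> U \<and> U \<subseteq> C"

definition haar_measure :: "'a::nonarch_local_field measure \<Rightarrow> bool" where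
  "haar_measure \<mu> \<longleftrightarrow>
     sets \<mu> = sets borel \<and>
     (\<forall>a. \<forall>B\<in>sets borel. emeasure \<mu> ((+) a ` B) = emeasure \<mu> B) \<and>
     (\<forall>C. compact C \<longrightarrow> emeasure \<mu> C < \<infinity>) \<and>
     emeasure \<mu> {x. absK x \<le> 1} = 1"


section \<open>The group and its action on the projective line\<close>

definition GL2 :: "('a::field^2^2) monoid" where
  "GL2 = \<lparr>carrier = {A. invertible A}, mult = (**), one = mat 1\<rparr>"

definition scalars :: "('a::field^2^2) set" where
  "scalars = {mat c | c. c \<noteq> 0}"

definition PGL2 :: "('a::field^2^2) set monoid" where
  "PGL2 = GL2 Mod scalars"

text \<open>The quotient topology on the cosets, inherited from the matrices.\<close>

definition PGL2_topology :: "('a::nonarch_local_field^2^2) set topology" where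
  "PGL2_topology = topology (\<lambda>S. S \<subseteq> carrier PGL2 \<and>
     openin (top_of_set (carrier GL2)) {A \<in> carrier GL2. scalars #>\<^bsub>GL2\<^esub> A \<in> S})"

text \<open>The projective line is \<open>'a option\<close>, with \<open>None\<close> as the point at infinity.\<close>

definition P1_topology :: "'a::nonarch_local_field option topology" where
  "P1_topology = Alexandroff_compactification euclidean"

definition moebius :: "'a::field^2^2 \<Rightarrow> 'a option \<Rightarrow> 'a option" where
  "moebius A z =
     (case z of
        None \<Rightarrow> (if A$2$1 = 0 then None else Some (A$1$1 / A$2$1))
      | Some x \<Rightarrow> (if A$2$1 * x + A$2$2 = 0 then None
                  else Some ((A$1$1 * x + A$1$2) / (A$2$1 * x + A$2$2))))"

text \<open>The choice of the representative is immaterial on \<^term>\<open>carrier PGL2\<close>.\<close>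

definition act :: "('a::field^2^2) set \<Rightarrow> 'a option \<Rightarrow> 'a option" where
  "act \<gamma> = moebius (SOME A. A \<in> \<gamma>)"

text \<open>
  A class in \<open>PGL2\<close> need not have a representative of determinant 1 over \<open>K\<close>: given any
  representative \<open>A\<close>, the matrix \<open>A / sqrt (det A)\<close> lies over an extension of degree at most 2, to
  which the absolute value extends uniquely, and the square of its trace has absolute value
  \<open>absK (trace A)^2 / absK (det A)\<close>. This does not depend on \<open>A\<close>.
\<close>

definition hyperbolic :: "('a::nonarch_local_field^2^2) set \<Rightarrow> bool" where
  "hyperbolic \<gamma> \<longleftrightarrow> (\<exists>A\<in>\<gamma>. (absK (trace A))\<^sup>2 / absK (det A) > 1)"


section \<open>Schottky groups\<close>

text \<open>A letter \<open>(x, True)\<close> stands for \<open>x\<close>, and \<open>(x, False)\<close> for the inverse of \<open>x\<close>.\<close>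

definition word_value :: "('g, 'b) monoid_scheme \<Rightarrow> ('g \<times> bool) list \<Rightarrow> 'g" where
  "word_value G w =
     foldr (\<lambda>(x, e) y. (if e then x else inv\<^bsub>G\<^esub> x) \<otimes>\<^bsub>G\<^esub> y) w \<one>\<^bsub>G\<^esub>"

definition reduced_word :: "('g \<times> bool) list \<Rightarrow> bool" where
  "reduced_word w \<longleftrightarrow> successively (\<lambda>(x, e) (y, e'). x = y \<longrightarrow> e = e') w"

definition freely_generated :: "('g, 'b) monoid_scheme \<Rightarrow> 'g set \<Rightarrow> 'g set \<Rightarrow> bool" where
  "freely_generated G H S \<longleftrightarrow>
     S \<subseteq> carrier G \<and> generate G S = H \<and>
     (\<forall>w. w \<noteq> [] \<and> fst ` set w \<subseteq> S \<and> reduced_word w \<longrightarrow> word_value G w \<noteq> \<one>\<^bsub>G\<^esub>)"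

definition schottky_group :: "('a::nonarch_local_field^2^2) set set \<Rightarrow> nat \<Rightarrow> bool" where
  "schottky_group \<Gamma> g \<longleftrightarrow>
     subgroup \<Gamma> PGL2 \<and>
     subtopology PGL2_topology \<Gamma> = discrete_topology \<Gamma> \<and>
     g \<ge> 1 \<and>
     (\<exists>S. finite S \<and> card S = g \<and> (\<forall>\<gamma>\<in>S. hyperbolic \<gamma>) \<and> freely_generated PGL2 \<Gamma> S)"

definition limit_points :: "('a::nonarch_local_field^2^2) set set \<Rightarrow> 'a option set" where
  "limit_points \<Gamma> = {a. \<exists>b \<gamma>. inj \<gamma> \<and> range \<gamma> \<subseteq> \<Gamma> \<and>
     limitin P1_topology (\<lambda>n::nat. act (\<gamma> n) b) a sequentially}"

definition regular_domain :: "('a::nonarch_local_field^2^2) set set \<Rightarrow> 'a option set" where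
  "regular_domain \<Gamma> = - (P1_topology closure_of limit_points \<Gamma>)"

text \<open>
  Fundamental domains are strict: the translates are pairwise disjoint, so that every regular point
  lies in exactly one of them.
\<close>

definition fundamental_domain ::
    "('a::nonarch_local_field^2^2) set set \<Rightarrow> 'a set \<Rightarrow> bool" where
  "fundamental_domain \<Gamma> F \<longleftrightarrow>
     (\<Union>\<gamma>\<in>\<Gamma>. act \<gamma> ` Some ` F) = regular_domain \<Gamma> \<and>
     disjoint_family_on (\<lambda>\<gamma>. act \<gamma> ` Some ` F) \<Gamma>"


section \<open>Coverings by holed discs\<close>

definition disc :: "'a::nonarch_local_field set \<Rightarrow> bool" where
  "disc B \<longleftrightarrow> (\<exists>a r. r > 0 \<and> B = cball a r)"

definition holed_disc :: "'a::nonarch_local_field set \<Rightarrow> bool" where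
  "holed_disc U \<longleftrightarrow>
     (\<exists>B \<H>. disc B \<and> finite \<H> \<and> disjoint \<H> \<and> (\<forall>H\<in>\<H>. disc H \<and> H \<subseteq> B) \<and> U = B - \<Union>\<H>)"

definition Cov :: "'a::nonarch_local_field set \<Rightarrow> 'a set set set" where
  "Cov F = {\<U>. (\<forall>U\<in>\<U>. holed_disc U) \<and> disjoint \<U> \<and> \<Union>\<U> = F}"

definition verticial :: "'a::nonarch_local_field set set \<Rightarrow> bool" where
  "verticial \<U> \<longleftrightarrow> (\<forall>U\<in>\<U>. \<exists>r>0. \<exists>S. S \<noteq> {} \<and> U = (\<Inter>a\<in>S. sphere a r))"


section \<open>Periodic functions and weighted integration\<close>

text \<open>
  Functions on the regular domain are total functions on the projective line whose values elsewhere
  are irrelevant.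
\<close>

definition periodic ::
    "('a::nonarch_local_field^2^2) set set \<Rightarrow> 'a set set \<Rightarrow> ('a option \<Rightarrow> complex) \<Rightarrow> bool" where
  "periodic \<Gamma> \<U> f \<longleftrightarrow>
     (\<exists>f\<^sub>U :: 'a set \<Rightarrow> 'a \<Rightarrow> complex. \<forall>x\<in>regular_domain \<Gamma>.
        f x = (\<Sum>\<^sub>\<infinity>\<gamma>\<in>\<Gamma>. \<Sum>U\<in>\<U>.
                 f\<^sub>U U (the (act (inv\<^bsub>PGL2\<^esub> \<gamma>) x)) * indicator (act \<gamma> ` Some ` U) x))"

text \<open>The derivative at a point \<open>x\<close> that is not the pole of \<open>\<gamma>\<close>.\<close>

definition moebius_deriv :: "('a::nonarch_local_field^2^2) set \<Rightarrow> 'a \<Rightarrow> 'a" where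
  "moebius_deriv \<gamma> x =
     Lim (at x) (\<lambda>y. (the (act \<gamma> (Some y)) - the (act \<gamma> (Some x))) / (y - x))"

text \<open>
  If the pole of \<open>\<gamma>\<close> lies in \<open>U\<close> (which can happen only if infinity is a regular point), then the
  supremum below is infinite and the weight is \<open>\<infinity> powr (-s) = 0\<close>; in the integrals, such a term
  counts as 0.
\<close>

definition deriv_max :: "('a::nonarch_local_field^2^2) set \<Rightarrow> 'a set \<Rightarrow> ennreal" where
  "deriv_max \<gamma> U =
     max 1 (SUP x\<in>{x\<in>U. act \<gamma> (Some x) \<noteq> None}. ennreal (absK (moebius_deriv \<gamma> x)))"

definition weight :: "real \<Rightarrow> ('a::nonarch_local_field^2^2) set \<Rightarrow> 'a set \<Rightarrow> real" where
  "weight s \<gamma> U = (if deriv_max \<gamma> U = \<infinity> then 0 else enn2real (deriv_max \<gamma> U) powr (- s))"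

definition finite_points :: "'a option set \<Rightarrow> 'a set" where
  "finite_points X = {x. Some x \<in> X}"

text \<open>
  The local function \<open>f\<^sub>U\<close> of a periodic function \<open>f\<close> is the restriction of \<open>f\<close> to \<open>U\<close>, whence
  the integrand \<open>f (\<gamma>\<^sup>-\<^sup>1 x)\<close> on \<open>\<gamma> U\<close>. The point at infinity has measure 0.
\<close>

definition weighted_integral ::
    "'a::nonarch_local_field measure \<Rightarrow> ('a^2^2) set set \<Rightarrow> 'a set set \<Rightarrow> real
      \<Rightarrow> ('a option \<Rightarrow> complex) \<Rightarrow> complex" where
  "weighted_integral \<mu> \<Gamma> \<U> s f =
     (\<Sum>U\<in>\<U>. \<Sum>\<^sub>\<infinity>\<gamma>\<in>\<Gamma>. complex_of_real (weight s \<gamma> U) *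
        (LINT x : finite_points (act \<gamma> ` Some ` U) | \<mu>. f (act (inv\<^bsub>PGL2\<^esub> \<gamma>) (Some x))))"

text \<open>
  The same integral for non-negative functions, with values in \<open>[0, \<infinity>]\<close>. It is needed to express
  finiteness, since divergent Bochner integrals and infinite sums are 0 by convention.
\<close>

definition weighted_nn_integral ::
    "'a::nonarch_local_field measure \<Rightarrow> ('a^2^2) set set \<Rightarrow> 'a set set \<Rightarrow> real
      \<Rightarrow> ('a option \<Rightarrow> ennreal) \<Rightarrow> ennreal" where
  "weighted_nn_integral \<mu> \<Gamma> \<U> s f =
     (\<Sum>U\<in>\<U>. \<Sum>\<^sub>\<infinity>\<gamma>\<in>\<Gamma>. ennreal (weight s \<gamma> U) *
        (\<integral>\<^sup>+x\<in>finite_points (act \<gamma> ` Some ` U). f (act (inv\<^bsub>PGL2\<^esub> \<gamma>) (Some x)) \<partial>\<mu>))"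

definition measurable_on_domain ::
    "('a::nonarch_local_field^2^2) set set \<Rightarrow> ('a option \<Rightarrow> complex) \<Rightarrow> bool" where
  "measurable_on_domain \<Gamma> f \<longleftrightarrow>
     (\<lambda>x. f (Some x)) \<in> borel_measurable (restrict_space borel (finite_points (regular_domain \<Gamma>)))"

definition weighted_integrable ::
    "'a::nonarch_local_field measure \<Rightarrow> ('a^2^2) set set \<Rightarrow> 'a set set \<Rightarrow> real
      \<Rightarrow> ('a option \<Rightarrow> complex) \<Rightarrow> bool" where
  "weighted_integrable \<mu> \<Gamma> \<U> s f \<longleftrightarrow>
     measurable_on_domain \<Gamma> f \<and>
     weighted_nn_integral \<mu> \<Gamma> \<U> s (\<lambda>x. ennreal (norm (f x))) < \<infinity>"

definition ip ::
    "'a::nonarch_local_field measure \<Rightarrow> ('a^2^2) set set \<Rightarrow> 'a set set \<Rightarrow> real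
      \<Rightarrow> ('a option \<Rightarrow> complex) \<Rightarrow> ('a option \<Rightarrow> complex) \<Rightarrow> complex" where
  "ip \<mu> \<Gamma> \<U> s f g = weighted_integral \<mu> \<Gamma> \<U> s (\<lambda>x. f x * cnj (g x))"

definition L2_norm ::
    "'a::nonarch_local_field measure \<Rightarrow> ('a^2^2) set set \<Rightarrow> 'a set set \<Rightarrow> real
      \<Rightarrow> ('a option \<Rightarrow> complex) \<Rightarrow> real" where
  "L2_norm \<mu> \<Gamma> \<U> s f = sqrt (Re (ip \<mu> \<Gamma> \<U> s f f))"

text \<open>The elements of the Hilbert space are the functions below up to equality almost everywhere.\<close>

definition L2_space ::
    "'a::nonarch_local_field measure \<Rightarrow> ('a^2^2) set set \<Rightarrow> 'a set set \<Rightarrow> real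
      \<Rightarrow> ('a option \<Rightarrow> complex) set" where
  "L2_space \<mu> \<Gamma> \<U> s =
     {f. periodic \<Gamma> \<U> f \<and> measurable_on_domain \<Gamma> f \<and>
         weighted_nn_integral \<mu> \<Gamma> \<U> s (\<lambda>x. ennreal ((norm (f x))\<^sup>2)) < \<infinity>}"

definition ae_eq ::
    "'a::nonarch_local_field measure \<Rightarrow> ('a^2^2) set set
      \<Rightarrow> ('a option \<Rightarrow> complex) \<Rightarrow> ('a option \<Rightarrow> complex) \<Rightarrow> bool" where
  "ae_eq \<mu> \<Gamma> f g \<longleftrightarrow>
     (AE x in \<mu>. Some x \<in> regular_domain \<Gamma> \<longrightarrow> f (Some x) = g (Some x))"


section \<open>The operator\<close>

definition kernel ::
    "('a::nonarch_local_field^2^2) set set \<Rightarrow> 'a set set \<Rightarrow> ('a set \<Rightarrow> 'a set \<Rightarrow> real) \<Rightarrow> real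
      \<Rightarrow> 'a option \<Rightarrow> 'a option \<Rightarrow> real" where
  "kernel \<Gamma> \<U> A \<alpha> x y =
     (\<Sum>U\<in>\<U>. \<Sum>V\<in>\<U>. A U V *
        (\<Sum>\<^sub>\<infinity>(\<gamma>, \<delta>)\<in>\<Gamma> \<times> \<Gamma>.
           absK (the (act (inv\<^bsub>PGL2\<^esub> \<gamma>) x) - the (act (inv\<^bsub>PGL2\<^esub> \<delta>) y)) powr \<alpha>
           * indicator (act \<gamma> ` Some ` U) x * indicator (act \<delta> ` Some ` V) y))"

definition D_integrand ::
    "('a::nonarch_local_field^2^2) set set \<Rightarrow> 'a set set \<Rightarrow> ('a set \<Rightarrow> 'a set \<Rightarrow> real) \<Rightarrow> real
      \<Rightarrow> ('a option \<Rightarrow> complex) \<Rightarrow> 'a option \<Rightarrow> 'a option \<Rightarrow> complex" where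
  "D_integrand \<Gamma> \<U> A \<alpha> f x y = complex_of_real (kernel \<Gamma> \<U> A \<alpha> x y) * (f y - f x)"

definition D_operator ::
    "'a::nonarch_local_field measure \<Rightarrow> ('a^2^2) set set \<Rightarrow> 'a set set \<Rightarrow> real
      \<Rightarrow> ('a set \<Rightarrow> 'a set \<Rightarrow> real) \<Rightarrow> real
      \<Rightarrow> ('a option \<Rightarrow> complex) \<Rightarrow> 'a option \<Rightarrow> complex" where
  "D_operator \<mu> \<Gamma> \<U> s A \<alpha> f x = weighted_integral \<mu> \<Gamma> \<U> s (D_integrand \<Gamma> \<U> A \<alpha> f x)"

text \<open>
  Operators on a space given by a set \<open>H\<close> of representatives modulo an equivalence \<open>eqv\<close>.
\<close>

definition bounded_linear_operator_on ::
    "('x \<Rightarrow> complex) set \<Rightarrow> (('x \<Rightarrow> complex) \<Rightarrow> ('x \<Rightarrow> complex) \<Rightarrow> bool)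
      \<Rightarrow> (('x \<Rightarrow> complex) \<Rightarrow> real) \<Rightarrow> (('x \<Rightarrow> complex) \<Rightarrow> 'x \<Rightarrow> complex) \<Rightarrow> bool" where
  "bounded_linear_operator_on H eqv nrm T \<longleftrightarrow>
     (\<forall>f\<in>H. T f \<in> H) \<and>
     (\<forall>f\<in>H. \<forall>g\<in>H. eqv f g \<longrightarrow> eqv (T f) (T g)) \<and>
     (\<forall>f\<in>H. \<forall>g\<in>H. \<forall>a b. eqv (T (\<lambda>x. a * f x + b * g x)) (\<lambda>x. a * T f x + b * T g x)) \<and>
     (\<exists>C. \<forall>f\<in>H. nrm (T f) \<le> C * nrm f)"

text \<open>
  The graph of the adjoint of \<open>T\<close> consists of the pairs \<open>(g, h)\<close> with \<open>\<langle>T f, g\<rangle> = \<langle>f, h\<rangle>\<close> for all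
  \<open>f\<close>; the operator is self-adjoint if this is the graph of \<open>T\<close>.
\<close>

definition self_adjoint_on ::
    "('x \<Rightarrow> complex) set \<Rightarrow> (('x \<Rightarrow> complex) \<Rightarrow> ('x \<Rightarrow> complex) \<Rightarrow> bool)
      \<Rightarrow> (('x \<Rightarrow> complex) \<Rightarrow> ('x \<Rightarrow> complex) \<Rightarrow> complex)
      \<Rightarrow> (('x \<Rightarrow> complex) \<Rightarrow> 'x \<Rightarrow> complex) \<Rightarrow> bool" where
  "self_adjoint_on H eqv inner_prod T \<longleftrightarrow>
     (\<forall>g\<in>H. \<forall>h\<in>H. (\<forall>f\<in>H. inner_prod (T f) g = inner_prod f h) \<longleftrightarrow> eqv h (T g))"

end

theory Submission
  imports Defs
begin

text \<open>
  Every point of the regular domain is \<open>\<gamma>y\<close> for exactly one \<open>\<gamma> \<in> \<Gamma>\<close> and \<open>y \<in> F\<close>, and a periodic function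
  satisfies \<open>f (\<gamma>y) = f y\<close>. All weighted integrals are therefore integrals over \<open>F\<close> against one measure
  \<open>\<nu>\<close>: on a cell \<open>U\<close> it is the sum over \<open>\<gamma>\<close> of the weight of \<open>(\<gamma>, U)\<close> times the
  Haar measure pulled back by \<open>\<gamma>\<close>. On \<open>F\<close> the null sets of \<open>\<nu>\<close> and of the Haar measure agree, because the
  identity contributes a positive multiple of the Haar measure and Moebius maps preserve null sets
  (\<open>null_iff\<close>). So the Hilbert space is \<open>L\<^sup>2(F, \<nu>)\<close>.

  In a verticial covering the distance \<open>\<bar>x - y\<bar>\<close> depends only on the cells of \<open>x\<close> and \<open>y\<close> if these differ,
  and the diagonal entries of \<open>A\<close> vanish. The kernel is thus a symmetric matrix \<open>c\<close> indexed by the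
  finitely many cells (\<open>kernel_eq_coeff\<close>), and on \<open>U\<close> the operator is
  \<open>\<D> f = (\<Sum>V. c U V * (\<integral>\<^bsub>V\<^esub> f d\<nu> - \<nu>(V) f))\<close>. If \<open>\<nu>\<close> is finite, boundedness follows from the
  Cauchy-Schwarz inequality, and symmetry from that of \<open>c\<close> after expanding both inner products
  (\<open>block_op_bounded\<close>, \<open>block_op_symmetric\<close>).

  The measure \<open>\<nu>\<close> can be infinite, for instance if \<open>\<infinity>\<close> is fixed by a hyperbolic element of a
  non-cyclic \<open>\<Gamma>\<close>. Then it is infinite on every Borel subset of \<open>F\<close> of positive Haar measure
  (\<open>cell_measure_dichotomy\<close>), the Hilbert space is \<open>{0}\<close>, and the assertion is trivial. The dichotomy rests on a distortion estimate: a pole of \<open>\<gamma>\<close>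
  outside the open compact set \<open>F\<close> keeps a distance \<open>\<epsilon>\<close> from all points of \<open>F\<close>, with \<open>\<epsilon>\<close> independent of \<open>\<gamma>\<close>,
  so that \<open>\<bar>\<gamma>'\<bar>\<close> varies on \<open>F\<close> by at most a factor independent of \<open>\<gamma>\<close> (\<open>den_uniformly_comparable\<close>). Hence the
  contributions of \<open>\<gamma>\<close> to \<open>\<nu>(V)\<close> and to \<open>\<nu>(E)\<close> are comparable for any cell \<open>V\<close> and any \<open>E\<close> of positive
  measure. Since the translates of \<open>F\<close> are disjoint, at most one \<open>\<gamma>\<close> has a pole in \<open>F\<close>, and its
  contribution is finite because its weight vanishes on the cell that contains the pole.
\<close>

section \<open>Ultrametric geometry\<close>

lemma absK_eq_dist: "absK (x::'a::nonarch_local_field) = dist x 0"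
  using dist_absK[of x 0] by simp

lemma absK_nonneg [simp]: "0 \<le> absK (x::'a::nonarch_local_field)"
  by (simp add: absK_eq_dist)

lemma absK_0 [simp]: "absK (0::'a::nonarch_local_field) = 0"
  by (simp add: absK_eq_dist)

lemma absK_eq_0_iff [simp]: "absK (x::'a::nonarch_local_field) = 0 \<longleftrightarrow> x = 0"
  by (simp add: absK_eq_dist)

lemma absK_pos_iff [simp]: "0 < absK (x::'a::nonarch_local_field) \<longleftrightarrow> x \<noteq> 0"
  using absK_nonneg[of x] absK_eq_0_iff[of x] by linarith

lemma absK_1 [simp]: "absK (1::'a::nonarch_local_field) = 1"
  using absK_mult[of "1::'a" 1] absK_eq_0_iff[of "1::'a"] by simp

lemma absK_minus_commute: "absK (x - y) = absK (y - (x::'a::nonarch_local_field))"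
  by (metis dist_absK dist_commute)

lemma absK_minus: "absK (- x) = absK (x::'a::nonarch_local_field)"
  using absK_minus_commute[of 0 x] by simp

lemma absK_power [simp]: "absK ((x::'a::nonarch_local_field) ^ n) = absK x ^ n"
  by (induction n) (simp_all add: absK_mult)

lemma absK_inverse [simp]: "absK (inverse (x::'a::nonarch_local_field)) = inverse (absK x)"
proof (cases "x = 0")
  case False
  then have "absK x * absK (inverse x) = 1"
    by (simp flip: absK_mult)
  then show ?thesis
    by (metis inverse_unique)
qed simp

lemma absK_divide: "absK ((x::'a::nonarch_local_field) / y) = absK x / absK y"
  by (simp add: divide_inverse absK_mult)

lemma dist_ultrametric: "dist x z \<le> max (dist x y) (dist y (z::'a::nonarch_local_field))"
  using absK_ultrametric[of "x - y" "y - z"] by (simp add: dist_absK)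

lemma dist_eq_of_less: "dist x y < dist y z \<Longrightarrow> dist x z = dist y (z::'a::nonarch_local_field)"
  using dist_ultrametric[of x z y] dist_ultrametric[of y z x] by (auto simp: dist_commute max_def split: if_splits)

lemma dist_mult_left: "dist (a * x) (a * y) = absK a * dist x (y::'a::nonarch_local_field)"
  by (simp add: dist_absK absK_mult flip: right_diff_distrib)

lemma dist_add_left [simp]: "dist (a + x) (a + y) = dist x (y::'a::nonarch_local_field)"
  by (simp add: dist_absK)

lemma cball_eq_of_mem: "y \<in> cball x r \<Longrightarrow> cball y r = cball (x::'a::nonarch_local_field) r"
proof -
  have "cball y r \<subseteq> cball x r" if "dist x y \<le> r" for x y :: 'a
    using that order_trans[OF dist_ultrametric[of x _ y]] by (auto)
  then show "y \<in> cball x r \<Longrightarrow> cball y r = cball x r"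
    by (metis dist_commute mem_cball subset_antisym)
qed

lemma disjnt_or_eq_cball: "cball x r \<inter> cball y r = {} \<or> cball x r = cball (y::'a::nonarch_local_field) r"
  using cball_eq_of_mem by blast

lemma cball_nested:
  assumes "cball x r \<inter> cball y t \<noteq> {}" "r \<le> t"
  shows "cball x r \<subseteq> cball (y::'a::nonarch_local_field) t"
proof -
  obtain z where z: "z \<in> cball x r" "z \<in> cball y t" using assms(1) by blast
  have "cball x r = cball z r" "cball y t = cball z t" using z cball_eq_of_mem by metis+
  then show ?thesis using assms(2) by (simp add: subset_cball)
qed

lemma open_cball: "r > 0 \<Longrightarrow> open (cball (x::'a::nonarch_local_field) r)"
  unfolding open_contains_cball using cball_eq_of_mem by blast

lemma image_mult_cball:
  assumes "a \<noteq> (0::'a::nonarch_local_field)"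
  shows "(*) a ` cball x r = cball (a * x) (absK a * r)"
proof
  show "(*) a ` cball x r \<subseteq> cball (a * x) (absK a * r)"
    by (auto simp: dist_mult_left mult_left_mono)
  show "cball (a * x) (absK a * r) \<subseteq> (*) a ` cball x r"
  proof
    fix y assume "y \<in> cball (a * x) (absK a * r)"
    then have "dist (a * x) (a * (y / a)) \<le> absK a * r" using assms by simp
    then have "y / a \<in> cball x r"
      using assms unfolding dist_mult_left by simp
    then show "y \<in> (*) a ` cball x r" using assms by (intro image_eqI[of _ _ "y / a"]) auto
  qed
qed

lemma image_add_cball: "(+) a ` cball x r = cball (a + x) (r::real)" for a x :: "'a::nonarch_local_field"
proof
  show "cball (a + x) r \<subseteq> (+) a ` cball x r"
  proof
    fix y assume "y \<in> cball (a + x) r"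
    then have "dist (a + x) (a + (y - a)) \<le> r" by simp
    then show "y \<in> (+) a ` cball x r" using dist_add_left[of a x "y - a"] by (intro image_eqI[of _ _ "y - a"]) auto
  qed
qed auto

definition contractor :: "'a::nonarch_local_field" where
  "contractor = (SOME p. 0 < absK p \<and> absK p < 1)"

lemma contractor: "0 < absK (contractor::'a::nonarch_local_field)" "absK (contractor::'a) < 1"
proof -
  obtain x :: 'a where x: "absK x \<noteq> 0" "absK x \<noteq> 1" using absK_nontrivial by blast
  have "\<exists>p::'a. 0 < absK p \<and> absK p < 1"
  proof (cases "absK x < 1")
    case True with x show ?thesis by (intro exI[of _ x]) auto
  next
    case False with x show ?thesis by (intro exI[of _ "inverse x"]) (auto simp: inverse_less_1_iff)
  qed
  from someI_ex[OF this] show "0 < absK (contractor::'a)" "absK (contractor::'a) < 1"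
    unfolding contractor_def by auto
qed

lemma contractor_nonzero [simp]: "(contractor::'a::nonarch_local_field) \<noteq> 0"
  using contractor(1)[where 'a='a] by simp

lemma contractor_power_less: "0 < e \<Longrightarrow> \<exists>n. absK ((contractor::'a::nonarch_local_field) ^ n) < e"
  using real_arch_pow_inv[of e "absK (contractor::'a)"] contractor(2)[where 'a='a] by simp

lemma ex_absK_ge: "\<exists>t::'a::nonarch_local_field. t \<noteq> 0 \<and> absK t \<ge> C"
proof -
  have "1 < inverse (absK (contractor::'a))" using contractor[where 'a='a] by (simp add: one_less_inverse)
  then obtain n where "C < inverse (absK (contractor::'a)) ^ n" using real_arch_pow by blast
  then show ?thesis by (intro exI[of _ "inverse (contractor::'a) ^ n"]) auto
qed

text \<open>
  Local compactness provides one compact ball, and scaling turns it into arbitrarily large ones.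
\<close>

lemma compact_cball_local_field: "compact (cball (x::'a::nonarch_local_field) r)"
proof -
  obtain U C where UC: "open U" "compact C" "(0::'a) \<in> U" "U \<subseteq> C"
    using locally_compact by blast
  then obtain e where e: "e > 0" "cball (0::'a) e \<subseteq> U" using open_contains_cball by metis
  have ce: "compact (cball (0::'a) e)"
    using compact_Int_closed[OF UC(2) closed_cball, of 0 e] e UC(4) by (metis inf.absorb_iff2 order_trans)
  obtain t :: 'a where t: "t \<noteq> 0" "absK t \<ge> r / e" using ex_absK_ge by blast
  let ?f = "\<lambda>y. x + t * y"
  have "continuous_on UNIV ?f"
    unfolding continuous_on_iff
  proof (intro ballI allI impI)
    fix y :: 'a and d :: real assume "d > 0"
    then show "\<exists>d'>0. \<forall>z\<in>UNIV. dist z y < d' \<longrightarrow> dist (x + t * z) (x + t * y) < d"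
      using t(1) by (intro exI[of _ "d / absK t"]) (auto simp: dist_mult_left[of t, unfolded mult.commute[of "absK t"]] pos_less_divide_eq)
  qed
  then have "compact (?f ` cball 0 e)"
    using ce compact_continuous_image continuous_on_subset by blast
  also have "?f ` cball 0 e = (+) x ` ((*) t ` cball 0 e)" by (simp add: image_image)
  also have "\<dots> = cball x (absK t * e)" using t by (simp add: image_mult_cball image_add_cball)
  finally have c: "compact (cball x (absK t * e))" .
  have "r \<le> absK t * e" using t e by (simp add: field_simps)
  then have "cball x r \<subseteq> cball x (absK t * e)" by (rule subset_cball)
  then show ?thesis using c compact_Int_closed[OF c closed_cball, of x r] by (simp add: inf.absorb2)
qed

text \<open>
  Completeness and second countability make the library theorem on the regularity of finite Borel
  measures applicable.
\<close>

instance nonarch_local_field \<subseteq> complete_space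
proof
  fix X :: "nat \<Rightarrow> 'a" assume X: "Cauchy X"
  then obtain N where N: "\<And>m n. m \<ge> N \<Longrightarrow> n \<ge> N \<Longrightarrow> dist (X m) (X n) < 1"
    by (metis Cauchy_def zero_less_one)
  have "complete (cball (X N) 1)" by (simp add: compact_cball_local_field compact_imp_complete)
  moreover have "Cauchy (\<lambda>n. X (n + N))" using X Cauchy_subseq_Cauchy[OF X, of "\<lambda>n. n + N"]
    by (simp add: strict_mono_def o_def)
  moreover have "X (n + N) \<in> cball (X N) 1" for n using N[of N "n + N"] by simp
  ultimately obtain l where "(\<lambda>n. X (n + N)) \<longlonglongrightarrow> l" unfolding complete_def by meson
  then show "convergent X" by (metis LIMSEQ_offset convergent_def)
qed

instance nonarch_local_field \<subseteq> second_countable_topology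
proof
  \<comment> \<open>Every ball of integer radius is covered by finitely many balls of radius \<open>?c n\<close>, for each \<open>n\<close>.\<close>
  let ?c = "\<lambda>n. absK ((contractor::'a) ^ n)"
  have "\<exists>D. finite D \<and> D \<subseteq> cball (0::'a) (real m) \<and> cball 0 (real m) \<subseteq> (\<Union>x\<in>D. cball x (?c n))" for m n :: nat
  proof -
    have "cball (0::'a) (real m) \<subseteq> (\<Union>x\<in>cball 0 (real m). cball x (?c n))" by force
    then show ?thesis
      using compactE_image[OF compact_cball_local_field[of "0::'a" "real m"], of "cball 0 (real m)" "\<lambda>x. cball x (?c n)"]
      using open_cball by (metis contractor_nonzero absK_pos_iff power_not_zero)
  qed
  then obtain D where D: "\<And>m n. finite (D m n)" "\<And>m n. cball (0::'a) (real m) \<subseteq> (\<Union>x\<in>D m n. cball x (?c n))"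
    by metis
  define B where "B = (\<Union>m. \<Union>n. (\<lambda>x. cball x (?c n)) ` D m n)"
  have "countable B" unfolding B_def by (intro countable_UN countable_image) (auto simp: D(1) countable_finite)
  moreover have "open = generate_topology B"
  proof (rule ext)
    fix S :: "'a set"
    have gen: "generate_topology B S" if "open S"
    proof -
      have "\<exists>b\<in>B. x \<in> b \<and> b \<subseteq> S" if "x \<in> S" for x
      proof -
        obtain e where e: "e > 0" "cball x e \<subseteq> S" using \<open>open S\<close> \<open>x \<in> S\<close> open_contains_cball by metis
        obtain n where n: "?c n < e" using contractor_power_less[OF e(1)] by blast
        obtain m :: nat where m: "dist 0 x \<le> real m" using real_arch_simple by blast
        then obtain y where y: "y \<in> D m n" "x \<in> cball y (?c n)" using D(2)[of m n] by auto
        then have "cball y (?c n) = cball x (?c n)" by (metis cball_eq_of_mem)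
        also have "\<dots> \<subseteq> S" using n e(2) subset_cball[of "?c n" e x] by auto
        finally show ?thesis using y unfolding B_def by blast
      qed
      then have "S = \<Union>{b\<in>B. b \<subseteq> S}" by blast
      moreover have "generate_topology B (\<Union>{b\<in>B. b \<subseteq> S})"
        by (rule generate_topology.UN) (auto intro: generate_topology.Basis)
      ultimately show ?thesis by simp
    qed
    have "open S" if "generate_topology B S"
      using that
    proof induction
      case (Basis s)
      then show ?case unfolding B_def
        by (auto intro!: open_cball simp: contractor)
    qed auto
    with gen show "open S = generate_topology B S" by blast
  qed
  ultimately show "\<exists>B::'a set set. countable B \<and> open = generate_topology B" by blast
qed

section \<open>Haar measure and maps with bounded distortion\<close>

lemma haar_measureD:
  assumes "haar_measure (\<mu> :: 'a::nonarch_local_field measure)"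
  shows "sets \<mu> = sets borel" "space \<mu> = UNIV"
    "compact C \<Longrightarrow> emeasure \<mu> C < \<infinity>"
    "emeasure \<mu> (cball 0 1) = 1"
    "emeasure \<mu> (cball x r) = emeasure \<mu> (cball 0 r)"
proof -
  show s: "sets \<mu> = sets borel" using assms by (simp add: haar_measure_def)
  show "space \<mu> = UNIV" using s sets_eq_imp_space_eq by fastforce
  show "compact C \<Longrightarrow> emeasure \<mu> C < \<infinity>" using assms by (simp add: haar_measure_def)
  have "{x. absK x \<le> 1} = cball (0::'a) 1" by (auto simp: absK_eq_dist dist_commute)
  then show "emeasure \<mu> (cball 0 1) = 1" using assms by (simp add: haar_measure_def)
  have "emeasure \<mu> ((+) x ` cball 0 r) = emeasure \<mu> (cball 0 r)"
    using assms unfolding haar_measure_def by (meson borel_closed closed_cball)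
  then show "emeasure \<mu> (cball x r) = emeasure \<mu> (cball 0 r)" by (simp add: image_add_cball)
qed

text \<open>
  The factor by which multiplication by \<open>a\<close> scales the Haar measure. As the absolute value is not
  normalised, this need not be \<open>\<bar>a\<bar>\<close>; what matters is that it is multiplicative.
\<close>

definition haar_modulus :: "'a::nonarch_local_field measure \<Rightarrow> 'a \<Rightarrow> ennreal" where
  "haar_modulus \<mu> a = emeasure \<mu> (cball 0 (absK a))"

lemma haar_modulus_finite: "haar_measure \<mu> \<Longrightarrow> haar_modulus \<mu> a < \<infinity>"
  unfolding haar_modulus_def by (intro haar_measureD compact_cball_local_field)

lemma haar_modulus_1: "haar_measure \<mu> \<Longrightarrow> haar_modulus \<mu> 1 = 1"
  unfolding haar_modulus_def by (simp add: haar_measureD(4))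

text \<open>
  The number \<open>n\<close> is the index of \<open>bO\<close> in the unit ball \<open>O\<close>: multiplication by \<open>a\<close> maps the partition
  of \<open>O\<close> into cosets of \<open>bO\<close> to a partition of \<open>aO\<close> into translates of \<open>abO\<close>.
\<close>

lemma haar_modulus_index:
  assumes \<mu>: "haar_measure \<mu>" and b: "b \<noteq> (0::'a::nonarch_local_field)" "absK b \<le> 1"
  shows "\<exists>n::nat. \<forall>a. a \<noteq> 0 \<longrightarrow> haar_modulus \<mu> a = of_nat n * haar_modulus \<mu> (a * b)"
proof -
  define \<B> where "\<B> = (\<lambda>x. cball x (absK b)) ` cball (0::'a) 1"
  have disj: "X \<inter> Y = {} \<or> X = Y" if "X \<in> \<B>" "Y \<in> \<B>" for X Y
    using that disjnt_or_eq_cball unfolding \<B>_def by blast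
  have ne: "X \<noteq> {}" if "X \<in> \<B>" for X
    using that centre_in_cball absK_nonneg[of b] unfolding \<B>_def by blast
  have cov: "\<Union>\<B> = cball 0 1"
  proof
    show "\<Union>\<B> \<subseteq> cball 0 1"
    proof
      fix z assume "z \<in> \<Union>\<B>"
      then obtain x where x: "x \<in> cball 0 1" "z \<in> cball x (absK b)" unfolding \<B>_def by auto
      then have "dist 0 z \<le> max (dist 0 x) (dist x z)" by (simp add: dist_ultrametric)
      then show "z \<in> cball 0 1" using x b by auto
    qed
    show "cball 0 1 \<subseteq> \<Union>\<B>" unfolding \<B>_def by force
  qed
  have opn: "\<forall>X\<in>\<B>. open X" using b open_cball[of "absK b"] unfolding \<B>_def by auto
  obtain \<B>' where \<B>': "\<B>' \<subseteq> \<B>" "finite \<B>'" "cball 0 1 \<subseteq> \<Union>\<B>'"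
    using compactE[OF compact_cball_local_field, of 0 1 \<B>] cov opn by (metis subset_refl)
  have "\<B> \<subseteq> \<B>'"
  proof
    fix X assume X: "X \<in> \<B>"
    obtain z where "z \<in> X" using ne[OF X] by blast
    moreover then obtain Y where "Y \<in> \<B>'" "z \<in> Y" using \<B>' X cov by blast
    ultimately show "X \<in> \<B>'" using disj[OF X, of Y] \<B>'(1) by blast
  qed
  then have fin: "finite \<B>" using \<B>' finite_subset by blast
  have "haar_modulus \<mu> a = of_nat (card \<B>) * haar_modulus \<mu> (a * b)" if a: "a \<noteq> 0" for a
  proof -
    have img: "\<exists>x. (*) a ` X = cball (a * x) (absK (a * b))" if "X \<in> \<B>" for X
      using that image_mult_cball[OF a] unfolding \<B>_def by (auto simp: absK_mult)
    have "disjoint_family_on (\<lambda>X. (*) a ` X) \<B>"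
      unfolding disjoint_family_on_def
    proof (intro ballI impI)
      fix X Y assume "X \<in> \<B>" "Y \<in> \<B>" "X \<noteq> Y"
      then have "X \<inter> Y = {}" using disj by blast
      then show "(*) a ` X \<inter> (*) a ` Y = {}" using a by auto
    qed
    moreover have "(\<lambda>X. (*) a ` X) ` \<B> \<subseteq> sets \<mu>"
      using img haar_measureD(1)[OF \<mu>] by fastforce
    ultimately have "(\<Sum>X\<in>\<B>. emeasure \<mu> ((*) a ` X)) = emeasure \<mu> (\<Union>X\<in>\<B>. (*) a ` X)"
      using fin by (intro sum_emeasure)
    also have "(\<Union>X\<in>\<B>. (*) a ` X) = (*) a ` cball 0 1" using cov by (metis image_Union)
    also have "\<dots> = cball 0 (absK a)" using image_mult_cball[OF a, of 0 1] by simp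
    also have "(\<Sum>X\<in>\<B>. emeasure \<mu> ((*) a ` X)) = (\<Sum>X\<in>\<B>. haar_modulus \<mu> (a * b))"
    proof (rule sum.cong[OF refl])
      fix X assume "X \<in> \<B>"
      then obtain x where "(*) a ` X = cball (a * x) (absK (a * b))" using img by blast
      then show "emeasure \<mu> ((*) a ` X) = haar_modulus \<mu> (a * b)"
        unfolding haar_modulus_def using haar_measureD(5)[OF \<mu>, of "a * x"] by simp
    qed
    finally show ?thesis by (simp add: haar_modulus_def)
  qed
  then show ?thesis by blast
qed

lemma haar_modulus_mult:
  assumes \<mu>: "haar_measure \<mu>" and "a \<noteq> (0::'a::nonarch_local_field)" "b \<noteq> 0"
  shows "haar_modulus \<mu> (a * b) = haar_modulus \<mu> a * haar_modulus \<mu> b"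
proof -
  have *: "haar_modulus \<mu> (a * b) = haar_modulus \<mu> a * haar_modulus \<mu> b"
    if ab: "a \<noteq> 0" "b \<noteq> 0" "absK b \<le> 1" for a b
  proof -
    obtain n :: nat where n: "\<And>a. a \<noteq> 0 \<Longrightarrow> haar_modulus \<mu> a = of_nat n * haar_modulus \<mu> (a * b)"
      using haar_modulus_index[OF \<mu> ab(2,3)] by blast
    have 1: "of_nat n * haar_modulus \<mu> b = 1" using n[of 1] haar_modulus_1[OF \<mu>] by simp
    have "haar_modulus \<mu> a * haar_modulus \<mu> b = haar_modulus \<mu> (a * b) * (of_nat n * haar_modulus \<mu> b)"
      unfolding n[OF ab(1)] by (simp add: ac_simps)
    then show ?thesis using 1 by simp
  qed
  show ?thesis
  proof (cases "absK b \<le> 1")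
    case False
    then have i: "inverse b \<noteq> 0" "absK (inverse b) \<le> 1" using assms by (auto simp: inverse_le_1_iff)
    have 1: "haar_modulus \<mu> (inverse b) * haar_modulus \<mu> b = 1"
      using *[of b "inverse b"] assms i by (simp add: haar_modulus_1 mult.commute)
    have "haar_modulus \<mu> a = haar_modulus \<mu> (a * b) * haar_modulus \<mu> (inverse b)"
      using *[of "a * b" "inverse b"] assms i by (simp add: mult.assoc)
    then have "haar_modulus \<mu> a * haar_modulus \<mu> b = haar_modulus \<mu> (a * b) * (haar_modulus \<mu> (inverse b) * haar_modulus \<mu> b)"
      by (simp add: ac_simps)
    then show ?thesis using 1 by simp
  qed (use assms * in auto)
qed

lemma haar_modulus_inverse:
  assumes "haar_measure \<mu>" "a \<noteq> (0::'a::nonarch_local_field)"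
  shows "haar_modulus \<mu> a * haar_modulus \<mu> (inverse a) = 1"
  using haar_modulus_mult[OF assms, of "inverse a"] assms by (simp add: haar_modulus_1)

lemma emeasure_countable_Union_le:
  assumes "countable I" "\<And>i. i \<in> I \<Longrightarrow> Z i \<in> sets M"
  shows "emeasure M (\<Union>i\<in>I. Z i) \<le> (\<integral>\<^sup>+i. emeasure M (Z i) \<partial>count_space I)"
proof -
  have m: "(\<Union>i\<in>I. Z i) \<in> sets M" using assms by auto
  have "emeasure M (\<Union>i\<in>I. Z i) = (\<integral>\<^sup>+x. indicator (\<Union>i\<in>I. Z i) x \<partial>M)" using m by simp
  also have "\<dots> \<le> (\<integral>\<^sup>+x. \<integral>\<^sup>+i. indicator (Z i) x \<partial>count_space I \<partial>M)"
  proof (intro nn_integral_mono)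
    fix x
    show "(indicator (\<Union>i\<in>I. Z i) x :: ennreal) \<le> (\<integral>\<^sup>+i. indicator (Z i) x \<partial>count_space I)"
    proof (cases "x \<in> (\<Union>i\<in>I. Z i)")
      case True
      then obtain i where i: "i \<in> I" "x \<in> Z i" by blast
      have "(indicator (Z i) x :: ennreal) \<le> (\<integral>\<^sup>+i. indicator (Z i) x \<partial>count_space I)"
        using nn_integral_ge_point[OF i(1), of "\<lambda>i. indicator (Z i) x"] .
      then show ?thesis using i True by simp
    qed simp
  qed
  also have "\<dots> = (\<integral>\<^sup>+i. \<integral>\<^sup>+x. indicator (Z i) x \<partial>M \<partial>count_space I)"
    using assms by (intro nn_integral_count_space_nn_integral) auto
  also have "\<dots> = (\<integral>\<^sup>+i. emeasure M (Z i) \<partial>count_space I)"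
    using assms by (intro nn_integral_cong) auto
  finally show ?thesis .
qed

text \<open>
  A bound for the images of small balls extends to all bounded Borel sets. By outer regularity \<open>E\<close> may
  be replaced by an open set, and in an ultrametric space an open set is a countable disjoint union of
  balls whose radii are powers of \<open>\<bar>contractor\<bar>\<close>, namely of the largest ones that it contains.
\<close>

lemma emeasure_image_le:
  fixes \<phi> :: "'a::nonarch_local_field \<Rightarrow> 'a"
  assumes \<mu>: "haar_measure \<mu>" and E: "E \<in> sets borel" "bounded E" and c: "c < \<infinity>"
    and ball: "\<And>x n. x \<in> E \<Longrightarrow> n \<ge> n0 \<Longrightarrow>
      \<exists>z r. \<phi> ` (E \<inter> cball x (absK ((contractor::'a) ^ n))) \<subseteq> cball z r \<and>
            emeasure \<mu> (cball z r) \<le> c * haar_modulus \<mu> (contractor ^ n)"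
  shows "emeasure \<mu> (\<phi> ` E) \<le> c * emeasure \<mu> E"
proof -
  note [measurable_cong] = haar_measureD(1)[OF \<mu>]
  obtain R0 where R0: "\<forall>y\<in>E. dist 0 y \<le> R0" using E(2) bounded_any_center[of E 0] by blast
  define R where "R = max R0 1"
  have R: "R > 0" "E \<subseteq> cball 0 R" using R0 by (auto simp: R_def)
  \<comment> \<open>Outer regularity is available for finite measures, whence the restriction to a ball.\<close>
  define M where "M = density \<mu> (indicator (cball 0 R))"
  have sM: "sets M = sets borel" unfolding M_def by (simp add: haar_measureD(1)[OF \<mu>])
  have eM: "emeasure M X = emeasure \<mu> (cball 0 R \<inter> X)" if "X \<in> sets borel" for X
  proof -
    have "cball 0 R \<in> sets \<mu>" "X \<in> sets \<mu>" using that haar_measureD(1)[OF \<mu>] by auto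
    moreover from this have "indicator (cball 0 R) \<in> borel_measurable \<mu>"
      by (intro borel_measurable_indicator)
    ultimately have "emeasure M X = (\<integral>\<^sup>+x. indicator (cball 0 R \<inter> X) x \<partial>\<mu>)"
      unfolding M_def indicator_inter_arith by (intro emeasure_density) auto
    also have "\<dots> = emeasure \<mu> (cball 0 R \<inter> X)"
      using \<open>cball 0 R \<in> sets \<mu>\<close> \<open>X \<in> sets \<mu>\<close> by (intro nn_integral_indicator) auto
    finally show ?thesis .
  qed
  have "emeasure M (space M) \<noteq> \<infinity>"
    using eM[of UNIV] haar_measureD(3)[OF \<mu> compact_cball_local_field[of 0 R]] sets_eq_imp_space_eq[OF sM] by simp
  then have outer: "emeasure M E = (INF U \<in> {U. E \<subseteq> U \<and> open U}. emeasure M U)"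
    by (rule outer_regular[OF sM _ E(1)])
  have *: "emeasure \<mu> (\<phi> ` E) \<le> c * emeasure M U" if U: "E \<subseteq> U" "open U" for U
  proof -
    define O' where "O' = cball 0 R \<inter> U"
    have O': "open O'" "E \<subseteq> O'" unfolding O'_def using U R open_cball[OF R(1)] by auto
    let ?B = "\<lambda>x n. cball x (absK ((contractor::'a) ^ n))"
    have mono: "?B x n \<subseteq> ?B x m" if "m \<le> n" for x :: 'a and m n
      by (rule subset_cball) (use that contractor[where 'a='a] in \<open>simp add: power_decreasing\<close>)
    \<comment> \<open>\<open>?B x (N x)\<close> is the largest admissible ball around \<open>x\<close> inside \<open>O'\<close>.\<close>
    define N where "N x = (LEAST n. n \<ge> n0 \<and> ?B x n \<subseteq> O')" for x
    have N: "N x \<ge> n0 \<and> ?B x (N x) \<subseteq> O'" if x: "x \<in> E" for x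
    proof -
      obtain e where e: "e > 0" "cball x e \<subseteq> O'"
        using O'(1) subsetD[OF O'(2) x] open_contains_cball[of O'] by blast
      obtain n where "absK ((contractor::'a) ^ n) < e" using contractor_power_less[OF e(1)] by blast
      then have "?B x n \<subseteq> O'" using e subset_cball[of _ e x] by (metis less_imp_le order_trans)
      then have "max n n0 \<ge> n0 \<and> ?B x (max n n0) \<subseteq> O'" using mono[of n "max n n0" x] by auto
      then show ?thesis unfolding N_def by (rule LeastI)
    qed
    have N_le: "N x \<le> n" if "n \<ge> n0" "?B x n \<subseteq> O'" for x n
      unfolding N_def using that by (intro Least_le) auto
    define \<C> where "\<C> = (\<lambda>x. ?B x (N x)) ` E"
    have same: "?B x (N x) = ?B y (N y)" if "x \<in> E" "y \<in> E" "?B x (N x) \<inter> ?B y (N y) \<noteq> {}" "N y \<le> N x" for x y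
    proof -
      have "?B x (N x) \<subseteq> ?B y (N y)"
        using contractor[where 'a='a] that(4) by (intro cball_nested[OF that(3)]) (auto simp: power_decreasing)
      then have "x \<in> ?B y (N y)" by (meson centre_in_cball absK_nonneg subsetD)
      then have b: "?B x (N y) = ?B y (N y)" by (rule cball_eq_of_mem)
      then have "N x \<le> N y" using N[OF that(2)] by (intro N_le) auto
      then show ?thesis using b that(4) by simp
    qed
    have disj: "X \<inter> Y = {}" if X: "X \<in> \<C>" "Y \<in> \<C>" "X \<noteq> Y" for X Y
    proof (rule ccontr)
      assume "X \<inter> Y \<noteq> {}"
      obtain x y where xy: "x \<in> E" "y \<in> E" "X = ?B x (N x)" "Y = ?B y (N y)" using X unfolding \<C>_def by auto
      show False
        using same[of x y] same[of y x] xy \<open>X \<inter> Y \<noteq> {}\<close> \<open>X \<noteq> Y\<close> by (metis Int_commute linear)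
    qed
    have op: "open X" if "X \<in> \<C>" for X
      using that unfolding \<C>_def by (auto intro!: open_cball simp: contractor)
    have cnt: "countable \<C>"
      by (rule countable_disjoint_open_subsets[OF op]) (auto simp: disjoint_def disj)
    have "\<exists>Z. Z \<in> sets borel \<and> \<phi> ` (E \<inter> X) \<subseteq> Z \<and> emeasure \<mu> Z \<le> c * emeasure \<mu> X" if X: "X \<in> \<C>" for X
    proof -
      obtain x where x: "x \<in> E" "X = ?B x (N x)" using X unfolding \<C>_def by blast
      from ball[OF x(1), of "N x"] N[OF x(1)] obtain z r where
        "\<phi> ` (E \<inter> X) \<subseteq> cball z r" "emeasure \<mu> (cball z r) \<le> c * haar_modulus \<mu> (contractor ^ N x)"
        using x(2) by auto
      moreover have "haar_modulus \<mu> (contractor ^ N x) = emeasure \<mu> X"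
        unfolding haar_modulus_def x(2) by (rule haar_measureD(5)[OF \<mu>, symmetric])
      ultimately show ?thesis by (intro exI[of _ "cball z r"]) auto
    qed
    then obtain Z where Z: "\<And>X. X \<in> \<C> \<Longrightarrow> Z X \<in> sets borel"
      "\<And>X. X \<in> \<C> \<Longrightarrow> \<phi> ` (E \<inter> X) \<subseteq> Z X" "\<And>X. X \<in> \<C> \<Longrightarrow> emeasure \<mu> (Z X) \<le> c * emeasure \<mu> X"
      by metis
    have "\<phi> ` E \<subseteq> (\<Union>X\<in>\<C>. Z X)"
    proof
      fix y assume "y \<in> \<phi> ` E"
      then obtain x where x: "x \<in> E" "y = \<phi> x" by blast
      then have "?B x (N x) \<in> \<C>" "x \<in> ?B x (N x)" unfolding \<C>_def by auto
      then show "y \<in> (\<Union>X\<in>\<C>. Z X)" using Z(2) x by blast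
    qed
    moreover have "(\<Union>X\<in>\<C>. Z X) \<in> sets \<mu>" using cnt Z(1) haar_measureD(1)[OF \<mu>] by auto
    ultimately have "emeasure \<mu> (\<phi> ` E) \<le> emeasure \<mu> (\<Union>X\<in>\<C>. Z X)" by (rule emeasure_mono)
    also have "\<dots> \<le> (\<integral>\<^sup>+X. emeasure \<mu> (Z X) \<partial>count_space \<C>)"
      using cnt Z(1) haar_measureD(1)[OF \<mu>] by (intro emeasure_countable_Union_le) auto
    also have "\<dots> \<le> (\<integral>\<^sup>+X. c * emeasure \<mu> X \<partial>count_space \<C>)"
      using Z(3) by (intro nn_integral_mono) auto
    also have "\<dots> = c * (\<integral>\<^sup>+X. emeasure \<mu> X \<partial>count_space \<C>)" by (simp add: nn_integral_cmult)
    also have "(\<integral>\<^sup>+X. emeasure \<mu> X \<partial>count_space \<C>) = emeasure \<mu> (\<Union>X\<in>\<C>. X)"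
      using cnt op disj haar_measureD(1)[OF \<mu>]
      by (intro emeasure_UN_countable[symmetric]) (auto simp: disjoint_family_on_def)
    also have "\<dots> \<le> emeasure \<mu> O'"
      using N O'(1) haar_measureD(1)[OF \<mu>] unfolding \<C>_def by (intro emeasure_mono) auto
    also have "\<dots> = emeasure M U" unfolding O'_def using eM[of U] U by simp
    finally show ?thesis by (simp add: mult_left_mono)
  qed
  have "emeasure \<mu> (\<phi> ` E) \<le> c * emeasure M E"
  proof (cases "c = 0")
    case True
    then show ?thesis using *[of UNIV] by simp
  next
    case False
    have "emeasure \<mu> (\<phi> ` E) / c \<le> emeasure M E"
      unfolding outer
    proof (rule INF_greatest)
      fix U assume "U \<in> {U. E \<subseteq> U \<and> open U}"
      then show "emeasure \<mu> (\<phi> ` E) / c \<le> emeasure M U"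
        using * False by (intro divide_le_posI_ennreal) (auto simp: zero_less_iff_neq_zero)
    qed
    then have "emeasure \<mu> (\<phi> ` E) / c * c \<le> emeasure M E * c" by (rule mult_right_mono) simp
    moreover have "emeasure \<mu> (\<phi> ` E) / c * c = emeasure \<mu> (\<phi> ` E)"
      unfolding ennreal_divide_times using False c by (simp add: ennreal_divide_self)
    ultimately show ?thesis by (simp add: mult.commute)
  qed
  also have "emeasure M E = emeasure \<mu> E" using eM[OF E(1)] R(2) by (simp add: inf.absorb2)
  finally show ?thesis .
qed

text \<open>
  Lipschitz maps distort measure by the modulus of their Lipschitz constant. Applied to a map and to
  its inverse with constants \<open>\<bar>at\<bar>\<close> and \<open>\<bar>t/a\<bar>\<close>, this determines the distortion up to the modulus of \<open>t\<close>,
  which replaces an exact change of variables.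
\<close>

lemma emeasure_image_scaled_le:
  fixes \<phi> :: "'a::nonarch_local_field \<Rightarrow> 'a"
  assumes \<mu>: "haar_measure \<mu>" and E: "E \<in> sets borel" "bounded E" and "a \<noteq> 0"
    and lip: "\<And>x y. x \<in> E \<Longrightarrow> y \<in> E \<Longrightarrow> dist (\<phi> x) (\<phi> y) \<le> absK a * dist x y"
  shows "emeasure \<mu> (\<phi> ` E) \<le> haar_modulus \<mu> a * emeasure \<mu> E"
proof (rule emeasure_image_le[OF \<mu> E haar_modulus_finite[OF \<mu>], where ?n0.0 = 0])
  fix x n assume x: "x \<in> E"
  have "\<phi> ` (E \<inter> cball x (absK ((contractor::'a) ^ n))) \<subseteq> cball (\<phi> x) (absK (a * contractor ^ n))"
  proof clarify
    fix y assume y: "y \<in> E" "y \<in> cball x (absK ((contractor::'a) ^ n))"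
    have "dist (\<phi> x) (\<phi> y) \<le> absK a * dist x y" by (rule lip[OF x y(1)])
    also have "\<dots> \<le> absK (a * contractor ^ n)" unfolding absK_mult using y by (intro mult_left_mono) auto
    finally show "\<phi> y \<in> cball (\<phi> x) (absK (a * contractor ^ n))" by simp
  qed
  moreover have "emeasure \<mu> (cball (\<phi> x) (absK (a * contractor ^ n))) = haar_modulus \<mu> a * haar_modulus \<mu> (contractor ^ n)"
    unfolding haar_measureD(5)[OF \<mu>, of "\<phi> x"] using haar_modulus_mult[OF \<mu> \<open>a \<noteq> 0\<close>, of "contractor ^ n"]
    by (simp add: haar_modulus_def)
  ultimately show "\<exists>z r. \<phi> ` (E \<inter> cball x (absK ((contractor::'a) ^ n))) \<subseteq> cball z r \<and>
            emeasure \<mu> (cball z r) \<le> haar_modulus \<mu> a * haar_modulus \<mu> (contractor ^ n)"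
    by (metis order_refl)
qed

lemma sigma_finite_haar_measure:
  assumes \<mu>: "haar_measure (\<mu> :: 'a::nonarch_local_field measure)"
  shows "sigma_finite_measure \<mu>"
proof
  have "(\<Union>n::nat. cball (0::'a) (real n)) = UNIV"
    using real_nat_ceiling_ge by (fastforce simp only: set_eq_iff UN_iff mem_cball UNIV_I)
  moreover have fin: "emeasure \<mu> (cball 0 r) \<noteq> \<infinity>" for r
    using haar_measureD(3)[OF \<mu> compact_cball_local_field[of 0 r]] by simp
  ultimately show "\<exists>A. countable A \<and> A \<subseteq> sets \<mu> \<and> \<Union>A = space \<mu> \<and> (\<forall>a\<in>A. emeasure \<mu> a \<noteq> \<infinity>)"
    using haar_measureD(1,2)[OF \<mu>] fin by (intro exI[of _ "range (\<lambda>n::nat. cball (0::'a) (real n))"]) auto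
qed

section \<open>Fractional linear transformations\<close>

lemma mat_mult_commute: "mat c ** (A :: 'a^2^2) = A ** (mat c :: 'a::field^2^2)"
  by (simp add: vec_eq_iff forall_2 matrix_matrix_mult_def mat_def sum_2 mult.commute)

lemma mat_mult_mat: "mat c ** mat d = (mat (c * d) :: 'a::field^2^2)"
  by (simp add: vec_eq_iff forall_2 matrix_matrix_mult_def mat_def sum_2 mult.commute)

lemma group_GL2: "group (GL2 :: ('a::field^2^2) monoid)"
proof (rule groupI)
  fix A B :: "'a^2^2"
  assume "A \<in> carrier GL2" "B \<in> carrier GL2"
  then show "A \<otimes>\<^bsub>GL2\<^esub> B \<in> carrier GL2" by (simp add: GL2_def invertible_mult)
next
  fix A :: "'a^2^2" assume "A \<in> carrier GL2"
  then obtain B where "A ** B = mat 1" "B ** A = mat 1" by (auto simp: GL2_def invertible_def)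
  then show "\<exists>B\<in>carrier GL2. B \<otimes>\<^bsub>GL2\<^esub> A = \<one>\<^bsub>GL2\<^esub>" by (auto simp: GL2_def invertible_def)
qed (auto simp: GL2_def matrix_mul_assoc invertible_def intro: exI[of _ "mat 1"])

lemma normal_scalars: "(scalars :: ('a::field^2^2) set) \<lhd> GL2"
proof -
  interpret group "GL2 :: ('a^2^2) monoid" by (rule group_GL2)
  have inv: "mat c ** mat (inverse c) = (mat 1 :: 'a^2^2)" "mat (inverse c) ** mat c = (mat 1 :: 'a^2^2)" if "c \<noteq> 0" for c
    using that by (simp_all add: mat_mult_mat)
  have sub: "(scalars :: ('a^2^2) set) \<subseteq> carrier GL2"
    using inv by (force simp: scalars_def GL2_def invertible_def)
  have "subgroup (scalars :: ('a^2^2) set) GL2"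
  proof (rule subgroupI[OF sub])
    show "(scalars :: ('a^2^2) set) \<noteq> {}" by (auto simp: scalars_def intro: exI[of _ 1])
  next
    fix A :: "'a^2^2" assume A: "A \<in> scalars"
    then obtain c where c: "A = mat c" "c \<noteq> 0" by (auto simp: scalars_def)
    have "inv\<^bsub>GL2\<^esub> A = mat (inverse c)"
      using inv[OF c(2)] c sub A by (intro inv_equality) (auto simp: GL2_def invertible_def)
    then show "inv\<^bsub>GL2\<^esub> A \<in> scalars" using c by (auto simp: scalars_def)
  next
    fix A B :: "'a^2^2" assume "A \<in> scalars" "B \<in> scalars"
    then obtain c d where "A = mat c" "c \<noteq> 0" "B = mat d" "d \<noteq> 0" by (auto simp: scalars_def)
    then show "A \<otimes>\<^bsub>GL2\<^esub> B \<in> scalars" by (auto simp: GL2_def scalars_def mat_mult_mat intro!: exI[of _ "c * d"])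
  qed
  then show ?thesis
  proof (rule normalI, intro ballI)
    fix A :: "'a^2^2"
    show "scalars #>\<^bsub>GL2\<^esub> A = A <#\<^bsub>GL2\<^esub> scalars"
      by (auto simp: r_coset_def l_coset_def GL2_def scalars_def mat_mult_commute)
  qed
qed

lemma group_PGL2: "group (PGL2 :: ('a::field^2^2) set monoid)"
  unfolding PGL2_def by (rule normal.factorgroup_is_group[OF normal_scalars])

lemma moebius_mult:
  assumes "det (A::'a::field^2^2) \<noteq> 0"
  shows "moebius B (moebius A z) = moebius (B ** A) z"
proof -
  \<comment> \<open>In homogeneous coordinates \<open>n : d\<close> the action is linear.\<close>
  have key: "moebius B (if d = 0 then None else Some (n / d)) =
      (if B$2$1 * n + B$2$2 * d = 0 then None else Some ((B$1$1 * n + B$1$2 * d) / (B$2$1 * n + B$2$2 * d)))"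
    if "d = 0 \<Longrightarrow> n \<noteq> 0" for n d
  proof (cases "d = 0")
    case True
    then show ?thesis using that by (auto simp: moebius_def)
  next
    case False
    then have "B$2$1 * (n / d) + B$2$2 = (B$2$1 * n + B$2$2 * d) / d"
      "B$1$1 * (n / d) + B$1$2 = (B$1$1 * n + B$1$2 * d) / d" by (simp_all add: field_simps)
    then show ?thesis using False by (auto simp: moebius_def)
  qed
  show ?thesis
  proof (cases z)
    case None
    have "A$2$1 = 0 \<Longrightarrow> A$1$1 \<noteq> 0" using assms by (auto simp: det_2)
    moreover have "(B ** A)$i$1 = B$i$1 * A$1$1 + B$i$2 * A$2$1" for i
      by (simp add: matrix_matrix_mult_def sum_2)
    ultimately show ?thesis using key[of "A$2$1" "A$1$1"]
      by (simp add: None moebius_def[of A] moebius_def[of "B ** A"])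
  next
    case (Some x)
    let ?n = "A$1$1 * x + A$1$2" and ?d = "A$2$1 * x + A$2$2"
    have "?d = 0 \<Longrightarrow> ?n \<noteq> 0"
    proof
      assume "?d = 0" "?n = 0"
      have "det A = A$1$1 * ?d - A$2$1 * ?n" by (simp add: det_2 algebra_simps)
      with \<open>?d = 0\<close> \<open>?n = 0\<close> assms show False by simp
    qed
    moreover have "(B ** A)$i$1 * x + (B ** A)$i$2 = B$i$1 * ?n + B$i$2 * ?d" for i
      by (simp add: matrix_matrix_mult_def sum_2 algebra_simps)
    ultimately show ?thesis using key[of ?d ?n]
      by (simp add: Some moebius_def[of A] moebius_def[of "B ** A"])
  qed
qed

lemma moebius_mat: "c \<noteq> 0 \<Longrightarrow> moebius (mat c) z = (z::'a::field option)"
  by (cases z) (auto simp: moebius_def mat_def)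

definition representative :: "('a::field^2^2) set \<Rightarrow> 'a^2^2" where
  "representative \<gamma> = (SOME A. A \<in> \<gamma>)"

lemma act_representative: "act \<gamma> = moebius (representative \<gamma>)"
  by (simp add: act_def representative_def)

lemma representative_mem:
  assumes "\<gamma> \<in> carrier PGL2"
  shows "representative \<gamma> \<in> \<gamma>" "representative \<gamma> \<in> carrier GL2" "det (representative \<gamma>) \<noteq> 0"
proof -
  interpret normal "scalars :: ('a^2^2) set" GL2 by (rule normal_scalars)
  obtain A where A: "A \<in> carrier GL2" "\<gamma> = scalars #>\<^bsub>GL2\<^esub> A"
    using assms unfolding PGL2_def carrier_FactGroup by auto
  have "A \<in> \<gamma>" unfolding A(2) by (rule rcos_self[OF A(1) subgroup_axioms])
  then show "representative \<gamma> \<in> \<gamma>" unfolding representative_def by (rule someI)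
  then show "representative \<gamma> \<in> carrier GL2"
    using A r_coset_subset_G[OF subset, of A] by blast
  then show "det (representative \<gamma>) \<noteq> 0" by (simp add: GL2_def invertible_det_nz)
qed

text \<open>
  The representatives multiply to a scalar matrix, which acts trivially.
\<close>

lemma act_mult:
  assumes "\<gamma> \<in> carrier PGL2" "\<delta> \<in> carrier PGL2" "\<gamma> \<otimes>\<^bsub>PGL2\<^esub> \<delta> = \<one>\<^bsub>PGL2\<^esub>"
  shows "act \<gamma> (act \<delta> z) = z"
proof -
  have "representative \<gamma> ** representative \<delta> \<in> \<gamma> \<otimes>\<^bsub>PGL2\<^esub> \<delta>"
    using representative_mem(1)[OF assms(1)] representative_mem(1)[OF assms(2)]
    unfolding PGL2_def mult_FactGroup set_mult_def by (auto simp: GL2_def)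
  then have "representative \<gamma> ** representative \<delta> \<in> scalars"
    using assms(3) by (simp add: PGL2_def)
  then obtain c where "c \<noteq> 0" "representative \<gamma> ** representative \<delta> = mat c" by (auto simp: scalars_def)
  then show ?thesis
    unfolding act_representative moebius_mult[OF representative_mem(3)[OF assms(2)]]
    by (simp add: moebius_mat)
qed

lemma act_inv:
  assumes "\<gamma> \<in> carrier PGL2"
  shows "act (inv\<^bsub>PGL2\<^esub> \<gamma>) (act \<gamma> z) = z" "act \<gamma> (act (inv\<^bsub>PGL2\<^esub> \<gamma>) z) = z"
  using group.l_inv[OF group_PGL2 assms] group.r_inv[OF group_PGL2 assms] assms
    group.inv_closed[OF group_PGL2 assms]
  by (auto intro: act_mult)

lemma act_one: "act \<one>\<^bsub>PGL2\<^esub> z = (z::'a::field option)"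
proof -
  let ?e = "\<one>\<^bsub>PGL2\<^esub> :: ('a^2^2) set"
  have 1: "?e \<in> carrier PGL2" by (rule monoid.one_closed) (simp add: group_PGL2 group.is_monoid)
  have "representative ?e \<in> scalars" using representative_mem(1)[OF 1] by (simp add: PGL2_def)
  then obtain c where "c \<noteq> 0" "representative ?e = mat c" by (auto simp: scalars_def)
  then show ?thesis by (simp add: act_representative moebius_mat)
qed

text \<open>
  Products of bounded length form an increasing sequence of countable sets that exhausts the subgroup.
\<close>

lemma countable_generate:
  assumes "countable S"
  shows "countable (generate G S)"
proof -
  define X where "X = rec_nat (insert \<one>\<^bsub>G\<^esub> (S \<union> (\<lambda>h. inv\<^bsub>G\<^esub> h) ` S)) (\<lambda>_ A. A \<union> (\<lambda>(a, b). a \<otimes>\<^bsub>G\<^esub> b) ` (A \<times> A))"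
  have X: "X 0 = insert \<one>\<^bsub>G\<^esub> (S \<union> (\<lambda>h. inv\<^bsub>G\<^esub> h) ` S)"
    "X (Suc n) = X n \<union> (\<lambda>(a, b). a \<otimes>\<^bsub>G\<^esub> b) ` (X n \<times> X n)" for n by (simp_all add: X_def)
  have cnt: "countable (X n)" for n by (induction n) (use assms in \<open>auto simp: X\<close>)
  have mono: "X m \<subseteq> X n" if "m \<le> n" for m n
    by (rule lift_Suc_mono_le[OF _ that]) (simp add: X)
  have "g \<in> (\<Union>n. X n)" if "g \<in> generate G S" for g
    using that
  proof induction
    case (eng a b)
    then obtain m n where "a \<in> X m" "b \<in> X n" by blast
    then have "a \<in> X (max m n)" "b \<in> X (max m n)" using mono[of m "max m n"] mono[of n "max m n"] by auto
    then have "a \<otimes>\<^bsub>G\<^esub> b \<in> X (Suc (max m n))" unfolding X by (auto intro!: image_eqI[of _ _ "(a, b)"])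
    then show ?case by blast
  next
    case one
    then show ?case using X(1) by blast
  next
    case (incl h)
    then show ?case using X(1) by blast
  next
    case (inv h)
    then show ?case using X(1) by blast
  qed
  then have "generate G S \<subseteq> (\<Union>n. X n)" by (rule subsetI)
  moreover have "countable (\<Union>n. X n)" using cnt by (intro countable_UN) auto
  ultimately show ?thesis by (rule countable_subset)
qed

text \<open>The denominator of \<open>\<gamma>\<close>; its zero is the pole of \<open>\<gamma>\<close>.\<close>

definition den :: "('a::field^2^2) set \<Rightarrow> 'a \<Rightarrow> 'a" where
  "den \<gamma> x = representative \<gamma> $ 2 $ 1 * x + representative \<gamma> $ 2 $ 2"

definition mob :: "('a::field^2^2) set \<Rightarrow> 'a \<Rightarrow> 'a" where
  "mob \<gamma> x = the (act \<gamma> (Some x))"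

lemma act_Some: "act \<gamma> (Some x) = (if den \<gamma> x = 0 then None else Some (mob \<gamma> x))"
  by (simp add: mob_def act_representative moebius_def den_def)

lemma den_diff: "den \<gamma> x - den \<gamma> y = representative \<gamma> $ 2 $ 1 * (x - y)"
  by (simp add: den_def algebra_simps)

text \<open>
  All metric information about \<open>\<gamma>\<close> is contained in this identity: the distortion at \<open>x\<close> and \<open>y\<close> is
  governed by the denominators only.
\<close>

lemma mob_diff:
  assumes "den \<gamma> x \<noteq> 0" "den \<gamma> y \<noteq> 0"
  shows "mob \<gamma> x - mob \<gamma> y = det (representative \<gamma>) * (x - y) / (den \<gamma> x * den \<gamma> y)"
proof -
  have "mob \<gamma> z = (representative \<gamma>$1$1 * z + representative \<gamma>$1$2) / den \<gamma> z" if "den \<gamma> z \<noteq> 0" for z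
    using that by (simp add: mob_def act_representative moebius_def den_def)
  with assms have "mob \<gamma> x - mob \<gamma> y =
    ((representative \<gamma>$1$1 * x + representative \<gamma>$1$2) * den \<gamma> y - (representative \<gamma>$1$1 * y + representative \<gamma>$1$2) * den \<gamma> x)
      / (den \<gamma> x * den \<gamma> y)"
    by (simp add: diff_frac_eq mult.commute)
  also have "(representative \<gamma>$1$1 * x + representative \<gamma>$1$2) * den \<gamma> y - (representative \<gamma>$1$1 * y + representative \<gamma>$1$2) * den \<gamma> x
      = det (representative \<gamma>) * (x - y)"
    by (simp add: den_def det_2 algebra_simps)
  finally show ?thesis .
qed

lemma dist_mob:
  assumes "den \<gamma> x \<noteq> 0" "den \<gamma> (y::'a::nonarch_local_field) \<noteq> 0"
  shows "dist (mob \<gamma> x) (mob \<gamma> y) = absK (det (representative \<gamma>)) * dist x y / (absK (den \<gamma> x) * absK (den \<gamma> y))"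
  using mob_diff[OF assms] by (simp add: dist_absK absK_mult absK_divide)

lemma mob_inv:
  assumes "\<gamma> \<in> carrier PGL2" "den \<gamma> x \<noteq> 0"
  shows "den (inv\<^bsub>PGL2\<^esub> \<gamma>) (mob \<gamma> x) \<noteq> 0" "mob (inv\<^bsub>PGL2\<^esub> \<gamma>) (mob \<gamma> x) = x"
proof -
  have "act (inv\<^bsub>PGL2\<^esub> \<gamma>) (Some (mob \<gamma> x)) = Some x"
    using act_inv(1)[OF assms(1), of "Some x"] assms(2) by (simp add: act_Some)
  then show "den (inv\<^bsub>PGL2\<^esub> \<gamma>) (mob \<gamma> x) \<noteq> 0" "mob (inv\<^bsub>PGL2\<^esub> \<gamma>) (mob \<gamma> x) = x"
    by (auto simp: act_Some split: if_splits)
qed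

lemma mob_inv':
  assumes "\<gamma> \<in> carrier PGL2" "den (inv\<^bsub>PGL2\<^esub> \<gamma>) x \<noteq> 0"
  shows "den \<gamma> (mob (inv\<^bsub>PGL2\<^esub> \<gamma>) x) \<noteq> 0" "mob \<gamma> (mob (inv\<^bsub>PGL2\<^esub> \<gamma>) x) = x"
  using mob_inv[OF group.inv_closed[OF group_PGL2 assms(1)] assms(2)]
  by (auto simp: group.inv_inv[OF group_PGL2 assms(1)])

text \<open>The set \<open>\<gamma>E\<close> without the point at infinity.\<close>

definition translate :: "('a::field^2^2) set \<Rightarrow> 'a set \<Rightarrow> 'a set" where
  "translate \<gamma> E = finite_points (act \<gamma> ` Some ` E)"

lemma translate_eq_image: "translate \<gamma> E = mob \<gamma> ` {x\<in>E. den \<gamma> x \<noteq> 0}"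
  by (force simp: translate_def finite_points_def image_iff act_Some)

lemma translate_eq_vimage:
  assumes "\<gamma> \<in> carrier PGL2"
  shows "translate \<gamma> E = {x. den (inv\<^bsub>PGL2\<^esub> \<gamma>) x \<noteq> 0 \<and> mob (inv\<^bsub>PGL2\<^esub> \<gamma>) x \<in> E}"
  unfolding translate_eq_image
  using mob_inv[OF assms] mob_inv'[OF assms] by (auto simp: image_iff) (metis)

lemma finite_poles:
  assumes "\<gamma> \<in> carrier PGL2"
  shows "finite {x. den \<gamma> x = 0}"
proof (cases "representative \<gamma> $ 2 $ 1 = 0")
  case True
  then have "representative \<gamma> $ 2 $ 2 \<noteq> 0"
    using representative_mem(3)[OF assms] by (auto simp: det_2)
  then show ?thesis using True by (simp add: den_def)
next
  case False
  then have "{x. den \<gamma> x = 0} \<subseteq> {- representative \<gamma> $ 2 $ 2 / representative \<gamma> $ 2 $ 1}"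
    by (auto simp: den_def field_simps eq_neg_iff_add_eq_0)
  then show ?thesis using finite_subset by blast
qed

lemma open_den_nonzero: "\<gamma> \<in> carrier PGL2 \<Longrightarrow> open {x::'a::nonarch_local_field. den \<gamma> x \<noteq> 0}"
  using finite_imp_closed[OF finite_poles] by (simp add: closed_def Compl_eq)

text \<open>
  By the ultrametric inequality the absolute value of the denominator is locally constant away from
  the pole.
\<close>

lemma absK_den_eq_nearby:
  assumes "absK (representative \<gamma> $ 2 $ 1) * dist x y < absK (den \<gamma> (x::'a::nonarch_local_field))"
  shows "absK (den \<gamma> y) = absK (den \<gamma> x)"
proof -
  have "dist (den \<gamma> y) (den \<gamma> x) < dist (den \<gamma> x) 0"
    using assms by (metis absK_eq_dist absK_minus_commute absK_mult den_diff dist_absK)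
  then show ?thesis using dist_eq_of_less by (simp add: absK_eq_dist)
qed

lemma isCont_mob:
  assumes "den \<gamma> (x::'a::nonarch_local_field) \<noteq> 0"
  shows "isCont (mob \<gamma>) x"
  unfolding continuous_at_eps_delta
proof (intro allI impI)
  fix e :: real assume e: "e > 0"
  define c where "c = absK (representative \<gamma> $ 2 $ 1) + 1"
  define k where "k = absK (det (representative \<gamma>)) + 1"
  define \<delta> where "\<delta> = min (absK (den \<gamma> x) / c) (e * (absK (den \<gamma> x))\<^sup>2 / k)"
  have pos: "c > 0" "k > 0" "absK (den \<gamma> x) > 0"
    using assms by (auto simp: c_def k_def add_nonneg_pos)
  have "\<delta> > 0" using pos e by (simp add: \<delta>_def)
  moreover have "dist (mob \<gamma> y) (mob \<gamma> x) < e" if y: "dist y x < \<delta>" for y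
  proof -
    have "c * dist x y < absK (den \<gamma> x)"
      using y pos by (simp add: \<delta>_def pos_less_divide_eq dist_commute mult.commute)
    then have "absK (representative \<gamma> $ 2 $ 1) * dist x y < absK (den \<gamma> x)"
      by (smt (verit) c_def mult_right_mono zero_le_dist)
    then have d: "absK (den \<gamma> y) = absK (den \<gamma> x)" by (rule absK_den_eq_nearby)
    then have "den \<gamma> y \<noteq> 0" using pos by (metis absK_pos_iff)
    then have "dist (mob \<gamma> y) (mob \<gamma> x) = absK (det (representative \<gamma>)) * dist y x / (absK (den \<gamma> x))\<^sup>2"
      using assms by (simp add: dist_mob d power2_eq_square)
    also have "\<dots> \<le> k * dist y x / (absK (den \<gamma> x))\<^sup>2"
      by (intro divide_right_mono mult_right_mono) (auto simp: k_def)
    also have "\<dots> < e"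
      using y pos by (simp add: \<delta>_def pos_less_divide_eq pos_divide_less_eq mult.commute)
    finally show ?thesis .
  qed
  ultimately show "\<exists>\<delta>>0. \<forall>y. dist y x < \<delta> \<longrightarrow> dist (mob \<gamma> y) (mob \<gamma> x) < e" by blast
qed

lemma continuous_on_mob: "continuous_on {x::'a::nonarch_local_field. den \<gamma> x \<noteq> 0} (mob \<gamma>)"
  by (simp add: continuous_at_imp_continuous_on isCont_mob)

lemma borel_measurable_mob:
  assumes "\<gamma> \<in> carrier PGL2"
  shows "mob \<gamma> \<in> borel_measurable (borel :: 'a::nonarch_local_field measure)"
proof -
  let ?A = "{x::'a. den \<gamma> x \<noteq> 0}"
  have "(\<lambda>x. if x \<in> ?A then mob \<gamma> x else the None) \<in> borel_measurable borel"
    using open_den_nonzero[OF assms] continuous_on_mob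
    by (intro borel_measurable_continuous_on_if) auto
  moreover have "mob \<gamma> = (\<lambda>x. if x \<in> ?A then mob \<gamma> x else the None)"
  proof
    have "mob \<gamma> x = the None" if "den \<gamma> x = 0" for x
      unfolding mob_def using that by (simp add: act_Some)
    then show "mob \<gamma> x = (if x \<in> ?A then mob \<gamma> x else the None)" for x by auto
  qed
  ultimately show ?thesis by simp
qed

lemma borel_translate:
  assumes "\<gamma> \<in> carrier PGL2" "(E::'a::nonarch_local_field set) \<in> sets borel"
  shows "translate \<gamma> E \<in> sets borel"
proof -
  have i: "inv\<^bsub>PGL2\<^esub> \<gamma> \<in> carrier PGL2" using assms group.inv_closed[OF group_PGL2] by blast
  have "translate \<gamma> E = {x. den (inv\<^bsub>PGL2\<^esub> \<gamma>) x \<noteq> 0} \<inter> (mob (inv\<^bsub>PGL2\<^esub> \<gamma>) -` E \<inter> space borel)"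
    unfolding translate_eq_vimage[OF assms(1)] by auto
  also have "\<dots> \<in> sets borel"
    using open_den_nonzero[OF i] measurable_sets[OF borel_measurable_mob[OF i] assms(2)] by auto
  finally show ?thesis .
qed

text \<open>
  On the part of \<open>E\<close> where the denominator is bounded away from 0 the map is Lipschitz; countably many
  such parts exhaust \<open>E\<close> up to the pole.
\<close>

lemma translate_null:
  assumes \<mu>: "haar_measure \<mu>" and \<gamma>: "\<gamma> \<in> carrier PGL2"
    and E: "(E::'a::nonarch_local_field set) \<in> sets borel" "emeasure \<mu> E = 0"
  shows "emeasure \<mu> (translate \<gamma> E) = 0"
proof -
  define X where "X n = E \<inter> cball 0 (real n) \<inter> {x. inverse (real (Suc n)) \<le> absK (den \<gamma> x)}" for n
  have dens: "{x. r \<le> absK (den \<gamma> x)} \<in> sets borel" if "r > 0" for r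
  proof -
    have "open {x. absK (den \<gamma> x) < r}"
      unfolding open_dist
    proof (intro ballI)
      fix x assume "x \<in> {x. absK (den \<gamma> x) < r}"
      then have x: "absK (den \<gamma> x) < r" by simp
      define c where "c = absK (representative \<gamma> $ 2 $ 1) + 1"
      have c: "c > 0" by (simp add: c_def add_nonneg_pos)
      have "absK (den \<gamma> y) < r" if y: "dist y x < r / c" for y
      proof -
        have "dist y x * c < r" using y c by (simp add: pos_less_divide_eq)
        then have "absK (den \<gamma> y - den \<gamma> x) < r"
          unfolding den_diff absK_mult dist_absK[symmetric]
          by (smt (verit) c_def mult.commute mult_right_mono zero_le_dist)
        then show ?thesis using absK_ultrametric[of "den \<gamma> y - den \<gamma> x" "den \<gamma> x"] x by simp
      qed
      then show "\<exists>e>0. \<forall>y. dist y x < e \<longrightarrow> y \<in> {x. absK (den \<gamma> x) < r}"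
        using c \<open>r > 0\<close> by (intro exI[of _ "r / c"]) auto
    qed
    then have "closed {x. r \<le> absK (den \<gamma> x)}" by (simp add: closed_def Compl_eq not_le)
    then show ?thesis by (rule borel_closed)
  qed
  have X: "X n \<in> sets borel" "bounded (X n)" for n
    using E dens[of "inverse (real (Suc n))"] bounded_subset[OF bounded_cball] by (auto simp: X_def)
  have "translate \<gamma> (X n) \<in> null_sets \<mu>" for n
  proof -
    have nz: "absK (den \<gamma> x) > 0" if "x \<in> X n" for x
      using that by (auto simp: X_def simp del: absK_pos_iff) (smt (verit) of_nat_0_le_iff positive_imp_inverse_positive)
    then have nz': "den \<gamma> x \<noteq> 0" if "x \<in> X n" for x using that by (metis absK_pos_iff)
    obtain a :: 'a where a: "a \<noteq> 0" "absK (det (representative \<gamma>)) * (real (Suc n))\<^sup>2 \<le> absK a"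
      using ex_absK_ge by blast
    have "emeasure \<mu> (mob \<gamma> ` X n) \<le> haar_modulus \<mu> a * emeasure \<mu> (X n)"
    proof (rule emeasure_image_scaled_le[OF \<mu> X a(1)])
      fix x y assume xy: "x \<in> X n" "y \<in> X n"
      have i: "inverse (absK (den \<gamma> z)) \<le> real (Suc n)" if "z \<in> X n" for z
        using le_imp_inverse_le[of "inverse (real (Suc n))" "absK (den \<gamma> z)"] that by (simp add: X_def)
      have "dist (mob \<gamma> x) (mob \<gamma> y) =
         absK (det (representative \<gamma>)) * dist x y * (inverse (absK (den \<gamma> x)) * inverse (absK (den \<gamma> y)))"
        using xy nz' by (simp add: dist_mob divide_inverse)
      also have "\<dots> \<le> absK (det (representative \<gamma>)) * dist x y * (real (Suc n) * real (Suc n))"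
        using i[OF xy(1)] i[OF xy(2)] by (intro mult_left_mono mult_mono) auto
      also have "\<dots> = absK (det (representative \<gamma>)) * (real (Suc n))\<^sup>2 * dist x y" by (simp add: power2_eq_square)
      also have "\<dots> \<le> absK a * dist x y" by (intro mult_right_mono a) auto
      finally show "dist (mob \<gamma> x) (mob \<gamma> y) \<le> absK a * dist x y" .
    qed
    moreover have "emeasure \<mu> (X n) = 0"
      using E emeasure_mono[of "X n" E \<mu>] haar_measureD(1)[OF \<mu>] by (auto simp: X_def)
    moreover have "mob \<gamma> ` X n = translate \<gamma> (X n)" unfolding translate_eq_image using nz' by auto
    ultimately have "emeasure \<mu> (translate \<gamma> (X n)) = 0" by simp
    then show ?thesis using borel_translate[OF \<gamma> X(1)] haar_measureD(1)[OF \<mu>] by auto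
  qed
  then have "(\<Union>n. translate \<gamma> (X n)) \<in> null_sets \<mu>" by (rule null_sets_UN)
  moreover have "translate \<gamma> E \<subseteq> (\<Union>n. translate \<gamma> (X n))"
  proof
    fix y assume "y \<in> translate \<gamma> E"
    then obtain x where x: "x \<in> E" "den \<gamma> x \<noteq> 0" "y = mob \<gamma> x" unfolding translate_eq_image by blast
    obtain n1 :: nat where n1: "dist 0 x \<le> real n1" using real_arch_simple by blast
    obtain n2 :: nat where n2: "inverse (absK (den \<gamma> x)) \<le> real n2" using real_arch_simple by blast
    define n where "n = max n1 n2"
    have "inverse (absK (den \<gamma> x)) \<le> real (Suc n)" using n2 by (simp add: n_def)
    then have "inverse (real (Suc n)) \<le> absK (den \<gamma> x)"
      using le_imp_inverse_le[of "inverse (absK (den \<gamma> x))" "real (Suc n)"] x(2) by simp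
    then have "x \<in> X n" using x n1 by (auto simp: X_def n_def)
    then show "y \<in> (\<Union>n. translate \<gamma> (X n))" using x unfolding translate_eq_image by blast
  qed
  ultimately show ?thesis by (metis emeasure_eq_0 null_setsD1 null_setsD2)
qed

lemma moebius_deriv_eq:
  assumes "den \<gamma> (x::'a::nonarch_local_field) \<noteq> 0"
  shows "moebius_deriv \<gamma> x = det (representative \<gamma>) / (den \<gamma> x)\<^sup>2"
  unfolding moebius_deriv_def mob_def[symmetric]
proof (rule tendsto_Lim)
  show "at x \<noteq> bot"
  proof
    assume "at x = bot"
    then obtain e where e: "e > 0" "cball x e \<subseteq> {x}" unfolding at_eq_bot_iff open_contains_cball by auto
    obtain n where "absK ((contractor::'a) ^ n) < e" using contractor_power_less[OF e(1)] by blast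
    then have "x + contractor ^ n \<in> cball x e" by (simp add: dist_absK absK_minus)
    with e show False by auto
  qed
  show "((\<lambda>y. (mob \<gamma> y - mob \<gamma> x) / (y - x)) \<longlongrightarrow> det (representative \<gamma>) / (den \<gamma> x)\<^sup>2) (at x)"
    unfolding Lim_at
  proof (intro allI impI)
    fix e :: real assume e: "e > 0"
    define c where "c = absK (representative \<gamma> $ 2 $ 1) + 1"
    define k where "k = absK (det (representative \<gamma>)) + 1"
    define \<delta> where "\<delta> = min (absK (den \<gamma> x) / c) (e * (absK (den \<gamma> x))^3 / (k * c))"
    have pos: "c > 0" "k > 0" "absK (den \<gamma> x) > 0"
      using assms by (auto simp: c_def k_def add_nonneg_pos)
    have "\<delta> > 0" using pos e by (simp add: \<delta>_def)
    moreover have "dist ((mob \<gamma> y - mob \<gamma> x) / (y - x)) (det (representative \<gamma>) / (den \<gamma> x)\<^sup>2) < e"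
      if y: "0 < dist y x \<and> dist y x < \<delta>" for y
    proof -
      have "c * dist x y < absK (den \<gamma> x)"
        using y pos by (simp add: \<delta>_def pos_less_divide_eq dist_commute mult.commute)
      then have "absK (representative \<gamma> $ 2 $ 1) * dist x y < absK (den \<gamma> x)"
        by (smt (verit) c_def mult_right_mono zero_le_dist)
      then have d: "absK (den \<gamma> y) = absK (den \<gamma> x)" by (rule absK_den_eq_nearby)
      then have dy: "den \<gamma> y \<noteq> 0" using pos by (metis absK_pos_iff)
      have q: "(mob \<gamma> y - mob \<gamma> x) / (y - x) = det (representative \<gamma>) / (den \<gamma> y * den \<gamma> x)"
        unfolding mob_diff[OF dy assms] using y by simp
      have "(mob \<gamma> y - mob \<gamma> x) / (y - x) - det (representative \<gamma>) / (den \<gamma> x)\<^sup>2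
         = det (representative \<gamma>) * (den \<gamma> x - den \<gamma> y) / (den \<gamma> y * (den \<gamma> x)\<^sup>2)"
        unfolding q using assms dy by (simp add: field_simps power2_eq_square)
      then have "dist ((mob \<gamma> y - mob \<gamma> x) / (y - x)) (det (representative \<gamma>) / (den \<gamma> x)\<^sup>2)
         = absK (det (representative \<gamma>)) * absK (representative \<gamma> $ 2 $ 1) * dist x y / (absK (den \<gamma> x))^3"
        by (simp add: dist_absK absK_mult absK_divide den_diff d power2_eq_square power3_eq_cube)
      also have "\<dots> \<le> k * c * dist y x / (absK (den \<gamma> x))^3"
        unfolding dist_commute[of y] by (intro divide_right_mono mult_right_mono mult_mono) (auto simp: k_def c_def)
      also have "\<dots> < e"
        using y pos by (simp add: \<delta>_def pos_less_divide_eq pos_divide_less_eq mult.commute)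
      finally show ?thesis .
    qed
    ultimately show "\<exists>\<delta>>0. \<forall>y. 0 < dist y x \<and> dist y x < \<delta> \<longrightarrow>
      dist ((mob \<gamma> y - mob \<gamma> x) / (y - x)) (det (representative \<gamma>) / (den \<gamma> x)\<^sup>2) < e" by blast
  qed
qed

text \<open>
  Near a pole \<open>p\<close> the derivative has absolute value \<open>\<bar>det \<gamma>\<bar> / (\<bar>c\<bar>\<^sup>2 \<bar>x - p\<bar>\<^sup>2)\<close> with \<open>c \<noteq> 0\<close>, which is
  unbounded.
\<close>

lemma deriv_max_pole:
  assumes "open U" "p \<in> U" "den \<gamma> (p::'a::nonarch_local_field) = 0" "\<gamma> \<in> carrier PGL2"
  shows "deriv_max \<gamma> U = \<infinity>"
proof (rule ccontr)
  assume "deriv_max \<gamma> U \<noteq> \<infinity>"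
  then obtain B where B: "B \<ge> 0" "deriv_max \<gamma> U = ennreal B" by (cases "deriv_max \<gamma> U") auto
  have *: "absK (moebius_deriv \<gamma> x) \<le> B" if "x \<in> U" "den \<gamma> x \<noteq> 0" for x
  proof -
    have "ennreal (absK (moebius_deriv \<gamma> x)) \<le> (SUP x\<in>{x\<in>U. act \<gamma> (Some x) \<noteq> None}. ennreal (absK (moebius_deriv \<gamma> x)))"
      using that by (intro SUP_upper) (auto simp: act_Some)
    also have "\<dots> \<le> ennreal B" unfolding B(2)[symmetric] deriv_max_def by simp
    finally show ?thesis using B(1) by (simp add: ennreal_le_iff)
  qed
  let ?c = "representative \<gamma> $ 2 $ 1"
  have c: "?c \<noteq> 0"
    using assms(3) representative_mem(3)[OF assms(4)] by (auto simp: den_def det_2)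
  have dt: "absK (det (representative \<gamma>)) > 0" using representative_mem(3)[OF assms(4)] by simp
  obtain e where e: "e > 0" "cball p e \<subseteq> U" using assms open_contains_cball by blast
  \<comment> \<open>The threshold \<open>q\<close> makes the derivative at \<open>p + t\<close> exceed \<open>B\<close> as soon as \<open>\<bar>t\<bar> < q\<close> and \<open>\<bar>t\<bar> < 1\<close>.\<close>
  define q where "q = absK (det (representative \<gamma>)) / ((absK ?c)\<^sup>2 * (B + 1))"
  have "q > 0" using dt c B by (simp add: q_def)
  then obtain n where n: "absK ((contractor::'a) ^ n) < min (min e 1) q"
    using contractor_power_less[of "min (min e 1) q"] e by auto
  define t where "t = (contractor::'a) ^ n"
  have t: "t \<noteq> 0" "absK t < e" "absK t < 1" "absK t < q" using n by (auto simp: t_def)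
  have den: "den \<gamma> (p + t) = ?c * t" using assms(3) by (simp add: den_def algebra_simps)
  have "p + t \<in> U" using e t by (auto simp: dist_absK absK_minus subset_iff)
  then have "absK (det (representative \<gamma>)) / (absK ?c * absK t)\<^sup>2 \<le> B"
    using *[of "p + t"] c t(1) den by (simp add: moebius_deriv_eq absK_divide absK_mult)
  then have "absK (det (representative \<gamma>)) \<le> B * (absK ?c * absK t)\<^sup>2"
    using c t(1) by (simp add: pos_divide_le_eq)
  also have "\<dots> \<le> (B + 1) * ((absK ?c)\<^sup>2 * absK t)"
  proof -
    have "(absK t)\<^sup>2 \<le> absK t" using t(3) by (simp add: power2_eq_square mult_left_le)
    then show ?thesis using B(1) unfolding power_mult_distrib by (intro mult_mono mult_left_mono) auto
  qed
  also have "\<dots> < (B + 1) * ((absK ?c)\<^sup>2 * q)"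
    using t(4) c B by (intro mult_strict_left_mono) auto
  also have "\<dots> = absK (det (representative \<gamma>))" using c B by (simp add: q_def)
  finally show False by simp
qed

section \<open>Coverings by holed discs\<close>

lemma holed_disc_clopen:
  assumes "holed_disc (U::'a::nonarch_local_field set)"
  shows "open U" "closed U"
proof -
  obtain B \<H> where U: "disc B" "finite \<H>" "\<forall>H\<in>\<H>. disc H \<and> H \<subseteq> B" "U = B - \<Union>\<H>"
    using assms unfolding holed_disc_def by blast
  have clopen: "open X \<and> closed X" if "disc X" for X :: "'a set"
    using that open_cball by (auto simp: disc_def)
  then have "open (\<Union>\<H>)" "closed (\<Union>\<H>)" using U by (auto intro: closed_Union)
  then show "open U" "closed U" using U(1) clopen[of B] unfolding U(4) by auto
qed

text \<open>
  A disjoint open cover of a compact set has only finitely many nonempty members.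
\<close>

lemma finite_Cov:
  assumes "compact F" "\<U> \<in> Cov (F::'a::nonarch_local_field set)"
  shows "finite \<U>"
proof -
  have \<U>: "\<forall>U\<in>\<U>. open U" "disjoint \<U>" "\<Union>\<U> = F" using assms(2) holed_disc_clopen by (auto simp: Cov_def)
  then obtain \<V> where \<V>: "\<V> \<subseteq> \<U>" "finite \<V>" "F \<subseteq> \<Union>\<V>"
    using compactE[OF assms(1), of \<U>] by (metis subset_refl)
  have "\<U> \<subseteq> insert {} \<V>"
  proof
    fix U assume U: "U \<in> \<U>"
    show "U \<in> insert {} \<V>"
    proof (cases "U = {}")
      case False
      then obtain x where x: "x \<in> U" by blast
      then obtain V where V: "V \<in> \<V>" "x \<in> V" using U \<U>(3) \<V>(3) by blast
      then have "U = V" using \<U>(2) U \<V>(1) x by (metis disjointD disjoint_iff subsetD)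
      then show ?thesis using V by simp
    qed simp
  qed
  then show ?thesis using \<V>(2) finite_subset by blast
qed

text \<open>
  If \<open>z\<close> misses the sphere of radius \<open>r\<close> around \<open>a\<close>, then every \<open>x\<close> on this sphere is at distance
  \<open>max r \<bar>a - z\<bar>\<close> from \<open>z\<close>.
\<close>

lemma verticial_dist_const:
  assumes "verticial \<U>" "U \<in> \<U>" "z \<notin> U"
  shows "\<exists>d. \<forall>x\<in>(U::'a::nonarch_local_field set). dist x z = d"
proof -
  obtain r S where S: "r > 0" "S \<noteq> {}" "U = (\<Inter>a\<in>S. sphere a r)" using assms(1,2) unfolding verticial_def by meson
  then obtain a where a: "a \<in> S" "dist a z \<noteq> r" using assms(3) by auto
  have x: "dist a x = r" if "x \<in> U" for x using that S a by auto
  show ?thesis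
  proof (cases "dist a z < r")
    case True
    then have "dist x z = r" if "x \<in> U" for x
      using dist_eq_of_less[of z a x] x[OF that] by (simp add: dist_commute)
    then show ?thesis by blast
  next
    case False
    then have "dist x z = dist a z" if "x \<in> U" for x
      using dist_eq_of_less[of x a z] x[OF that] a(2) by (simp add: dist_commute)
    then show ?thesis by blast
  qed
qed

text \<open>
  The distance stays the same if first one point and then the other is moved within its cell.
\<close>

lemma verticial_dist_const2:
  assumes "verticial \<U>" "disjoint \<U>" "U \<in> \<U>" "V \<in> \<U>" "U \<noteq> V"
  shows "\<exists>d. \<forall>x\<in>(U::'a::nonarch_local_field set). \<forall>y\<in>V. dist x y = d"
proof (cases "U = {} \<or> V = {}")
  case False
  then obtain u v where uv: "u \<in> U" "v \<in> V" by blast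
  have disj: "x \<notin> V" if "x \<in> U" for x using assms that by (metis disjointD disjoint_iff)
  have "dist x y = dist u v" if "x \<in> U" "y \<in> V" for x y
  proof -
    have "dist x y = dist u y"
      using verticial_dist_const[OF assms(1,3), of y] disj that uv by metis
    also have "dist u y = dist u v"
      using verticial_dist_const[OF assms(1,4), of u] disj that uv by (metis dist_commute)
    finally show ?thesis .
  qed
  then show ?thesis by blast
qed blast

section \<open>Uniform distortion away from poles\<close>

lemma compact_open_uniform_cball:
  assumes "compact F" "open (F::'a::nonarch_local_field set)"
  shows "\<exists>\<epsilon>>0. \<forall>x\<in>F. cball x \<epsilon> \<subseteq> F"
proof -
  obtain e where e: "\<And>x. x \<in> F \<Longrightarrow> e x > 0" "\<And>x. x \<in> F \<Longrightarrow> cball x (e x) \<subseteq> F"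
    using assms(2) unfolding open_contains_cball by metis
  have "F \<subseteq> (\<Union>x\<in>F. cball x (e x))" using e(1) by (force intro: less_imp_le)
  then obtain D where D: "D \<subseteq> F" "finite D" "F \<subseteq> (\<Union>x\<in>D. cball x (e x))"
    using compactE_image[OF assms(1), of F "\<lambda>x. cball x (e x)"] e(1) open_cball by metis
  define \<epsilon> where "\<epsilon> = Min (insert 1 (e ` D))"
  have "\<epsilon> > 0" unfolding \<epsilon>_def using D e(1) by (subst Min_gr_iff) auto
  moreover have "cball x \<epsilon> \<subseteq> F" if x: "x \<in> F" for x
  proof -
    obtain y where y: "y \<in> D" "x \<in> cball y (e y)" using D(3) x by blast
    have "\<epsilon> \<le> e y" unfolding \<epsilon>_def using D y by (intro Min_le) auto
    then have "cball x \<epsilon> \<subseteq> cball x (e y)" by (rule subset_cball)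
    also have "\<dots> = cball y (e y)" by (rule cball_eq_of_mem[OF y(2)])
    also have "\<dots> \<subseteq> F" using e(2) D(1) y(1) by blast
    finally show ?thesis .
  qed
  ultimately show ?thesis by blast
qed

text \<open>
  The constant depends only on \<open>F\<close>. A pole outside \<open>F\<close> has distance at least \<open>\<epsilon>\<close> from every point of
  \<open>F\<close>, while two points of \<open>F\<close> differ by at most \<open>D\<close>; so the distances of two points of \<open>F\<close> to the
  pole have ratio at most \<open>max 1 (D/\<epsilon>)\<close>.
\<close>

lemma den_uniformly_comparable:
  assumes "compact F" "open (F::'a::nonarch_local_field set)"
  shows "\<exists>C\<ge>1. \<forall>\<gamma>. (\<forall>x\<in>F. den \<gamma> x \<noteq> 0) \<longrightarrow> (\<forall>x\<in>F. \<forall>y\<in>F. absK (den \<gamma> x) \<le> C * absK (den \<gamma> y))"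
proof -
  obtain \<epsilon> where \<epsilon>: "\<epsilon> > 0" "\<And>x. x \<in> F \<Longrightarrow> cball x \<epsilon> \<subseteq> F"
    using compact_open_uniform_cball[OF assms] by blast
  obtain D where D: "\<And>x y. x \<in> F \<Longrightarrow> y \<in> F \<Longrightarrow> dist x y \<le> D"
    using compact_imp_bounded[OF assms(1)] unfolding bounded_two_points by blast
  have "absK (den \<gamma> x) \<le> max 1 (D / \<epsilon>) * absK (den \<gamma> y)"
    if nz: "\<forall>x\<in>F. den \<gamma> x \<noteq> 0" and xy: "x \<in> F" "y \<in> F" for \<gamma> x y
  proof -
    define c where "c = representative \<gamma> $ 2 $ 1"
    have "absK c * \<epsilon> \<le> absK (den \<gamma> y)"
    proof (rule ccontr)
      assume "\<not> absK c * \<epsilon> \<le> absK (den \<gamma> y)"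
      then have lt: "absK (den \<gamma> y) < absK c * \<epsilon>" by simp
      then have c: "c \<noteq> 0" by (metis absK_0 absK_nonneg mult_zero_left not_less)
      define p where "p = y - den \<gamma> y / c"
      have "dist y p \<le> \<epsilon>" using lt c by (simp add: p_def dist_absK absK_divide pos_divide_le_eq mult.commute)
      then have "p \<in> F" using \<epsilon>(2)[OF xy(2)] by auto
      moreover have "den \<gamma> p = 0"
        using den_diff[of \<gamma> y p] c by (simp add: p_def c_def[symmetric])
      ultimately show False using nz by blast
    qed
    then have "absK c * D * \<epsilon> \<le> absK (den \<gamma> y) * D"
      using D[OF xy] zero_le_dist[of x y] by (metis mult.assoc mult.commute mult_left_mono order_trans)
    then have "absK c * D \<le> D / \<epsilon> * absK (den \<gamma> y)"
      using \<epsilon>(1) by (simp add: pos_le_divide_eq mult.commute)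
    moreover have "absK (den \<gamma> x - den \<gamma> y) \<le> absK c * D"
      unfolding den_diff absK_mult c_def[symmetric] dist_absK[symmetric]
      by (intro mult_left_mono D xy) simp
    ultimately have "absK (den \<gamma> x - den \<gamma> y) \<le> max 1 (D / \<epsilon>) * absK (den \<gamma> y)"
      by (smt (verit) absK_nonneg max.cobounded2 mult_right_mono)
    moreover have "absK (den \<gamma> y) \<le> max 1 (D / \<epsilon>) * absK (den \<gamma> y)"
      using mult_right_mono[of 1 "max 1 (D / \<epsilon>)" "absK (den \<gamma> y)"] by simp
    ultimately show ?thesis
      using absK_ultrametric[of "den \<gamma> x - den \<gamma> y" "den \<gamma> y"] by simp
  qed
  then show ?thesis by (intro exI[of _ "max 1 (D / \<epsilon>)"]) auto
qed

text \<open>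
  The number \<open>\<kappa>\<close> is \<open>\<bar>\<gamma>'(x0)\<bar>\<close>. All values of \<open>\<bar>\<gamma>'\<bar>\<close> on \<open>F\<close> lie within a factor \<open>C\<^sup>2\<close> of it, so the
  weights of all cells agree up to a factor that is independent of \<open>\<gamma>\<close>.
\<close>

lemma weight_comparable:
  fixes F :: "'a::nonarch_local_field set"
  assumes F: "U \<subseteq> F" "U \<noteq> {}" and nz: "\<forall>x\<in>F. den \<gamma> x \<noteq> 0" and x0: "x0 \<in> F" and s: "0 \<le> s"
    and C: "C \<ge> 1" "\<forall>x\<in>F. \<forall>y\<in>F. absK (den \<gamma> x) \<le> C * absK (den \<gamma> y)"
  defines "\<kappa> \<equiv> absK (det (representative \<gamma>)) / (absK (den \<gamma> x0))\<^sup>2"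
  shows "weight s \<gamma> U \<le> (C\<^sup>2) powr s * max 1 \<kappa> powr (- s)"
    "max 1 \<kappa> powr (- s) \<le> (C\<^sup>2) powr s * weight s \<gamma> U"
proof -
  let ?d = "\<lambda>x. absK (moebius_deriv \<gamma> x)"
  have C2: "C\<^sup>2 \<ge> 1" using C(1) by simp
  have d: "?d x = absK (det (representative \<gamma>)) / (absK (den \<gamma> x))\<^sup>2" if "x \<in> F" for x
    using nz that by (simp add: moebius_deriv_eq absK_divide)
  have pos: "absK (den \<gamma> x) > 0" if "x \<in> F" for x using nz that by simp
  have up: "?d x \<le> C\<^sup>2 * \<kappa>" if "x \<in> F" for x
  proof -
    have "(absK (den \<gamma> x0))\<^sup>2 \<le> (C * absK (den \<gamma> x))\<^sup>2" using C(2) x0 that by (intro power_mono) auto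
    then have "absK (det (representative \<gamma>)) * (absK (den \<gamma> x0))\<^sup>2 \<le> absK (det (representative \<gamma>)) * (C\<^sup>2 * (absK (den \<gamma> x))\<^sup>2)"
      by (intro mult_left_mono) (auto simp: power_mult_distrib)
    then show ?thesis
      using pos[OF that] pos[OF x0] unfolding d[OF that] \<kappa>_def by (simp add: divide_simps ac_simps)
  qed
  have lo: "\<kappa> \<le> C\<^sup>2 * ?d x" if "x \<in> F" for x
  proof -
    have "(absK (den \<gamma> x))\<^sup>2 \<le> (C * absK (den \<gamma> x0))\<^sup>2" using C(2) x0 that by (intro power_mono) auto
    then have "absK (det (representative \<gamma>)) * (absK (den \<gamma> x))\<^sup>2 \<le> absK (det (representative \<gamma>)) * (C\<^sup>2 * (absK (den \<gamma> x0))\<^sup>2)"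
      by (intro mult_left_mono) (auto simp: power_mult_distrib)
    then show ?thesis
      using pos[OF that] pos[OF x0] unfolding d[OF that] \<kappa>_def by (simp add: divide_simps ac_simps)
  qed
  have \<kappa>0: "\<kappa> \<ge> 0" by (simp add: \<kappa>_def)
  have "deriv_max \<gamma> U \<le> ennreal (C\<^sup>2 * max 1 \<kappa>)"
    unfolding deriv_max_def
  proof (intro max.boundedI SUP_least)
    show "1 \<le> ennreal (C\<^sup>2 * max 1 \<kappa>)"
      using C2 mult_mono[of 1 "C\<^sup>2" 1 "max 1 \<kappa>"] by (metis ennreal_1 ennreal_leI max.cobounded1 mult_1 order_trans zero_le_one)
    fix x assume "x \<in> {x\<in>U. act \<gamma> (Some x) \<noteq> None}"
    then have "?d x \<le> C\<^sup>2 * \<kappa>" using F up by auto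
    also have "\<dots> \<le> C\<^sup>2 * max 1 \<kappa>" by (intro mult_left_mono) auto
    finally show "ennreal (?d x) \<le> ennreal (C\<^sup>2 * max 1 \<kappa>)" by (rule ennreal_leI)
  qed
  then obtain m where m: "deriv_max \<gamma> U = ennreal m" "0 \<le> m" "m \<le> C\<^sup>2 * max 1 \<kappa>"
    using C2 by (cases "deriv_max \<gamma> U") (auto simp: ennreal_le_iff top_unique)
  have w: "weight s \<gamma> U = m powr (- s)" using m by (simp add: weight_def)
  have "1 \<le> deriv_max \<gamma> U" by (simp add: deriv_max_def)
  then have m1: "1 \<le> m" using m by simp
  obtain u where u: "u \<in> U" using F by blast
  have "ennreal (?d u) \<le> deriv_max \<gamma> U"
    unfolding deriv_max_def using u nz F by (intro max.coboundedI2 SUP_upper) (auto simp: act_Some)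
  then have "?d u \<le> m" using m by (simp add: ennreal_le_iff)
  then have "\<kappa> \<le> C\<^sup>2 * m" using lo[of u] u F C2 by (meson mult_left_mono order_trans subsetD zero_le_power2)
  moreover have "1 \<le> C\<^sup>2 * m" using C2 m1 mult_mono[of 1 "C\<^sup>2" 1 m] by simp
  ultimately have le: "max 1 \<kappa> \<le> C\<^sup>2 * m" by simp
  have "(C\<^sup>2 * m) powr (- s) \<le> max 1 \<kappa> powr (- s)"
    using le s by (intro powr_mono2') auto
  then have "(C\<^sup>2) powr (- s) * m powr (- s) \<le> max 1 \<kappa> powr (- s)" using C2 m1 by (simp add: powr_mult)
  then have "(C\<^sup>2) powr s * ((C\<^sup>2) powr (- s) * m powr (- s)) \<le> (C\<^sup>2) powr s * max 1 \<kappa> powr (- s)"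
    by (intro mult_left_mono) auto
  moreover have inv: "(C\<^sup>2) powr s * (C\<^sup>2) powr (- s) = 1" using C(1) by (simp flip: powr_add)
  ultimately show "weight s \<gamma> U \<le> (C\<^sup>2) powr s * max 1 \<kappa> powr (- s)"
    unfolding w by (metis mult.assoc mult_1)
  have "(C\<^sup>2 * max 1 \<kappa>) powr (- s) \<le> m powr (- s)" using m m1 s by (intro powr_mono2') auto
  then have "(C\<^sup>2) powr (- s) * max 1 \<kappa> powr (- s) \<le> m powr (- s)" using C2 by (simp add: powr_mult)
  then have "(C\<^sup>2) powr s * ((C\<^sup>2) powr (- s) * max 1 \<kappa> powr (- s)) \<le> (C\<^sup>2) powr s * m powr (- s)"
    by (intro mult_left_mono) auto
  then show "max 1 \<kappa> powr (- s) \<le> (C\<^sup>2) powr s * weight s \<gamma> U"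
    unfolding w using inv by (metis mult.assoc mult_1)
qed

lemma weight_nonneg [simp]: "0 \<le> weight s \<gamma> U"
  by (simp add: weight_def)

text \<open>
  On \<open>F\<close> the map \<open>\<gamma>\<close> multiplies distances by \<open>\<bar>a\<bar> = \<bar>\<gamma>'(x0)\<bar>\<close> up to a factor \<open>C\<^sup>2 \<le> \<bar>t\<bar>\<close> in either
  direction.
\<close>

lemma translate_measure_comparable:
  fixes F :: "'a::nonarch_local_field set"
  assumes \<mu>: "haar_measure \<mu>" and \<gamma>: "\<gamma> \<in> carrier PGL2" and "bounded F"
    and E: "E \<in> sets borel" "E \<subseteq> F" and nz: "\<forall>x\<in>F. den \<gamma> x \<noteq> 0" and x0: "x0 \<in> F"
    and C: "C \<ge> 1" "\<forall>x\<in>F. \<forall>y\<in>F. absK (den \<gamma> x) \<le> C * absK (den \<gamma> y)"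
    and t: "t \<noteq> 0" "C\<^sup>2 \<le> absK t" and bdd: "bounded (translate \<gamma> E)"
  defines "a \<equiv> det (representative \<gamma>) / (den \<gamma> x0)\<^sup>2"
  shows "emeasure \<mu> (translate \<gamma> E) \<le> haar_modulus \<mu> a * haar_modulus \<mu> t * emeasure \<mu> E"
    "haar_modulus \<mu> a * emeasure \<mu> E \<le> haar_modulus \<mu> t * emeasure \<mu> (translate \<gamma> E)"
proof -
  have a: "a \<noteq> 0" using representative_mem(3)[OF \<gamma>] nz x0 by (simp add: a_def)
  have absa: "absK a = absK (det (representative \<gamma>)) / (absK (den \<gamma> x0))\<^sup>2" by (simp add: a_def absK_divide)
  have img: "translate \<gamma> E = mob \<gamma> ` E" unfolding translate_eq_image using nz E by auto
  have pos: "absK (den \<gamma> x) > 0" if "x \<in> F" for x using nz that by simp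
  have dt: "absK (det (representative \<gamma>)) > 0" using representative_mem(3)[OF \<gamma>] by simp
  have bE: "bounded E" using \<open>bounded F\<close> E bounded_subset by blast
  have up: "dist (mob \<gamma> x) (mob \<gamma> y) \<le> absK (a * t) * dist x y"
    and lo: "dist x y \<le> absK (inverse a * t) * dist (mob \<gamma> x) (mob \<gamma> y)" if xy: "x \<in> E" "y \<in> E" for x y
  proof -
    have F: "x \<in> F" "y \<in> F" using xy E by auto
    have dm: "dist (mob \<gamma> x) (mob \<gamma> y) = absK (det (representative \<gamma>)) * dist x y / (absK (den \<gamma> x) * absK (den \<gamma> y))"
      using F nz by (simp add: dist_mob)
    have 1: "(absK (den \<gamma> x0))\<^sup>2 \<le> absK t * (absK (den \<gamma> x) * absK (den \<gamma> y))"
    proof -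
      have "(absK (den \<gamma> x0))\<^sup>2 \<le> (C * absK (den \<gamma> x)) * (C * absK (den \<gamma> y))"
        unfolding power2_eq_square using C x0 F by (intro mult_mono) auto
      also have "\<dots> = C\<^sup>2 * (absK (den \<gamma> x) * absK (den \<gamma> y))" by (simp add: power2_eq_square)
      also have "\<dots> \<le> absK t * (absK (den \<gamma> x) * absK (den \<gamma> y))" by (intro mult_right_mono t) auto
      finally show ?thesis .
    qed
    have 2: "absK (den \<gamma> x) * absK (den \<gamma> y) \<le> absK t * (absK (den \<gamma> x0))\<^sup>2"
    proof -
      have "absK (den \<gamma> x) * absK (den \<gamma> y) \<le> (C * absK (den \<gamma> x0)) * (C * absK (den \<gamma> x0))"
        using C x0 F by (intro mult_mono) auto
      also have "\<dots> = C\<^sup>2 * (absK (den \<gamma> x0))\<^sup>2" by (simp add: power2_eq_square)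
      also have "\<dots> \<le> absK t * (absK (den \<gamma> x0))\<^sup>2" by (intro mult_right_mono t) auto
      finally show ?thesis .
    qed
    have "(absK (den \<gamma> x0))\<^sup>2 * (absK (det (representative \<gamma>)) * dist x y)
      \<le> absK t * (absK (den \<gamma> x) * absK (den \<gamma> y)) * (absK (det (representative \<gamma>)) * dist x y)"
      using 1 by (intro mult_right_mono) auto
    then show "dist (mob \<gamma> x) (mob \<gamma> y) \<le> absK (a * t) * dist x y"
      unfolding dm absK_mult absa using pos[OF F(1)] pos[OF F(2)] pos[OF x0]
      by (simp add: divide_simps) (simp add: ac_simps)
    have "absK (den \<gamma> x) * absK (den \<gamma> y) * dist x y \<le> absK t * (absK (den \<gamma> x0))\<^sup>2 * dist x y"
      using 2 by (intro mult_right_mono) auto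
    then show "dist x y \<le> absK (inverse a * t) * dist (mob \<gamma> x) (mob \<gamma> y)"
      unfolding dm absK_mult absK_inverse absa using pos[OF F(1)] pos[OF F(2)] pos[OF x0] dt
      by (simp add: divide_simps) (simp add: ac_simps)
  qed
  have "emeasure \<mu> (mob \<gamma> ` E) \<le> haar_modulus \<mu> (a * t) * emeasure \<mu> E"
    using a t up by (intro emeasure_image_scaled_le[OF \<mu> E(1) bE]) auto
  then show "emeasure \<mu> (translate \<gamma> E) \<le> haar_modulus \<mu> a * haar_modulus \<mu> t * emeasure \<mu> E"
    unfolding img using haar_modulus_mult[OF \<mu> a t(1)] by simp
  have undo_mob: "mob (inv\<^bsub>PGL2\<^esub> \<gamma>) (mob \<gamma> x) = x" if "x \<in> E" for x
    using mob_inv(2)[OF \<gamma>] nz E that by blast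
  have "emeasure \<mu> (mob (inv\<^bsub>PGL2\<^esub> \<gamma>) ` translate \<gamma> E) \<le> haar_modulus \<mu> (inverse a * t) * emeasure \<mu> (translate \<gamma> E)"
    using a t lo undo_mob unfolding img
    by (intro emeasure_image_scaled_le[OF \<mu> borel_translate[OF \<gamma> E(1), unfolded img] bdd[unfolded img]]) auto
  moreover have "mob (inv\<^bsub>PGL2\<^esub> \<gamma>) ` translate \<gamma> E = E" unfolding img image_image using undo_mob by simp
  ultimately have "emeasure \<mu> E \<le> haar_modulus \<mu> (inverse a) * haar_modulus \<mu> t * emeasure \<mu> (translate \<gamma> E)"
    using haar_modulus_mult[OF \<mu> _ t(1), of "inverse a"] a by simp
  then have "haar_modulus \<mu> a * emeasure \<mu> E \<le>
      haar_modulus \<mu> a * (haar_modulus \<mu> (inverse a) * haar_modulus \<mu> t * emeasure \<mu> (translate \<gamma> E))"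
    by (intro mult_left_mono) auto
  also have "\<dots> = (haar_modulus \<mu> a * haar_modulus \<mu> (inverse a)) * (haar_modulus \<mu> t * emeasure \<mu> (translate \<gamma> E))"
    by (simp add: ac_simps)
  finally show "haar_modulus \<mu> a * emeasure \<mu> E \<le> haar_modulus \<mu> t * emeasure \<mu> (translate \<gamma> E)"
    by (simp add: haar_modulus_inverse[OF \<mu> a])
qed

section \<open>The weighted measure on the fundamental domain\<close>

lemma nn_integral_count_space_eq_infsum:
  fixes f :: "'i \<Rightarrow> ennreal"
  assumes "countable A"
  shows "(\<integral>\<^sup>+i. f i \<partial>count_space A) = (\<Sum>\<^sub>\<infinity>i\<in>A. f i)"
proof -
  have inf: "(\<Sum>\<^sub>\<infinity>i\<in>A. f i) = (SUP X\<in>{X. finite X \<and> X \<subseteq> A}. sum f X)"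
    by (rule nonneg_infsum_complete) simp
  have sum: "(\<integral>\<^sup>+i. f i * indicator X i \<partial>count_space A) = sum f X" if "finite X" "X \<subseteq> A" for X
  proof -
    have "(\<integral>\<^sup>+i. f i * indicator X i \<partial>count_space A) = (\<Sum>i\<in>X. f i * indicator X i)"
      using that by (intro nn_integral_count_space') auto
    then show ?thesis by simp
  qed
  show ?thesis
  proof (rule antisym)
    show "(\<Sum>\<^sub>\<infinity>i\<in>A. f i) \<le> (\<integral>\<^sup>+i. f i \<partial>count_space A)"
      unfolding inf
    proof (rule SUP_least)
      fix X assume "X \<in> {X. finite X \<and> X \<subseteq> A}"
      then have "sum f X = (\<integral>\<^sup>+i. f i * indicator X i \<partial>count_space A)" using sum by simp
      also have "\<dots> \<le> (\<integral>\<^sup>+i. f i \<partial>count_space A)"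
        by (intro nn_integral_mono) (auto split: split_indicator)
      finally show "sum f X \<le> (\<integral>\<^sup>+i. f i \<partial>count_space A)" .
    qed
    define B where "B n = from_nat_into A ` {..n} \<inter> A" for n :: nat
    have B: "finite (B n)" "B n \<subseteq> A" for n by (auto simp: B_def)
    have ex: "\<exists>n. i \<in> B n" if "i \<in> A" for i
      using from_nat_into_surj[OF assms that] that by (auto simp: B_def)
    have "(\<integral>\<^sup>+i. f i \<partial>count_space A) = (\<integral>\<^sup>+i. (SUP n. f i * indicator (B n) i) \<partial>count_space A)"
    proof (intro nn_integral_cong antisym)
      fix i assume "i \<in> space (count_space A)"
      then obtain n where "i \<in> B n" using ex by auto
      then show "f i \<le> (SUP n. f i * indicator (B n) i)" by (intro SUP_upper2[of n]) auto
    qed (auto intro!: SUP_least split: split_indicator)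
    also have "\<dots> = (SUP n. \<integral>\<^sup>+i. f i * indicator (B n) i \<partial>count_space A)"
      by (intro nn_integral_monotone_convergence_SUP)
         (auto simp: incseq_def le_fun_def B_def split: split_indicator)
    also have "\<dots> \<le> (\<Sum>\<^sub>\<infinity>i\<in>A. f i)"
      unfolding inf using B by (intro SUP_least) (auto simp: sum intro!: SUP_upper)
    finally show "(\<integral>\<^sup>+i. f i \<partial>count_space A) \<le> (\<Sum>\<^sub>\<infinity>i\<in>A. f i)" .
  qed
qed

text \<open>
  A countable group that acts with a strict fundamental domain \<open>F\<close>, which is partitioned into finitely
  many clopen cells.
\<close>

locale schottky_cells =
  fixes \<mu> :: "'a::nonarch_local_field measure" and \<Gamma> :: "('a^2^2) set set"
    and F :: "'a set" and \<U> :: "'a set set" and s :: real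
  assumes haar: "haar_measure \<mu>"
    and \<Gamma>_carrier: "\<Gamma> \<subseteq> carrier PGL2" and one_\<Gamma>: "\<one>\<^bsub>PGL2\<^esub> \<in> \<Gamma>" and countable_\<Gamma>: "countable \<Gamma>"
    and fundamental: "fundamental_domain \<Gamma> F" and compact_F: "compact F" and open_F: "open F"
    and finite_\<U>: "finite \<U>" and open_cell: "\<And>U. U \<in> \<U> \<Longrightarrow> open U" and closed_cell: "\<And>U. U \<in> \<U> \<Longrightarrow> closed U"
    and disjoint_\<U>: "disjoint \<U>" and Union_\<U>: "\<Union>\<U> = F"
    and s_nonneg: "0 \<le> s"
begin

lemma sets_\<mu> [measurable_cong]: "sets \<mu> = sets borel"
  by (rule haar_measureD(1)[OF haar])

sublocale haar: sigma_finite_measure \<mu>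
  by (rule sigma_finite_haar_measure[OF haar])

lemma carrier: "\<gamma> \<in> \<Gamma> \<Longrightarrow> \<gamma> \<in> carrier PGL2"
  using \<Gamma>_carrier by blast

lemma inv_carrier: "\<gamma> \<in> \<Gamma> \<Longrightarrow> inv\<^bsub>PGL2\<^esub> \<gamma> \<in> carrier PGL2"
  using carrier group.inv_closed[OF group_PGL2] by blast

lemma cell_subset: "U \<in> \<U> \<Longrightarrow> U \<subseteq> F"
  using Union_\<U> by blast

lemma cell_eq: "U \<in> \<U> \<Longrightarrow> V \<in> \<U> \<Longrightarrow> y \<in> U \<Longrightarrow> y \<in> V \<Longrightarrow> U = V"
  using disjoint_\<U> by (metis disjointD disjoint_iff)

lemma borel_cell [measurable]: "U \<in> \<U> \<Longrightarrow> U \<in> sets borel"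
  using open_cell by (intro borel_open)

lemma borel_F [measurable]: "F \<in> sets borel"
  using open_F by (rule borel_open)

lemma borel_translate_cell: "\<gamma> \<in> \<Gamma> \<Longrightarrow> U \<in> \<U> \<Longrightarrow> translate \<gamma> U \<in> sets borel"
  using borel_translate carrier borel_cell by blast

definition density_weight :: "('a^2^2) set \<Rightarrow> 'a \<Rightarrow> real" where
  "density_weight \<gamma> x = (\<Sum>U\<in>\<U>. weight s \<gamma> U * indicator (translate \<gamma> U) x)"

lemma density_weight_nonneg: "0 \<le> density_weight \<gamma> x"
  by (auto simp: density_weight_def intro!: sum_nonneg)

lemma density_weight_cell:
  assumes "\<gamma> \<in> \<Gamma>" "U \<in> \<U>" "mob (inv\<^bsub>PGL2\<^esub> \<gamma>) x \<in> U"
  shows "density_weight \<gamma> x = weight s \<gamma> U * indicator (translate \<gamma> U) x"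
proof -
  have "(\<Sum>V\<in>\<U>. weight s \<gamma> V * indicator (translate \<gamma> V) x) = (\<Sum>V\<in>{U}. weight s \<gamma> V * indicator (translate \<gamma> V) x)"
    using assms cell_eq by (intro sum.mono_neutral_right finite_\<U>)
      (auto simp: translate_eq_vimage[OF carrier[OF assms(1)]] split: split_indicator)
  then show ?thesis by (simp only: density_weight_def sum.insert finite.emptyI empty_iff sum.empty not_False_eq_True add_0_right)
qed

text \<open>
  The measure is built on \<open>\<Gamma> \<times> K\<close> and pushed forward by \<open>(\<gamma>, x) \<mapsto> \<gamma>\<^sup>-\<^sup>1x\<close>, so that the sums over
  \<open>\<Gamma>\<close> in the weighted integrals come from Fubini's theorem.
\<close>

definition \<nu> :: "'a measure" where
  "\<nu> = distr (density (count_space \<Gamma> \<Otimes>\<^sub>M \<mu>) (\<lambda>p. ennreal (density_weight (fst p) (snd p)))) borel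
     (\<lambda>p. mob (inv\<^bsub>PGL2\<^esub> (fst p)) (snd p))"

lemma sets_cell_measure [simp, measurable_cong]: "sets \<nu> = sets borel"
  and space_cell_measure [simp]: "space \<nu> = UNIV"
  by (simp_all add: \<nu>_def)

lemma measurable_density_weight: "(\<lambda>p. density_weight (fst p) (snd p)) \<in> borel_measurable (count_space \<Gamma> \<Otimes>\<^sub>M \<mu>)"
  using borel_translate_cell
  by (intro measurable_pair_measure_countable1 countable_\<Gamma>)
    (auto simp: density_weight_def sets_\<mu> intro!: borel_measurable_sum borel_measurable_times borel_measurable_indicator)

lemma measurable_mob_pair: "(\<lambda>p. mob (inv\<^bsub>PGL2\<^esub> (fst p)) (snd p)) \<in> (count_space \<Gamma> \<Otimes>\<^sub>M \<mu>) \<rightarrow>\<^sub>M borel"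
  using borel_measurable_mob[OF inv_carrier] measurable_cong_sets[OF sets_\<mu> refl]
  by (intro measurable_pair_measure_countable1 countable_\<Gamma>) auto

lemma nn_integral_cell_measure:
  assumes h: "h \<in> borel_measurable borel" and U: "U \<in> \<U>" and supp: "\<And>y. y \<notin> U \<Longrightarrow> h y = 0"
  shows "(\<integral>\<^sup>+y. h y \<partial>\<nu>) = (\<integral>\<^sup>+\<gamma>. ennreal (weight s \<gamma> U) *
     (\<integral>\<^sup>+x\<in>translate \<gamma> U. h (mob (inv\<^bsub>PGL2\<^esub> \<gamma>) x) \<partial>\<mu>) \<partial>count_space \<Gamma>)"
proof -
  let ?P = "count_space \<Gamma> \<Otimes>\<^sub>M \<mu>"
  let ?g = "\<lambda>p. h (mob (inv\<^bsub>PGL2\<^esub> (fst p)) (snd p))"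
  note [measurable] = measurable_density_weight measurable_mob_pair h
  have g: "?g \<in> borel_measurable ?P" by measurable
  have "(\<integral>\<^sup>+y. h y \<partial>\<nu>) = (\<integral>\<^sup>+p. ennreal (density_weight (fst p) (snd p)) * ?g p \<partial>?P)"
    unfolding \<nu>_def using h g by (simp add: nn_integral_distr nn_integral_density)
  also have "\<dots> = (\<integral>\<^sup>+\<gamma>. \<integral>\<^sup>+x. ennreal (density_weight \<gamma> x) * h (mob (inv\<^bsub>PGL2\<^esub> \<gamma>) x) \<partial>\<mu> \<partial>count_space \<Gamma>)"
    using g by (subst haar.nn_integral_fst[symmetric]) auto
  also have "\<dots> = (\<integral>\<^sup>+\<gamma>. ennreal (weight s \<gamma> U) *
     (\<integral>\<^sup>+x\<in>translate \<gamma> U. h (mob (inv\<^bsub>PGL2\<^esub> \<gamma>) x) \<partial>\<mu>) \<partial>count_space \<Gamma>)"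
  proof (intro nn_integral_cong)
    fix \<gamma> assume "\<gamma> \<in> space (count_space \<Gamma>)"
    then have \<gamma>: "\<gamma> \<in> \<Gamma>" by simp
    have [measurable]: "mob (inv\<^bsub>PGL2\<^esub> \<gamma>) \<in> borel_measurable borel" "translate \<gamma> U \<in> sets borel"
      using borel_measurable_mob[OF inv_carrier[OF \<gamma>]] borel_translate_cell[OF \<gamma> U] by auto
    have "(\<integral>\<^sup>+x. ennreal (density_weight \<gamma> x) * h (mob (inv\<^bsub>PGL2\<^esub> \<gamma>) x) \<partial>\<mu>)
       = (\<integral>\<^sup>+x. ennreal (weight s \<gamma> U) * (h (mob (inv\<^bsub>PGL2\<^esub> \<gamma>) x) * indicator (translate \<gamma> U) x) \<partial>\<mu>)"
    proof (intro nn_integral_cong)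
      fix x
      show "ennreal (density_weight \<gamma> x) * h (mob (inv\<^bsub>PGL2\<^esub> \<gamma>) x)
        = ennreal (weight s \<gamma> U) * (h (mob (inv\<^bsub>PGL2\<^esub> \<gamma>) x) * indicator (translate \<gamma> U) x)"
        using density_weight_cell[OF \<gamma> U, of x] supp[of "mob (inv\<^bsub>PGL2\<^esub> \<gamma>) x"]
        by (cases "mob (inv\<^bsub>PGL2\<^esub> \<gamma>) x \<in> U") (auto split: split_indicator)
    qed
    also have "\<dots> = ennreal (weight s \<gamma> U) * (\<integral>\<^sup>+x\<in>translate \<gamma> U. h (mob (inv\<^bsub>PGL2\<^esub> \<gamma>) x) \<partial>\<mu>)"
      by (rule nn_integral_cmult) measurable
    finally show "(\<integral>\<^sup>+x. ennreal (density_weight \<gamma> x) * h (mob (inv\<^bsub>PGL2\<^esub> \<gamma>) x) \<partial>\<mu>) = \<dots>" .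
  qed
  finally show ?thesis .
qed

lemma infsum_cell_measure:
  fixes h :: "'a \<Rightarrow> complex"
  assumes h: "integrable \<nu> h" and U: "U \<in> \<U>" and supp: "\<And>y. y \<notin> U \<Longrightarrow> h y = 0"
  shows "(\<Sum>\<^sub>\<infinity>\<gamma>\<in>\<Gamma>. complex_of_real (weight s \<gamma> U) *
     (LINT x : translate \<gamma> U | \<mu>. h (mob (inv\<^bsub>PGL2\<^esub> \<gamma>) x))) = (\<integral>y. h y \<partial>\<nu>)"
proof -
  let ?P = "count_space \<Gamma> \<Otimes>\<^sub>M \<mu>"
  let ?g = "\<lambda>p. h (mob (inv\<^bsub>PGL2\<^esub> (fst p)) (snd p))"
  have hm: "h \<in> borel_measurable borel" using borel_measurable_integrable[OF h] measurable_cong_sets[OF sets_cell_measure refl] by blast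
  note [measurable] = measurable_density_weight measurable_mob_pair hm
  interpret P: pair_sigma_finite "count_space \<Gamma>" \<mu>
    by (simp add: pair_sigma_finite_def sigma_finite_measure_count_space_countable countable_\<Gamma> haar.sigma_finite_measure_axioms)
  have g: "?g \<in> borel_measurable ?P" by measurable
  let ?k = "\<lambda>p. density_weight (fst p) (snd p) *\<^sub>R ?g p"
  have int: "integrable ?P ?k"
    using h g density_weight_nonneg unfolding \<nu>_def
    by (simp add: integrable_distr_eq integrable_density)
  have "(\<integral>y. h y \<partial>\<nu>) = (\<integral>p. ?k p \<partial>?P)"
    unfolding \<nu>_def using g density_weight_nonneg by (simp add: integral_distr integral_density)
  also have "\<dots> = (\<integral>\<gamma>. (\<integral>x. ?k (\<gamma>, x) \<partial>\<mu>) \<partial>count_space \<Gamma>)"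
    using P.integral_fst'[OF int] by simp
  also have "\<dots> = infsetsum (\<lambda>\<gamma>. \<integral>x. ?k (\<gamma>, x) \<partial>\<mu>) \<Gamma>" by (simp add: infsetsum_def)
  also have "\<dots> = (\<Sum>\<^sub>\<infinity>\<gamma>\<in>\<Gamma>. \<integral>x. ?k (\<gamma>, x) \<partial>\<mu>)"
    using P.integrable_fst'[OF int] by (intro infsetsum_infsum) (simp add: Infinite_Set_Sum.abs_summable_on_def)
  also have "\<dots> = (\<Sum>\<^sub>\<infinity>\<gamma>\<in>\<Gamma>. complex_of_real (weight s \<gamma> U) *
     (LINT x : translate \<gamma> U | \<mu>. h (mob (inv\<^bsub>PGL2\<^esub> \<gamma>) x)))"
  proof (rule infsum_cong)
    fix \<gamma> assume \<gamma>: "\<gamma> \<in> \<Gamma>"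
    have "(\<integral>x. ?k (\<gamma>, x) \<partial>\<mu>) = (\<integral>x. complex_of_real (weight s \<gamma> U) *
        (indicator (translate \<gamma> U) x *\<^sub>R h (mob (inv\<^bsub>PGL2\<^esub> \<gamma>) x)) \<partial>\<mu>)"
    proof (intro Bochner_Integration.integral_cong refl)
      fix x
      show "?k (\<gamma>, x) = complex_of_real (weight s \<gamma> U) * (indicator (translate \<gamma> U) x *\<^sub>R h (mob (inv\<^bsub>PGL2\<^esub> \<gamma>) x))"
        using density_weight_cell[OF \<gamma> U, of x] supp[of "mob (inv\<^bsub>PGL2\<^esub> \<gamma>) x"]
        by (cases "mob (inv\<^bsub>PGL2\<^esub> \<gamma>) x \<in> U") (auto simp: scaleR_conv_of_real split: split_indicator)
    qed
    then show "(\<integral>x. ?k (\<gamma>, x) \<partial>\<mu>) = complex_of_real (weight s \<gamma> U) *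
      (LINT x : translate \<gamma> U | \<mu>. h (mob (inv\<^bsub>PGL2\<^esub> \<gamma>) x))"
      by (simp only: set_lebesgue_integral_def integral_mult_right_zero)
  qed
  finally show ?thesis by simp
qed

lemma act_inv_translate:
  assumes "\<gamma> \<in> \<Gamma>" "x \<in> translate \<gamma> U"
  shows "act (inv\<^bsub>PGL2\<^esub> \<gamma>) (Some x) = Some (mob (inv\<^bsub>PGL2\<^esub> \<gamma>) x)" "mob (inv\<^bsub>PGL2\<^esub> \<gamma>) x \<in> U"
  using assms by (auto simp: translate_eq_vimage[OF carrier] act_Some)

lemma emeasure_cell_measure:
  assumes "E \<in> sets borel" "E \<subseteq> U" "U \<in> \<U>"
  shows "emeasure \<nu> E = (\<integral>\<^sup>+\<gamma>. ennreal (weight s \<gamma> U) * emeasure \<mu> (translate \<gamma> E) \<partial>count_space \<Gamma>)"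
proof -
  have "emeasure \<nu> E = (\<integral>\<^sup>+y. indicator E y \<partial>\<nu>)" using assms(1) by simp
  also have "\<dots> = (\<integral>\<^sup>+\<gamma>. ennreal (weight s \<gamma> U) *
     (\<integral>\<^sup>+x\<in>translate \<gamma> U. indicator E (mob (inv\<^bsub>PGL2\<^esub> \<gamma>) x) \<partial>\<mu>) \<partial>count_space \<Gamma>)"
    using assms by (intro nn_integral_cell_measure) (auto simp: indicator_def)
  also have "\<dots> = (\<integral>\<^sup>+\<gamma>. ennreal (weight s \<gamma> U) * emeasure \<mu> (translate \<gamma> E) \<partial>count_space \<Gamma>)"
  proof (intro nn_integral_cong)
    fix \<gamma> assume "\<gamma> \<in> space (count_space \<Gamma>)"
    then have \<gamma>: "\<gamma> \<in> \<Gamma>" by simp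
    have "(\<integral>\<^sup>+x\<in>translate \<gamma> U. indicator E (mob (inv\<^bsub>PGL2\<^esub> \<gamma>) x) \<partial>\<mu>) = (\<integral>\<^sup>+x. indicator (translate \<gamma> E) x \<partial>\<mu>)"
      using assms(2) by (intro nn_integral_cong) (auto simp: translate_eq_vimage[OF carrier[OF \<gamma>]] split: split_indicator)
    also have "\<dots> = emeasure \<mu> (translate \<gamma> E)"
      using borel_translate[OF carrier[OF \<gamma>] assms(1)] by (simp add: sets_\<mu>)
    finally show "ennreal (weight s \<gamma> U) * (\<integral>\<^sup>+x\<in>translate \<gamma> U. indicator E (mob (inv\<^bsub>PGL2\<^esub> \<gamma>) x) \<partial>\<mu>)
       = ennreal (weight s \<gamma> U) * emeasure \<mu> (translate \<gamma> E)" by simp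
  qed
  finally show ?thesis .
qed

lemma AE_in_F: "AE y in \<nu>. y \<in> F"
proof -
  have *: "density_weight \<gamma> x = 0 \<or> mob (inv\<^bsub>PGL2\<^esub> \<gamma>) x \<in> F" if "\<gamma> \<in> \<Gamma>" for \<gamma> x
  proof (rule disjCI)
    assume "mob (inv\<^bsub>PGL2\<^esub> \<gamma>) x \<notin> F"
    then have "x \<notin> translate \<gamma> U" if "U \<in> \<U>" for U
      using cell_subset[OF that] act_inv_translate(2)[OF \<open>\<gamma> \<in> \<Gamma>\<close>] by blast
    then show "density_weight \<gamma> x = 0" by (simp add: density_weight_def)
  qed
  have "AE p in density (count_space \<Gamma> \<Otimes>\<^sub>M \<mu>) (\<lambda>p. ennreal (density_weight (fst p) (snd p))).
      mob (inv\<^bsub>PGL2\<^esub> (fst p)) (snd p) \<in> F"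
  proof (subst AE_density)
    show "AE p in count_space \<Gamma> \<Otimes>\<^sub>M \<mu>. 0 < ennreal (density_weight (fst p) (snd p)) \<longrightarrow>
        mob (inv\<^bsub>PGL2\<^esub> (fst p)) (snd p) \<in> F"
    proof (rule AE_I2)
      fix p assume "p \<in> space (count_space \<Gamma> \<Otimes>\<^sub>M \<mu>)"
      then have "fst p \<in> \<Gamma>" by (auto simp: space_pair_measure)
      then show "0 < ennreal (density_weight (fst p) (snd p)) \<longrightarrow> mob (inv\<^bsub>PGL2\<^esub> (fst p)) (snd p) \<in> F"
        using *[of "fst p" "snd p"] by auto
    qed
  qed (use measurable_density_weight in measurable)
  then show ?thesis
    unfolding \<nu>_def using measurable_mob_pair by (subst AE_distr_iff) auto
qed

lemma emeasure_sum_cells: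
  assumes M: "sets M = sets borel" and "E \<in> sets borel" "E \<subseteq> F"
  shows "emeasure M E = (\<Sum>U\<in>\<U>. emeasure M (E \<inter> U))"
proof -
  have "(\<Sum>U\<in>\<U>. emeasure M (E \<inter> U)) = emeasure M (\<Union>U\<in>\<U>. E \<inter> U)"
  proof (rule sum_emeasure)
    show "disjoint_family_on (\<lambda>U. E \<inter> U) \<U>" unfolding disjoint_family_on_def using cell_eq by blast
    show "(\<lambda>U. E \<inter> U) ` \<U> \<subseteq> sets M" using assms borel_cell by auto
  qed (rule finite_\<U>)
  also have "(\<Union>U\<in>\<U>. E \<inter> U) = E" using assms Union_\<U> by auto
  finally show ?thesis by simp
qed

section \<open>Dichotomy for the total mass\<close>

text \<open>
  The elements with pole outside \<open>F\<close>, to which the distortion estimates apply.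
\<close>

definition regular_elements :: "('a^2^2) set set" where
  "regular_elements = {\<gamma>\<in>\<Gamma>. \<forall>x\<in>F. den \<gamma> x \<noteq> 0}"

text \<open>
  If \<open>\<gamma>\<close> has its pole in \<open>F\<close>, then \<open>\<infinity>\<close> lies in \<open>\<gamma>F\<close>.
\<close>

lemma at_most_one_pole:
  assumes "\<gamma> \<in> \<Gamma> - regular_elements" "\<delta> \<in> \<Gamma> - regular_elements"
  shows "\<gamma> = \<delta>"
proof (rule ccontr)
  assume ne: "\<gamma> \<noteq> \<delta>"
  obtain x y where "x \<in> F" "den \<gamma> x = 0" "y \<in> F" "den \<delta> y = 0" using assms by (auto simp: regular_elements_def)
  then have "None \<in> act \<gamma> ` Some ` F" "None \<in> act \<delta> ` Some ` F"
    by (force simp: act_Some)+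
  then show False
    using fundamental ne assms unfolding fundamental_domain_def disjoint_family_on_def by blast
qed

lemma one_regular: "\<one>\<^bsub>PGL2\<^esub> \<in> regular_elements"
proof -
  have "den \<one>\<^bsub>PGL2\<^esub> x \<noteq> 0" for x :: 'a
    using act_one[of "Some x"] by (auto simp: act_Some split: if_splits)
  then show ?thesis using one_\<Gamma> by (simp add: regular_elements_def)
qed

lemma translate_one: "translate \<one>\<^bsub>PGL2\<^esub> E = (E :: 'a set)"
  by (auto simp: translate_def finite_points_def act_one)

lemma bounded_translate:
  assumes "\<gamma> \<in> regular_elements" "E \<subseteq> F"
  shows "bounded (translate \<gamma> E)"
proof -
  have "compact (mob \<gamma> ` F)"
    using assms(1) continuous_on_subset[OF continuous_on_mob, of F \<gamma>]
    by (intro compact_continuous_image compact_F) (auto simp: regular_elements_def)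
  then show ?thesis
    using assms(2) by (auto simp: translate_eq_image intro: bounded_subset[OF compact_imp_bounded])
qed

text \<open>
  If \<open>U\<close> contains the pole, then \<open>\<gamma>U\<close> has infinite measure but the weight is 0; otherwise \<open>\<gamma>U\<close> is
  compact.
\<close>

lemma weighted_translate_finite:
  assumes \<gamma>: "\<gamma> \<in> \<Gamma>" and U: "U \<in> \<U>"
  shows "ennreal (weight s \<gamma> U) * emeasure \<mu> (translate \<gamma> U) < \<infinity>"
proof (cases "\<exists>p\<in>U. den \<gamma> p = 0")
  case True
  then obtain p where "p \<in> U" "den \<gamma> p = 0" by blast
  then have "deriv_max \<gamma> U = \<infinity>" using deriv_max_pole[OF open_cell[OF U] _ _ carrier[OF \<gamma>]] by blast
  then show ?thesis by (simp add: weight_def)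
next
  case False
  then have img: "translate \<gamma> U = mob \<gamma> ` U" unfolding translate_eq_image by auto
  have "compact U" using compact_F closed_cell[OF U] cell_subset[OF U] by (metis compact_Int_closed inf.absorb2)
  then have "compact (mob \<gamma> ` U)"
    using False continuous_on_subset[OF continuous_on_mob, of U \<gamma>] by (intro compact_continuous_image) auto
  then have "emeasure \<mu> (mob \<gamma> ` U) < \<infinity>" by (rule haar_measureD(3)[OF haar])
  then show ?thesis unfolding img by (simp add: ennreal_mult_less_top)
qed

text \<open>
  The contributions of \<open>\<gamma>\<close> to \<open>\<nu>(V)\<close> and to \<open>\<nu>(E)\<close> differ at most by a factor independent of \<open>\<gamma>\<close>. Both
  are compared with \<open>max 1 \<kappa> powr (- s)\<close> times the modulus of \<open>a\<close>, where \<open>\<kappa> = \<bar>a\<bar> = \<bar>\<gamma>'(x0)\<bar>\<close>.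
\<close>

lemma cell_measure_comparable:
  obtains K :: ennreal where "K < \<infinity>"
    "\<And>\<gamma> U V E. \<gamma> \<in> regular_elements \<Longrightarrow> U \<in> \<U> \<Longrightarrow> V \<in> \<U> \<Longrightarrow> U \<noteq> {} \<Longrightarrow> V \<noteq> {} \<Longrightarrow> E \<in> sets borel \<Longrightarrow> E \<subseteq> U \<Longrightarrow>
      ennreal (weight s \<gamma> V) * emeasure \<mu> (translate \<gamma> V) * emeasure \<mu> E
      \<le> K * (ennreal (weight s \<gamma> U) * emeasure \<mu> (translate \<gamma> E))"
proof -
  obtain C where C: "C \<ge> 1" "\<And>\<gamma>. \<forall>x\<in>F. den \<gamma> x \<noteq> 0 \<Longrightarrow> \<forall>x\<in>F. \<forall>y\<in>F. absK (den \<gamma> x) \<le> C * absK (den \<gamma> y)"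
    using den_uniformly_comparable[OF compact_F open_F] by blast
  obtain t :: 'a where t: "t \<noteq> 0" "C\<^sup>2 \<le> absK t" using ex_absK_ge by blast
  define k where "k = ennreal ((C\<^sup>2) powr s)"
  define m where "m = haar_modulus \<mu> t"
  define K where "K = k * k * m * m * emeasure \<mu> F"
  have "emeasure \<mu> F < \<infinity>" using haar_measureD(3)[OF haar compact_F] .
  then have fin: "K < \<infinity>" using haar_modulus_finite[OF haar, of t]
    by (simp add: K_def k_def m_def ennreal_mult_less_top)
  have main: "ennreal (weight s \<gamma> V) * emeasure \<mu> (translate \<gamma> V) * emeasure \<mu> E
      \<le> K * (ennreal (weight s \<gamma> U) * emeasure \<mu> (translate \<gamma> E))"
    if \<gamma>: "\<gamma> \<in> regular_elements" and UV: "U \<in> \<U>" "V \<in> \<U>" "U \<noteq> {}" "V \<noteq> {}" and E: "E \<in> sets borel" "E \<subseteq> U"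
    for \<gamma> U V E
  proof -
    have nz: "\<forall>x\<in>F. den \<gamma> x \<noteq> 0" and cG: "\<gamma> \<in> carrier PGL2" using \<gamma> carrier by (auto simp: regular_elements_def)
    obtain x0 where x0: "x0 \<in> F" using UV cell_subset by blast
    define a where "a = det (representative \<gamma>) / (den \<gamma> x0)\<^sup>2"
    define \<kappa> where "\<kappa> = absK (det (representative \<gamma>)) / (absK (den \<gamma> x0))\<^sup>2"
    define \<omega> where "\<omega> = ennreal (max 1 \<kappa> powr (- s))"
    note C' = C(1) C(2)[OF nz]
    have w1: "ennreal (weight s \<gamma> V) \<le> k * \<omega>"
      using weight_comparable(1)[OF cell_subset[OF UV(2)] UV(4) nz x0 s_nonneg C', folded \<kappa>_def]
      unfolding k_def \<omega>_def by (subst ennreal_mult[symmetric]) (auto intro!: ennreal_leI)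
    have w2: "\<omega> \<le> k * ennreal (weight s \<gamma> U)"
      using weight_comparable(2)[OF cell_subset[OF UV(1)] UV(3) nz x0 s_nonneg C', folded \<kappa>_def]
      unfolding k_def \<omega>_def by (subst ennreal_mult[symmetric]) (auto intro!: ennreal_leI)
    have EF: "E \<subseteq> F" using E(2) cell_subset[OF UV(1)] by blast
    note meas = translate_measure_comparable[OF haar cG compact_imp_bounded[OF compact_F] _ _ nz x0 C' t, folded a_def m_def]
    have m1: "emeasure \<mu> (translate \<gamma> V) \<le> haar_modulus \<mu> a * m * emeasure \<mu> V"
      using UV(2) cell_subset[OF UV(2)] bounded_translate[OF \<gamma>] by (intro meas(1)) auto
    have m2: "haar_modulus \<mu> a * emeasure \<mu> E \<le> m * emeasure \<mu> (translate \<gamma> E)"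
      using E EF bounded_translate[OF \<gamma>] by (intro meas(2)) auto
    have VF: "emeasure \<mu> V \<le> emeasure \<mu> F" using cell_subset[OF UV(2)] by (intro emeasure_mono) auto
    have "ennreal (weight s \<gamma> V) * emeasure \<mu> (translate \<gamma> V) * emeasure \<mu> E
        \<le> k * \<omega> * (haar_modulus \<mu> a * m * emeasure \<mu> F) * emeasure \<mu> E"
      using w1 m1 VF by (intro mult_mono order_trans[OF m1]) auto
    also have "\<dots> = k * \<omega> * m * emeasure \<mu> F * (haar_modulus \<mu> a * emeasure \<mu> E)"
      by (simp add: ac_simps)
    also have "\<dots> \<le> k * (k * ennreal (weight s \<gamma> U)) * m * emeasure \<mu> F * (m * emeasure \<mu> (translate \<gamma> E))"
      by (rule mult_mono[OF mult_right_mono[OF mult_right_mono[OF mult_left_mono[OF w2]]] m2]) auto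
    also have "\<dots> = K * (ennreal (weight s \<gamma> U) * emeasure \<mu> (translate \<gamma> E))"
      by (simp add: K_def ac_simps)
    finally show ?thesis .
  qed
  show ?thesis by (rule that[OF fin main])
qed

lemma weight_one_pos: "U \<in> \<U> \<Longrightarrow> U \<noteq> {} \<Longrightarrow> 0 < weight s \<one>\<^bsub>PGL2\<^esub> U"
proof -
  assume U: "U \<in> \<U>" "U \<noteq> {}"
  have nz: "\<forall>x\<in>F. den \<one>\<^bsub>PGL2\<^esub> x \<noteq> 0" using one_regular by (simp add: regular_elements_def)
  obtain x0 where x0: "x0 \<in> F" using U cell_subset by blast
  obtain C where C: "C \<ge> 1" "\<And>\<gamma>. \<forall>x\<in>F. den \<gamma> x \<noteq> 0 \<Longrightarrow> \<forall>x\<in>F. \<forall>y\<in>F. absK (den \<gamma> x) \<le> C * absK (den \<gamma> y)"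
    using den_uniformly_comparable[OF compact_F open_F] by blast
  have "0 < max 1 (absK (det (representative (\<one>\<^bsub>PGL2\<^esub> :: ('a^2^2) set))) / (absK (den \<one>\<^bsub>PGL2\<^esub> x0))\<^sup>2) powr (- s)" by simp
  also have "\<dots> \<le> (C\<^sup>2) powr s * weight s \<one>\<^bsub>PGL2\<^esub> U"
    by (rule weight_comparable(2)[OF cell_subset[OF U(1)] U(2) nz x0 s_nonneg C(1) C(2)[OF nz]])
  finally show ?thesis using weight_nonneg[of s "\<one>\<^bsub>PGL2\<^esub>" U] by (metis less_eq_real_def mult_zero_right)
qed

text \<open>
  The identity contributes a positive multiple of the Haar measure to \<open>\<nu>\<close>, and every other element
  contributes 0 on a null set.
\<close>

lemma null_iff:
  assumes "E \<in> sets borel" "E \<subseteq> F"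
  shows "emeasure \<nu> E = 0 \<longleftrightarrow> emeasure \<mu> E = 0"
proof -
  have *: "emeasure \<nu> E' = 0 \<longleftrightarrow> emeasure \<mu> E' = 0" if E': "E' \<in> sets borel" "E' \<subseteq> U" and U: "U \<in> \<U>" for E' U
  proof
    assume 0: "emeasure \<nu> E' = 0"
    show "emeasure \<mu> E' = 0"
    proof (cases "U = {}")
      case False
      have "ennreal (weight s \<one>\<^bsub>PGL2\<^esub> U) * emeasure \<mu> (translate \<one>\<^bsub>PGL2\<^esub> E') \<le> emeasure \<nu> E'"
        unfolding emeasure_cell_measure[OF E' U]
        by (rule nn_integral_ge_point[OF one_\<Gamma>, of "\<lambda>\<gamma>. ennreal (weight s \<gamma> U) * emeasure \<mu> (translate \<gamma> E')"])
      then show ?thesis using 0 weight_one_pos[OF U False] by (simp add: translate_one ennreal_eq_0_iff)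
    qed (use E' in auto)
  next
    assume "emeasure \<mu> E' = 0"
    then show "emeasure \<nu> E' = 0"
      unfolding emeasure_cell_measure[OF E' U]
      using translate_null[OF haar carrier E'(1)] by (subst nn_integral_0_iff_AE) (auto simp: AE_count_space)
  qed
  have "\<forall>U\<in>\<U>. emeasure \<nu> (E \<inter> U) = 0 \<longleftrightarrow> emeasure \<mu> (E \<inter> U) = 0"
    by (intro ballI *) (use assms in auto)
  then show ?thesis
    using emeasure_sum_cells[OF sets_cell_measure assms] emeasure_sum_cells[OF sets_\<mu> assms] finite_\<U> by simp
qed

text \<open>
  If the mass is infinite, then so is \<open>\<nu>(V)\<close> for some cell \<open>V\<close>. The at most one element with a pole in
  \<open>F\<close> contributes a finite amount, so the sum over the other elements diverges, and by comparison so does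
  the sum for \<open>\<nu>(E)\<close>.
\<close>

lemma cell_measure_dichotomy:
  assumes "\<not> finite_measure \<nu>" "E \<in> sets borel" "E \<subseteq> F" "emeasure \<mu> E \<noteq> 0"
  shows "emeasure \<nu> E = \<infinity>"
proof -
  have "emeasure \<nu> UNIV = \<infinity>"
    using assms(1) by (metis finite_measureI infinity_ennreal_def space_cell_measure)
  moreover have "emeasure \<nu> UNIV = emeasure \<nu> F"
    using AE_in_F by (intro emeasure_eq_AE) auto
  ultimately have "(\<Sum>U\<in>\<U>. emeasure \<nu> (F \<inter> U)) = \<infinity>"
    using emeasure_sum_cells[OF sets_cell_measure borel_F order_refl] by simp
  then obtain V where V: "V \<in> \<U>" "emeasure \<nu> (F \<inter> V) = \<infinity>"
    using finite_\<U> by (auto simp: ennreal_sum_eq_top)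
  then have Vinf: "emeasure \<nu> V = \<infinity>" using cell_subset[OF V(1)] by (simp add: Int_absorb1)
  then have Vne: "V \<noteq> {}" by auto
  have "(\<Sum>U\<in>\<U>. emeasure \<mu> (E \<inter> U)) \<noteq> 0"
    using emeasure_sum_cells[OF sets_\<mu> assms(2,3)] assms(4) by simp
  then obtain U where U: "U \<in> \<U>" "emeasure \<mu> (E \<inter> U) \<noteq> 0" using finite_\<U> by auto
  define E' where "E' = E \<inter> U"
  have E': "E' \<in> sets borel" "E' \<subseteq> U" "emeasure \<mu> E' \<noteq> 0" using assms(2) U by (auto simp: E'_def)
  then have Une: "U \<noteq> {}" by auto
  define f where "f \<gamma> = ennreal (weight s \<gamma> V) * emeasure \<mu> (translate \<gamma> V)" for \<gamma>
  have sub: "regular_elements \<subseteq> \<Gamma>" by (auto simp: regular_elements_def)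
  have "finite (\<Gamma> - regular_elements)"
  proof (cases "\<Gamma> - regular_elements = {}")
    case True
    show ?thesis unfolding True by simp
  next
    case False
    then obtain \<gamma> where "\<gamma> \<in> \<Gamma> - regular_elements" by blast
    then have "\<Gamma> - regular_elements \<subseteq> {\<gamma>}" using at_most_one_pole by blast
    then show ?thesis using finite_subset by blast
  qed
  have "(\<integral>\<^sup>+\<gamma>. f \<gamma> * indicator (\<Gamma> - regular_elements) \<gamma> \<partial>count_space \<Gamma>)
      = (\<Sum>\<gamma>\<in>\<Gamma> - regular_elements. f \<gamma> * indicator (\<Gamma> - regular_elements) \<gamma>)"
    using \<open>finite (\<Gamma> - regular_elements)\<close> by (intro nn_integral_count_space') auto
  also have "\<dots> < \<infinity>"
    using \<open>finite (\<Gamma> - regular_elements)\<close> weighted_translate_finite[OF _ V(1)]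
    by (auto simp: f_def split: split_indicator)
  finally have exc: "(\<integral>\<^sup>+\<gamma>. f \<gamma> * indicator (\<Gamma> - regular_elements) \<gamma> \<partial>count_space \<Gamma>) < \<infinity>" .
  have "emeasure \<nu> V = (\<integral>\<^sup>+\<gamma>. f \<gamma> \<partial>count_space \<Gamma>)"
    unfolding f_def by (rule emeasure_cell_measure[OF borel_cell[OF V(1)] order_refl V(1)])
  also have "\<dots> = (\<integral>\<^sup>+\<gamma>. f \<gamma> * indicator regular_elements \<gamma> + f \<gamma> * indicator (\<Gamma> - regular_elements) \<gamma> \<partial>count_space \<Gamma>)"
    by (intro nn_integral_cong) (auto split: split_indicator)
  also have "\<dots> = (\<integral>\<^sup>+\<gamma>. f \<gamma> * indicator regular_elements \<gamma> \<partial>count_space \<Gamma>) +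
     (\<integral>\<^sup>+\<gamma>. f \<gamma> * indicator (\<Gamma> - regular_elements) \<gamma> \<partial>count_space \<Gamma>)"
    by (rule nn_integral_add) auto
  finally have "(\<integral>\<^sup>+\<gamma>. f \<gamma> * indicator regular_elements \<gamma> \<partial>count_space \<Gamma>) +
     (\<integral>\<^sup>+\<gamma>. f \<gamma> * indicator (\<Gamma> - regular_elements) \<gamma> \<partial>count_space \<Gamma>) = \<infinity>"
    using Vinf by simp
  then have inf: "(\<integral>\<^sup>+\<gamma>. f \<gamma> * indicator regular_elements \<gamma> \<partial>count_space \<Gamma>) = \<infinity>"
    using exc by (auto simp: ennreal_add_eq_top)
  obtain K where K: "K < \<infinity>" "\<And>\<gamma>. \<gamma> \<in> regular_elements \<Longrightarrow>
      f \<gamma> * emeasure \<mu> E' \<le> K * (ennreal (weight s \<gamma> U) * emeasure \<mu> (translate \<gamma> E'))"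
    using cell_measure_comparable U(1) V(1) Une Vne E'(1,2) unfolding f_def by metis
  have "\<infinity> = (\<integral>\<^sup>+\<gamma>. f \<gamma> * indicator regular_elements \<gamma> \<partial>count_space \<Gamma>) * emeasure \<mu> E'"
    unfolding inf using E'(3) by (simp add: ennreal_top_mult)
  also have "\<dots> = (\<integral>\<^sup>+\<gamma>. f \<gamma> * indicator regular_elements \<gamma> * emeasure \<mu> E' \<partial>count_space \<Gamma>)"
    by (rule nn_integral_multc[symmetric]) auto
  also have "\<dots> \<le> (\<integral>\<^sup>+\<gamma>. K * (ennreal (weight s \<gamma> U) * emeasure \<mu> (translate \<gamma> E')) \<partial>count_space \<Gamma>)"
    using K(2) by (intro nn_integral_mono) (auto split: split_indicator)
  also have "\<dots> = K * emeasure \<nu> E'"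
    unfolding emeasure_cell_measure[OF E'(1,2) U(1)] by (rule nn_integral_cmult) auto
  finally have "emeasure \<nu> E' = \<infinity>"
    using K(1) by (metis ennreal_mult_less_top infinity_ennreal_def less_top not_less top.extremum_strict top_unique)
  moreover have "emeasure \<nu> E' \<le> emeasure \<nu> E"
    using assms(2) by (intro emeasure_mono) (auto simp: E'_def)
  ultimately show ?thesis by (simp add: top_unique)
qed

end

section \<open>Block operators on finite measure spaces\<close>

lemma borel_measurable_cnj [measurable]: "cnj \<in> borel_measurable borel"
  by (intro borel_measurable_continuous_onI continuous_on_cnj continuous_on_id)

definition sq_integrable :: "'b measure \<Rightarrow> ('b \<Rightarrow> complex) \<Rightarrow> bool" where
  "sq_integrable M \<phi> \<longleftrightarrow> \<phi> \<in> borel_measurable M \<and> integrable M (\<lambda>y. (norm (\<phi> y))\<^sup>2)"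

lemma sq_integrableD:
  assumes "sq_integrable M \<phi>"
  shows "\<phi> \<in> borel_measurable M" "integrable M (\<lambda>y. (norm (\<phi> y))\<^sup>2)"
  using assms by (simp_all only: sq_integrable_def)

lemma sq_integrable_mult:
  assumes "sq_integrable M \<phi>" "sq_integrable M \<psi>"
  shows "integrable M (\<lambda>y. \<phi> y * cnj (\<psi> y))"
proof (rule Bochner_Integration.integrable_bound)
  show "integrable M (\<lambda>y. (norm (\<phi> y))\<^sup>2 + (norm (\<psi> y))\<^sup>2)"
    using assms by (simp add: sq_integrable_def)
  have [measurable]: "\<phi> \<in> borel_measurable M" "\<psi> \<in> borel_measurable M" using assms by (simp_all add: sq_integrableD)
  show "(\<lambda>y. \<phi> y * cnj (\<psi> y)) \<in> borel_measurable M" by measurable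
  show "AE y in M. norm (\<phi> y * cnj (\<psi> y)) \<le> norm ((norm (\<phi> y))\<^sup>2 + (norm (\<psi> y))\<^sup>2)"
  proof (rule AE_I2)
    fix y
    have "2 * (norm (\<phi> y) * norm (\<psi> y)) \<le> (norm (\<phi> y))\<^sup>2 + (norm (\<psi> y))\<^sup>2"
      using sum_squares_bound[of "norm (\<phi> y)" "norm (\<psi> y)"] by simp
    moreover have "0 \<le> norm (\<phi> y) * norm (\<psi> y)" by simp
    ultimately have "norm (\<phi> y) * norm (\<psi> y) \<le> (norm (\<phi> y))\<^sup>2 + (norm (\<psi> y))\<^sup>2" by linarith
    then show "norm (\<phi> y * cnj (\<psi> y)) \<le> norm ((norm (\<phi> y))\<^sup>2 + (norm (\<psi> y))\<^sup>2)"
      by (simp add: norm_mult)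
  qed
qed

lemma sq_integrable_lincomb:
  assumes "sq_integrable M \<phi>" "sq_integrable M \<psi>"
  shows "sq_integrable M (\<lambda>y. a * \<phi> y + b * \<psi> y)"
proof -
  have m [measurable]: "\<phi> \<in> borel_measurable M" "\<psi> \<in> borel_measurable M" using assms sq_integrableD by blast+
  have "integrable M (\<lambda>y. (norm (a * \<phi> y + b * \<psi> y))\<^sup>2)"
  proof (rule Bochner_Integration.integrable_bound)
    show "integrable M (\<lambda>y. 2 * (norm a)\<^sup>2 * (norm (\<phi> y))\<^sup>2 + 2 * (norm b)\<^sup>2 * (norm (\<psi> y))\<^sup>2)"
      using sq_integrableD(2)[OF assms(1)] sq_integrableD(2)[OF assms(2)] by simp
    show "AE y in M. norm ((norm (a * \<phi> y + b * \<psi> y))\<^sup>2) \<le> norm (2 * (norm a)\<^sup>2 * (norm (\<phi> y))\<^sup>2 + 2 * (norm b)\<^sup>2 * (norm (\<psi> y))\<^sup>2)"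
    proof (rule AE_I2)
      fix y
      have "(norm (a * \<phi> y + b * \<psi> y))\<^sup>2 \<le> (norm (a * \<phi> y) + norm (b * \<psi> y))\<^sup>2"
        by (intro power_mono norm_triangle_ineq) simp
      also have "\<dots> \<le> 2 * (norm (a * \<phi> y))\<^sup>2 + 2 * (norm (b * \<psi> y))\<^sup>2"
        using sum_squares_bound[of "norm (a * \<phi> y)" "norm (b * \<psi> y)"] by (simp add: power2_sum)
      also have "\<dots> = 2 * (norm a)\<^sup>2 * (norm (\<phi> y))\<^sup>2 + 2 * (norm b)\<^sup>2 * (norm (\<psi> y))\<^sup>2"
        by (simp add: norm_mult power_mult_distrib)
      finally show "norm ((norm (a * \<phi> y + b * \<psi> y))\<^sup>2) \<le> norm (2 * (norm a)\<^sup>2 * (norm (\<phi> y))\<^sup>2 + 2 * (norm b)\<^sup>2 * (norm (\<psi> y))\<^sup>2)"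
        by simp
    qed
  qed measurable
  then show ?thesis using m unfolding sq_integrable_def by (intro conjI) measurable
qed

lemma sq_integrable_AE_zero:
  assumes "\<phi> \<in> borel_measurable M" "AE y in M. \<phi> y = 0"
  shows "sq_integrable M \<phi>"
proof -
  have "(\<lambda>y. (norm (\<phi> y))\<^sup>2) \<in> borel_measurable M" using assms(1) by measurable
  moreover have "AE y in M. 0 = (norm (\<phi> y))\<^sup>2" using assms(2) by eventually_elim simp
  ultimately have "integrable M (\<lambda>y. (norm (\<phi> y))\<^sup>2)"
    by (rule integrable_cong_AE_imp[OF integrable_zero])
  then show ?thesis using assms(1) by (simp add: sq_integrable_def)
qed

lemma sq_integral_zero_iff:
  assumes "sq_integrable M \<phi>"
  shows "(\<integral>y. (norm (\<phi> y))\<^sup>2 \<partial>M) = 0 \<longleftrightarrow> (AE y in M. \<phi> y = 0)"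
  using integral_nonneg_eq_0_iff_AE[OF sq_integrableD(2)[OF assms]] by simp

text \<open>
  For a kernel that has the constant value \<open>c U V\<close> on \<open>U \<times> V\<close>, the operator below sends \<open>\<phi>\<close> to the
  integral of the kernel times \<open>\<phi> y - \<phi> x\<close> over \<open>y\<close>.
\<close>

locale block_operator = finite_measure M for M :: "'b measure" +
  fixes \<U> :: "'b set set" and c :: "'b set \<Rightarrow> 'b set \<Rightarrow> real"
  assumes finite_blocks: "finite \<U>" and sets_blocks: "\<And>U. U \<in> \<U> \<Longrightarrow> U \<in> sets M"
    and sym: "\<And>U V. U \<in> \<U> \<Longrightarrow> V \<in> \<U> \<Longrightarrow> c U V = c V U"
begin

definition block_integral :: "'b set \<Rightarrow> ('b \<Rightarrow> complex) \<Rightarrow> complex" where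
  "block_integral V \<phi> = (\<integral>y. indicator V y * \<phi> y \<partial>M)"

definition block_op :: "('b \<Rightarrow> complex) \<Rightarrow> 'b \<Rightarrow> complex" where
  "block_op \<phi> y = (\<Sum>U\<in>\<U>. \<Sum>V\<in>\<U>. indicator U y * (complex_of_real (c U V) * (block_integral V \<phi> - complex_of_real (measure M V) * \<phi> y)))"

lemma sq_integrable_integrable:
  assumes "sq_integrable M \<phi>"
  shows "integrable M \<phi>"
proof -
  have "(\<lambda>y. norm (\<phi> y)) \<in> borel_measurable M"
    by (rule measurable_compose[OF sq_integrableD(1)[OF assms] borel_measurable_norm])
  then have "integrable M (\<lambda>y. norm (\<phi> y))"
    by (rule square_integrable_imp_integrable[OF _ sq_integrableD(2)[OF assms]])
  then show ?thesis by (rule integrable_norm_cancel[OF _ sq_integrableD(1)[OF assms]])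
qed

lemma integral_norm_squared_le:
  assumes "sq_integrable M \<phi>"
  shows "(\<integral>y. norm (\<phi> y) \<partial>M)\<^sup>2 \<le> measure M (space M) * (\<integral>y. (norm (\<phi> y))\<^sup>2 \<partial>M)"
proof -
  have [measurable]: "\<phi> \<in> borel_measurable M" using assms by (auto simp: sq_integrable_def)
  have 1: "(\<integral>\<^sup>+y. ennreal (norm (\<phi> y)) \<partial>M) = ennreal (\<integral>y. norm (\<phi> y) \<partial>M)"
    using sq_integrable_integrable[OF assms] by (intro nn_integral_eq_integral) auto
  have 2: "(\<integral>\<^sup>+y. (ennreal (norm (\<phi> y)))\<^sup>2 \<partial>M) = ennreal (\<integral>y. (norm (\<phi> y))\<^sup>2 \<partial>M)"
    using assms by (subst nn_integral_eq_integral[symmetric]) (auto simp: sq_integrable_def ennreal_power)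
  have "(\<integral>\<^sup>+y. ennreal (norm (\<phi> y)) * 1 \<partial>M)\<^sup>2 \<le> (\<integral>\<^sup>+y. (ennreal (norm (\<phi> y)))\<^sup>2 \<partial>M) * (\<integral>\<^sup>+y. 1\<^sup>2 \<partial>M)"
    by (rule Cauchy_Schwarz_nn_integral) auto
  then have "ennreal ((\<integral>y. norm (\<phi> y) \<partial>M)\<^sup>2) \<le> ennreal ((\<integral>y. (norm (\<phi> y))\<^sup>2 \<partial>M) * measure M (space M))"
    unfolding mult_1_right 1 2 by (simp add: ennreal_power emeasure_eq_measure ennreal_mult[symmetric])
  then show ?thesis by (subst (asm) ennreal_le_iff) (auto simp: mult.commute)
qed

lemma block_integral_le:
  assumes "sq_integrable M \<phi>" "V \<in> \<U>"
  shows "norm (block_integral V \<phi>) \<le> (\<integral>y. norm (\<phi> y) \<partial>M)"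
  unfolding block_integral_def
proof (rule order_trans[OF integral_norm_bound], rule integral_mono)
  have [measurable]: "V \<in> sets M" "\<phi> \<in> borel_measurable M" using assms sets_blocks by (auto simp: sq_integrable_def)
  have i: "integrable M \<phi>" using sq_integrable_integrable[OF assms(1)] .
  then show "integrable M (\<lambda>y. norm (\<phi> y))" by simp
  show "integrable M (\<lambda>y. norm (indicator V y * \<phi> y))"
    by (rule Bochner_Integration.integrable_bound[OF i]) (auto simp: norm_mult split: split_indicator)
qed (auto simp: norm_mult split: split_indicator)

lemma measurable_block_op:
  assumes "sq_integrable M \<phi>"
  shows "block_op \<phi> \<in> borel_measurable M"
proof -
  have [measurable]: "\<phi> \<in> borel_measurable M" using assms by (simp add: sq_integrable_def)
  have ind: "(indicator U :: 'b \<Rightarrow> complex) \<in> borel_measurable M" if "U \<in> \<U>" for U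
    using sets_blocks[OF that] by measurable
  show ?thesis
    unfolding block_op_def[abs_def] using ind by (intro borel_measurable_sum borel_measurable_times) auto
qed

definition block_bound :: real where
  "block_bound = (\<Sum>U\<in>\<U>. \<Sum>V\<in>\<U>. \<bar>c U V\<bar>)"

lemma norm_block_op_le:
  assumes "sq_integrable M \<phi>"
  shows "norm (block_op \<phi> y) \<le> block_bound * ((\<integral>y. norm (\<phi> y) \<partial>M) + measure M (space M) * norm (\<phi> y))"
proof -
  let ?r = "(\<integral>y. norm (\<phi> y) \<partial>M) + measure M (space M) * norm (\<phi> y)"
  have "norm (block_op \<phi> y) \<le> (\<Sum>U\<in>\<U>. \<Sum>V\<in>\<U>. norm (indicator U y * (complex_of_real (c U V) * (block_integral V \<phi> - complex_of_real (measure M V) * \<phi> y))))"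
    unfolding block_op_def by (intro order_trans[OF norm_sum] sum_mono norm_sum)
  also have "\<dots> \<le> (\<Sum>U\<in>\<U>. \<Sum>V\<in>\<U>. \<bar>c U V\<bar> * ?r)"
  proof (intro sum_mono)
    fix U V assume UV: "U \<in> \<U>" "V \<in> \<U>"
    have "norm (block_integral V \<phi> - complex_of_real (measure M V) * \<phi> y) \<le> norm (block_integral V \<phi>) + norm (complex_of_real (measure M V) * \<phi> y)"
      by (rule norm_triangle_ineq4)
    also have "\<dots> \<le> ?r"
      using block_integral_le[OF assms UV(2)] bounded_measure[of V]
      by (intro add_mono) (auto simp: norm_mult intro!: mult_right_mono)
    finally have r: "norm (block_integral V \<phi> - complex_of_real (measure M V) * \<phi> y) \<le> ?r" .
    have "norm (indicator U y * (complex_of_real (c U V) * (block_integral V \<phi> - complex_of_real (measure M V) * \<phi> y)))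
        \<le> \<bar>c U V\<bar> * norm (block_integral V \<phi> - complex_of_real (measure M V) * \<phi> y)"
      by (auto simp: norm_mult split: split_indicator)
    also have "\<dots> \<le> \<bar>c U V\<bar> * ?r" using r by (intro mult_left_mono) auto
    finally show "norm (indicator U y * (complex_of_real (c U V) * (block_integral V \<phi> - complex_of_real (measure M V) * \<phi> y))) \<le> \<bar>c U V\<bar> * ?r" .
  qed
  also have "\<dots> = block_bound * ?r" by (simp add: block_bound_def sum_distrib_right)
  finally show ?thesis .
qed

lemma block_bound_nonneg: "0 \<le> block_bound"
  by (auto simp: block_bound_def intro!: sum_nonneg)

lemma
  assumes \<phi>: "sq_integrable M \<phi>"
  shows sq_integrable_block_op: "sq_integrable M (block_op \<phi>)"
    and block_op_bounded: "(\<integral>y. (norm (block_op \<phi> y))\<^sup>2 \<partial>M)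
      \<le> (2 * block_bound * measure M (space M))\<^sup>2 * (\<integral>y. (norm (\<phi> y))\<^sup>2 \<partial>M)"
proof -
  let ?a = "\<integral>y. norm (\<phi> y) \<partial>M" and ?m = "measure M (space M)" and ?q = "\<integral>y. (norm (\<phi> y))\<^sup>2 \<partial>M"
  let ?g = "\<lambda>y. 2 * block_bound\<^sup>2 * ?a\<^sup>2 + 2 * block_bound\<^sup>2 * ?m\<^sup>2 * (norm (\<phi> y))\<^sup>2"
  have le: "(norm (block_op \<phi> y))\<^sup>2 \<le> ?g y" for y
  proof -
    have "(norm (block_op \<phi> y))\<^sup>2 \<le> (block_bound * (?a + ?m * norm (\<phi> y)))\<^sup>2"
      by (intro power_mono norm_block_op_le \<phi>) simp
    also have "\<dots> = block_bound\<^sup>2 * (?a + ?m * norm (\<phi> y))\<^sup>2" by (simp add: power_mult_distrib)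
    also have "\<dots> \<le> block_bound\<^sup>2 * (2 * ?a\<^sup>2 + 2 * (?m * norm (\<phi> y))\<^sup>2)"
      using sum_squares_bound[of ?a "?m * norm (\<phi> y)"] by (intro mult_left_mono) (simp_all add: power2_sum)
    also have "\<dots> = ?g y" by (simp add: algebra_simps power_mult_distrib)
    finally show ?thesis .
  qed
  have g: "integrable M ?g" using \<phi> by (simp add: sq_integrable_def)
  have i: "integrable M (\<lambda>y. (norm (block_op \<phi> y))\<^sup>2)"
    using measurable_block_op[OF \<phi>] le order_trans[OF le abs_ge_self]
    by (intro Bochner_Integration.integrable_bound[OF g]) auto
  then show "sq_integrable M (block_op \<phi>)" using measurable_block_op[OF \<phi>] by (simp add: sq_integrable_def)
  have "(\<integral>y. (norm (block_op \<phi> y))\<^sup>2 \<partial>M) \<le> (\<integral>y. ?g y \<partial>M)"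
    by (intro integral_mono i g le)
  also have "\<dots> = 2 * block_bound\<^sup>2 * ?a\<^sup>2 * ?m + 2 * block_bound\<^sup>2 * ?m\<^sup>2 * ?q"
    using \<phi> by (simp add: sq_integrable_def)
  also have "\<dots> \<le> 2 * block_bound\<^sup>2 * (?m * ?q) * ?m + 2 * block_bound\<^sup>2 * ?m\<^sup>2 * ?q"
    by (intro add_mono mult_right_mono mult_left_mono integral_norm_squared_le \<phi>) auto
  also have "\<dots> = (2 * block_bound * ?m)\<^sup>2 * ?q" by (simp add: power2_eq_square)
  finally show "(\<integral>y. (norm (block_op \<phi> y))\<^sup>2 \<partial>M) \<le> (2 * block_bound * ?m)\<^sup>2 * ?q" .
qed

text \<open>
  Both terms of the expansion are visibly Hermitian in \<open>(\<phi>, \<psi>)\<close> once \<open>U\<close> and \<open>V\<close> are exchanged in the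
  first one.
\<close>

lemma integral_block_op:
  assumes \<phi>: "sq_integrable M \<phi>" and \<psi>: "sq_integrable M \<psi>"
  shows "(\<integral>y. block_op \<phi> y * cnj (\<psi> y) \<partial>M) = (\<Sum>U\<in>\<U>. \<Sum>V\<in>\<U>. complex_of_real (c U V) *
     (block_integral V \<phi> * cnj (block_integral U \<psi>) - complex_of_real (measure M V) * (\<integral>y. indicator U y * (\<phi> y * cnj (\<psi> y)) \<partial>M)))"
proof -
  have i\<psi>: "integrable M (\<lambda>y. indicator U y * cnj (\<psi> y))" and i\<phi>: "integrable M (\<lambda>y. indicator U y * (\<phi> y * cnj (\<psi> y)))"
    if "U \<in> \<U>" for U
    using integrable_mult_indicator[OF sets_blocks[OF that] integrable_cnj[OF sq_integrable_integrable[OF \<psi>]]]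
      integrable_mult_indicator[OF sets_blocks[OF that] sq_integrable_mult[OF \<phi> \<psi>]]
    by (auto simp: scaleR_conv_of_real of_real_indicator)
  have cb: "cnj (block_integral U \<psi>) = (\<integral>y. indicator U y * cnj (\<psi> y) \<partial>M)" for U
    unfolding block_integral_def Bochner_Integration.integral_cnj[symmetric]
    by (intro Bochner_Integration.integral_cong) (auto split: split_indicator)
  have "(\<integral>y. block_op \<phi> y * cnj (\<psi> y) \<partial>M) = (\<integral>y. (\<Sum>U\<in>\<U>. \<Sum>V\<in>\<U>.
     complex_of_real (c U V) * (block_integral V \<phi> * (indicator U y * cnj (\<psi> y)) - complex_of_real (measure M V) * (indicator U y * (\<phi> y * cnj (\<psi> y))))) \<partial>M)"
    unfolding block_op_def sum_distrib_right by (intro Bochner_Integration.integral_cong sum.cong refl) (simp add: algebra_simps)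
  also have "\<dots> = (\<Sum>U\<in>\<U>. \<Sum>V\<in>\<U>. complex_of_real (c U V) *
     (block_integral V \<phi> * cnj (block_integral U \<psi>) - complex_of_real (measure M V) * (\<integral>y. indicator U y * (\<phi> y * cnj (\<psi> y)) \<partial>M)))"
    using i\<psi> i\<phi> by (simp add: cb)
  finally show ?thesis .
qed

lemma block_op_symmetric:
  assumes \<phi>: "sq_integrable M \<phi>" and \<psi>: "sq_integrable M \<psi>"
  shows "(\<integral>y. block_op \<phi> y * cnj (\<psi> y) \<partial>M) = (\<integral>y. \<phi> y * cnj (block_op \<psi> y) \<partial>M)"
proof -
  have "(\<integral>y. \<phi> y * cnj (block_op \<psi> y) \<partial>M) = cnj (\<integral>y. block_op \<psi> y * cnj (\<phi> y) \<partial>M)"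
    by (subst Bochner_Integration.integral_cnj[symmetric], intro Bochner_Integration.integral_cong refl) simp
  also have "\<dots> = (\<Sum>U\<in>\<U>. \<Sum>V\<in>\<U>. complex_of_real (c U V) *
     (block_integral U \<phi> * cnj (block_integral V \<psi>) - complex_of_real (measure M V) * (\<integral>y. indicator U y * (\<phi> y * cnj (\<psi> y)) \<partial>M)))"
  proof -
    have "cnj (\<integral>y. indicator U y * (\<psi> y * cnj (\<phi> y)) \<partial>M) = (\<integral>y. indicator U y * (\<phi> y * cnj (\<psi> y)) \<partial>M)" for U
      unfolding Bochner_Integration.integral_cnj[symmetric] by (intro Bochner_Integration.integral_cong) (auto split: split_indicator)
    then show ?thesis unfolding integral_block_op[OF \<psi> \<phi>] by (simp add: mult.commute)
  qed
  also have "\<dots> = (\<Sum>U\<in>\<U>. \<Sum>V\<in>\<U>. complex_of_real (c U V) * (block_integral U \<phi> * cnj (block_integral V \<psi>)))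
     - (\<Sum>U\<in>\<U>. \<Sum>V\<in>\<U>. complex_of_real (c U V) * (complex_of_real (measure M V) * (\<integral>y. indicator U y * (\<phi> y * cnj (\<psi> y)) \<partial>M)))"
    by (simp add: right_diff_distrib sum_subtractf)
  also have "(\<Sum>U\<in>\<U>. \<Sum>V\<in>\<U>. complex_of_real (c U V) * (block_integral U \<phi> * cnj (block_integral V \<psi>)))
     = (\<Sum>U\<in>\<U>. \<Sum>V\<in>\<U>. complex_of_real (c U V) * (block_integral V \<phi> * cnj (block_integral U \<psi>)))"
    by (subst sum.swap) (intro sum.cong refl, simp add: sym)
  also have "(\<Sum>U\<in>\<U>. \<Sum>V\<in>\<U>. complex_of_real (c U V) * (block_integral V \<phi> * cnj (block_integral U \<psi>)))
     - (\<Sum>U\<in>\<U>. \<Sum>V\<in>\<U>. complex_of_real (c U V) * (complex_of_real (measure M V) * (\<integral>y. indicator U y * (\<phi> y * cnj (\<psi> y)) \<partial>M)))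
     = (\<integral>y. block_op \<phi> y * cnj (\<psi> y) \<partial>M)"
    unfolding integral_block_op[OF \<phi> \<psi>] by (simp add: right_diff_distrib sum_subtractf)
  finally show ?thesis by simp
qed

end

section \<open>Periodic functions\<close>

context schottky_cells
begin

lemma cell_of:
  assumes "y \<in> F"
  obtains U where "U \<in> \<U>" "y \<in> U"
  using assms unfolding Union_\<U>[symmetric] by (rule UnionE)

lemma mem_cell_iff: "V \<in> \<U> \<Longrightarrow> U \<in> \<U> \<Longrightarrow> y \<in> U \<Longrightarrow> y \<in> V \<longleftrightarrow> V = U"
  using cell_eq by blast

lemma regular_domain_eq: "regular_domain \<Gamma> = (\<Union>\<gamma>\<in>\<Gamma>. act \<gamma> ` Some ` F)"
  using fundamental by (simp add: fundamental_domain_def)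

lemma regular_domainE:
  assumes "x \<in> regular_domain \<Gamma>"
  obtains \<gamma> U y where "\<gamma> \<in> \<Gamma>" "U \<in> \<U>" "y \<in> U" "x = act \<gamma> (Some y)"
  using assms Union_\<U> unfolding regular_domain_eq by blast

lemma regular_domainI: "\<gamma> \<in> \<Gamma> \<Longrightarrow> y \<in> F \<Longrightarrow> act \<gamma> (Some y) \<in> regular_domain \<Gamma>"
  unfolding regular_domain_eq by blast

lemma Some_regular: "y \<in> F \<Longrightarrow> Some y \<in> regular_domain \<Gamma>"
  using regular_domainI[OF one_\<Gamma>, of y] by (simp add: act_one)

lemma act_inject:
  assumes "\<gamma> \<in> \<Gamma>" "\<delta> \<in> \<Gamma>" "y \<in> F" "z \<in> F" "act \<gamma> (Some y) = act \<delta> (Some z)"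
  shows "\<gamma> = \<delta> \<and> y = z"
proof -
  have "act \<gamma> (Some y) \<in> act \<gamma> ` Some ` F" using assms(3) by blast
  moreover have "act \<gamma> (Some y) \<in> act \<delta> ` Some ` F" unfolding assms(5) using assms(4) by blast
  ultimately have g: "\<gamma> = \<delta>"
    using fundamental assms(1,2) unfolding fundamental_domain_def disjoint_family_on_def by blast
  have "Some y = Some z"
    using act_inv(1)[OF carrier[OF assms(1)]] assms(5) unfolding g by metis
  then show ?thesis using g by simp
qed

lemma act_mem_translate_iff:
  assumes "\<gamma> \<in> \<Gamma>" "\<delta> \<in> \<Gamma>" "U \<in> \<U>" "V \<in> \<U>" "y \<in> U"
  shows "act \<gamma> (Some y) \<in> act \<delta> ` Some ` V \<longleftrightarrow> \<delta> = \<gamma> \<and> V = U"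
proof
  assume "act \<gamma> (Some y) \<in> act \<delta> ` Some ` V"
  then obtain z where z: "z \<in> V" "act \<gamma> (Some y) = act \<delta> (Some z)" by blast
  have "y \<in> F" "z \<in> F" using assms(5) z(1) cell_subset[OF assms(3)] cell_subset[OF assms(4)] by auto
  then have "\<gamma> = \<delta>" "y = z" using act_inject[OF assms(1,2)] z(2) by auto
  then show "\<delta> = \<gamma> \<and> V = U" using cell_eq[OF assms(4,3) z(1)] assms(5) by simp
next
  assume "\<delta> = \<gamma> \<and> V = U"
  then show "act \<gamma> (Some y) \<in> act \<delta> ` Some ` V" using assms(5) by simp
qed

text \<open>
  A point of the regular domain lies in exactly one translate of one cell, so a single term survives.
\<close>

lemma sum_translates:
  fixes f\<^sub>U :: "'a set \<Rightarrow> 'a \<Rightarrow> complex"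
  assumes "\<gamma> \<in> \<Gamma>" "U \<in> \<U>" "y \<in> U"
  shows "(\<Sum>\<^sub>\<infinity>\<delta>\<in>\<Gamma>. \<Sum>V\<in>\<U>. f\<^sub>U V (the (act (inv\<^bsub>PGL2\<^esub> \<delta>) (act \<gamma> (Some y)))) * indicator (act \<delta> ` Some ` V) (act \<gamma> (Some y)))
     = f\<^sub>U U y"
proof -
  let ?t = "\<lambda>\<delta> V. f\<^sub>U V (the (act (inv\<^bsub>PGL2\<^esub> \<delta>) (act \<gamma> (Some y)))) * indicator (act \<delta> ` Some ` V) (act \<gamma> (Some y))"
  have 0: "?t \<delta> V = 0" if "\<delta> \<in> \<Gamma>" "V \<in> \<U>" "\<delta> \<noteq> \<gamma> \<or> V \<noteq> U" for \<delta> V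
    using that act_mem_translate_iff[OF assms(1) that(1) assms(2) that(2) assms(3)] by auto
  have "(\<Sum>\<^sub>\<infinity>\<delta>\<in>\<Gamma>. \<Sum>V\<in>\<U>. ?t \<delta> V) = (\<Sum>\<^sub>\<infinity>\<delta>\<in>{\<gamma>}. \<Sum>V\<in>\<U>. ?t \<delta> V)"
  proof (rule infsum_cong_neutral)
    fix \<delta> assume "\<delta> \<in> \<Gamma> - {\<gamma>}"
    then show "(\<Sum>V\<in>\<U>. ?t \<delta> V) = 0" by (intro sum.neutral ballI 0) auto
  qed (use assms(1) in auto)
  also have "\<dots> = (\<Sum>V\<in>\<U>. ?t \<gamma> V)"
    by (simp only: infsum_finite finite.intros sum.insert sum.empty empty_iff not_False_eq_True add_0_right)
  also have "\<dots> = (\<Sum>V\<in>{U}. ?t \<gamma> V)"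
    using 0[OF assms(1)] assms(2) by (intro sum.mono_neutral_right finite_\<U>) auto
  also have "\<dots> = f\<^sub>U U y"
    using act_mem_translate_iff[OF assms(1,1,2,2,3)] act_inv(1)[OF carrier[OF assms(1)], of "Some y"] by simp
  finally show ?thesis .
qed

lemma periodic_iff: "periodic \<Gamma> \<U> f \<longleftrightarrow> (\<forall>\<gamma>\<in>\<Gamma>. \<forall>y\<in>F. f (act \<gamma> (Some y)) = f (Some y))"
proof
  assume "periodic \<Gamma> \<U> f"
  then obtain f\<^sub>U :: "'a set \<Rightarrow> 'a \<Rightarrow> complex" where fU: "\<And>x. x \<in> regular_domain \<Gamma> \<Longrightarrow> f x = (\<Sum>\<^sub>\<infinity>\<delta>\<in>\<Gamma>. \<Sum>V\<in>\<U>.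
      f\<^sub>U V (the (act (inv\<^bsub>PGL2\<^esub> \<delta>) x)) * indicator (act \<delta> ` Some ` V) x)"
    unfolding periodic_def by blast
  show "\<forall>\<gamma>\<in>\<Gamma>. \<forall>y\<in>F. f (act \<gamma> (Some y)) = f (Some y)"
  proof (intro ballI)
    fix \<gamma> y assume \<gamma>: "\<gamma> \<in> \<Gamma>" and y: "y \<in> F"
    then obtain U where U: "U \<in> \<U>" "y \<in> U" using Union_\<U> by blast
    have "f (act \<delta> (Some y)) = f\<^sub>U U y" if "\<delta> \<in> \<Gamma>" for \<delta>
      using fU[OF regular_domainI[OF that y]] sum_translates[OF that U] by simp
    from this[OF \<gamma>] this[OF one_\<Gamma>] show "f (act \<gamma> (Some y)) = f (Some y)" by (simp add: act_one)
  qed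
next
  assume *: "\<forall>\<gamma>\<in>\<Gamma>. \<forall>y\<in>F. f (act \<gamma> (Some y)) = f (Some y)"
  show "periodic \<Gamma> \<U> f"
    unfolding periodic_def
  proof (intro exI[of _ "\<lambda>_ y. f (Some y)"] ballI)
    fix x assume "x \<in> regular_domain \<Gamma>"
    then obtain \<gamma> U y where x: "\<gamma> \<in> \<Gamma>" "U \<in> \<U>" "y \<in> U" "x = act \<gamma> (Some y)" by (rule regular_domainE)
    then show "f x = (\<Sum>\<^sub>\<infinity>\<gamma>\<in>\<Gamma>. \<Sum>U\<in>\<U>. f (Some (the (act (inv\<^bsub>PGL2\<^esub> \<gamma>) x))) * indicator (act \<gamma> ` Some ` U) x)"
      using sum_translates[OF x(1-3), of "\<lambda>_ y. f (Some y)"] * cell_subset by auto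
  qed
qed

lemma borel_saturation:
  assumes "E \<in> sets borel"
  shows "(\<Union>\<gamma>\<in>\<Gamma>. translate \<gamma> E) \<in> sets borel"
  using assms borel_translate carrier countable_\<Gamma> by (intro sets.countable_UN') auto

lemma borel_regular_domain [measurable]: "finite_points (regular_domain \<Gamma>) \<in> sets borel"
proof -
  have "finite_points (regular_domain \<Gamma>) = (\<Union>\<gamma>\<in>\<Gamma>. translate \<gamma> F)"
    unfolding regular_domain_eq translate_def finite_points_def by blast
  then show ?thesis using borel_saturation[OF borel_F] by simp
qed

lemma measurable_on_domain_iff:
  "measurable_on_domain \<Gamma> f \<longleftrightarrow> (\<lambda>x. indicator (finite_points (regular_domain \<Gamma>)) x *\<^sub>R f (Some x)) \<in> borel_measurable borel"
  unfolding measurable_on_domain_def by (rule borel_measurable_restrict_space_iff) simp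

text \<open>
  The restriction to \<open>F\<close>, extended by 0 so as to be Borel measurable on all of \<open>K\<close>.
\<close>

definition local_part :: "('a option \<Rightarrow> complex) \<Rightarrow> 'a \<Rightarrow> complex" where
  "local_part f y = (if y \<in> F then f (Some y) else 0)"

lemma measurable_local_part:
  assumes "measurable_on_domain \<Gamma> f"
  shows "local_part f \<in> borel_measurable borel"
proof -
  have "local_part f = (\<lambda>y. indicator F y *\<^sub>R (indicator (finite_points (regular_domain \<Gamma>)) y *\<^sub>R f (Some y)))"
    using Some_regular by (auto simp: local_part_def finite_points_def fun_eq_iff split: split_indicator)
  also have "\<dots> \<in> borel_measurable borel"
    by (rule borel_measurable_scaleR[OF borel_measurable_indicator[OF borel_F] assms[unfolded measurable_on_domain_iff]])
  finally show ?thesis .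
qed

text \<open>
  On the \<open>\<Gamma>\<close>-orbit of a cell, which is a Borel set as \<open>\<Gamma>\<close> is countable, \<open>f\<close> agrees with the
  corresponding \<open>\<phi> U\<close>.
\<close>

lemma measurable_periodic:
  assumes f: "\<And>\<gamma> y. \<gamma> \<in> \<Gamma> \<Longrightarrow> y \<in> F \<Longrightarrow> f (act \<gamma> (Some y)) = (\<Sum>U\<in>\<U>. indicator U y * \<phi> U (act \<gamma> (Some y)))"
    and \<phi>: "\<And>U. U \<in> \<U> \<Longrightarrow> measurable_on_domain \<Gamma> (\<phi> U)"
  shows "measurable_on_domain \<Gamma> f"
  unfolding measurable_on_domain_iff
proof -
  let ?D = "finite_points (regular_domain \<Gamma>)"
  have "indicator ?D x *\<^sub>R f (Some x) = (\<Sum>U\<in>\<U>. indicator (\<Union>\<gamma>\<in>\<Gamma>. translate \<gamma> U) x *\<^sub>R (indicator ?D x *\<^sub>R \<phi> U (Some x)))" for x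
  proof (cases "x \<in> ?D")
    case True
    then obtain \<gamma> U y where y: "\<gamma> \<in> \<Gamma>" "U \<in> \<U>" "y \<in> U" "Some x = act \<gamma> (Some y)"
      unfolding finite_points_def by (blast elim: regular_domainE)
    have yF: "y \<in> F" using y cell_subset by blast
    have tr: "x \<in> translate \<delta> V \<longleftrightarrow> act \<gamma> (Some y) \<in> act \<delta> ` Some ` V" for \<delta> V
      by (simp add: translate_def finite_points_def flip: y(4))
    have "x \<in> (\<Union>\<gamma>\<in>\<Gamma>. translate \<gamma> V) \<longleftrightarrow> y \<in> V" if V: "V \<in> \<U>" for V
    proof -
      have "x \<in> (\<Union>\<gamma>\<in>\<Gamma>. translate \<gamma> V) \<longleftrightarrow> V = U"
        using act_mem_translate_iff[OF y(1) _ y(2) V y(3)] y(1) by (simp add: tr)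
      also have "\<dots> \<longleftrightarrow> y \<in> V" using cell_eq[OF V y(2) _ y(3)] y(3) by auto
      finally show ?thesis .
    qed
    then have "(\<Sum>U\<in>\<U>. indicator (\<Union>\<gamma>\<in>\<Gamma>. translate \<gamma> U) x *\<^sub>R (indicator ?D x *\<^sub>R \<phi> U (Some x))) = (\<Sum>U\<in>\<U>. indicator U y * \<phi> U (Some x))"
      using True by (intro sum.cong refl) (auto split: split_indicator)
    then show ?thesis using f[OF y(1) yF] True y(4) by simp
  qed simp
  moreover have "(\<lambda>x. \<Sum>U\<in>\<U>. indicator (\<Union>\<gamma>\<in>\<Gamma>. translate \<gamma> U) x *\<^sub>R (indicator ?D x *\<^sub>R \<phi> U (Some x))) \<in> borel_measurable borel"
    by (intro borel_measurable_sum)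
      (rule borel_measurable_scaleR[OF borel_measurable_indicator[OF borel_saturation[OF borel_cell]]
        \<phi>[unfolded measurable_on_domain_iff]])
  ultimately show "(\<lambda>x. indicator ?D x *\<^sub>R f (Some x)) \<in> borel_measurable borel" by simp
qed

lemma weighted_integral_cong:
  assumes "\<And>y. y \<in> F \<Longrightarrow> f (Some y) = g (Some y)"
  shows "weighted_integral \<mu> \<Gamma> \<U> s f = weighted_integral \<mu> \<Gamma> \<U> s g"
  unfolding weighted_integral_def translate_def[symmetric]
proof (intro sum.cong refl infsum_cong arg_cong2[where f = "(*)"])
  fix U \<gamma> assume U: "U \<in> \<U>" and \<gamma>: "\<gamma> \<in> \<Gamma>"
  show "(LINT x:translate \<gamma> U|\<mu>. f (act (inv\<^bsub>PGL2\<^esub> \<gamma>) (Some x))) = (LINT x:translate \<gamma> U|\<mu>. g (act (inv\<^bsub>PGL2\<^esub> \<gamma>) (Some x)))"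
  proof -
    have "f (act (inv\<^bsub>PGL2\<^esub> \<gamma>) (Some x)) = g (act (inv\<^bsub>PGL2\<^esub> \<gamma>) (Some x))" if "x \<in> translate \<gamma> U" for x
      using act_inv_translate[OF \<gamma> that] assms cell_subset[OF U] by auto
    then show ?thesis
      unfolding set_lebesgue_integral_def
      by (intro Bochner_Integration.integral_cong refl) (auto split: split_indicator)
  qed
qed

lemma weighted_integral_cmult:
  "weighted_integral \<mu> \<Gamma> \<U> s (\<lambda>x. c * f x) = c * weighted_integral \<mu> \<Gamma> \<U> s f"
proof -
  have "complex_of_real w * (LINT x:X|\<mu>. c * h x) = c * (complex_of_real w * (LINT x:X|\<mu>. h x))"
    for w X and h :: "'a \<Rightarrow> complex"
  proof -
    have "(LINT x:X|\<mu>. c * h x) = (\<integral>x. c * (indicator X x *\<^sub>R h x) \<partial>\<mu>)"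
      unfolding set_lebesgue_integral_def by (intro Bochner_Integration.integral_cong refl) simp
    also have "\<dots> = c * (LINT x:X|\<mu>. h x)" unfolding set_lebesgue_integral_def by (rule integral_mult_right_zero)
    finally show ?thesis by simp
  qed
  then show ?thesis
    unfolding weighted_integral_def sum_distrib_left by (simp only: infsum_cmult_right')
qed

text \<open>
  Without integrability the two sides follow different conventions: the sum on the left may converge
  although the integral on the right is 0 by default.
\<close>

lemma weighted_integral_eq:
  assumes h: "integrable \<nu> h" and fh: "\<And>y. y \<in> F \<Longrightarrow> f (Some y) = h y"
  shows "weighted_integral \<mu> \<Gamma> \<U> s f = (\<integral>y. h y \<partial>\<nu>)"
proof -
  have i: "integrable \<nu> (\<lambda>y. indicator U y *\<^sub>R h y)" if "U \<in> \<U>" for U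
    using integrable_mult_indicator[OF _ h, of U] borel_cell[OF that] by simp
  have hm: "h \<in> borel_measurable \<nu>" using h by auto
  have "weighted_integral \<mu> \<Gamma> \<U> s f = (\<Sum>U\<in>\<U>. \<integral>y. indicator U y *\<^sub>R h y \<partial>\<nu>)"
    unfolding weighted_integral_def translate_def[symmetric]
  proof (rule sum.cong[OF refl])
    fix U assume U: "U \<in> \<U>"
    have "(\<Sum>\<^sub>\<infinity>\<gamma>\<in>\<Gamma>. complex_of_real (weight s \<gamma> U) * (LINT x:translate \<gamma> U|\<mu>. f (act (inv\<^bsub>PGL2\<^esub> \<gamma>) (Some x))))
      = (\<Sum>\<^sub>\<infinity>\<gamma>\<in>\<Gamma>. complex_of_real (weight s \<gamma> U) *
          (LINT x:translate \<gamma> U|\<mu>. indicator U (mob (inv\<^bsub>PGL2\<^esub> \<gamma>) x) *\<^sub>R h (mob (inv\<^bsub>PGL2\<^esub> \<gamma>) x)))"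
    proof (intro infsum_cong arg_cong2[where f = "(*)"] refl)
      fix \<gamma> assume \<gamma>: "\<gamma> \<in> \<Gamma>"
      show "(LINT x:translate \<gamma> U|\<mu>. f (act (inv\<^bsub>PGL2\<^esub> \<gamma>) (Some x))) =
        (LINT x:translate \<gamma> U|\<mu>. indicator U (mob (inv\<^bsub>PGL2\<^esub> \<gamma>) x) *\<^sub>R h (mob (inv\<^bsub>PGL2\<^esub> \<gamma>) x))"
      proof -
        have "f (act (inv\<^bsub>PGL2\<^esub> \<gamma>) (Some x)) = indicator U (mob (inv\<^bsub>PGL2\<^esub> \<gamma>) x) *\<^sub>R h (mob (inv\<^bsub>PGL2\<^esub> \<gamma>) x)"
          if "x \<in> translate \<gamma> U" for x
          using act_inv_translate[OF \<gamma> that] fh cell_subset[OF U] by auto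
        then show ?thesis
          unfolding set_lebesgue_integral_def
          by (intro Bochner_Integration.integral_cong refl) (auto split: split_indicator)
      qed
    qed
    also have "\<dots> = (\<integral>y. indicator U y *\<^sub>R h y \<partial>\<nu>)"
      by (rule infsum_cell_measure[OF i[OF U] U]) simp
    finally show "(\<Sum>\<^sub>\<infinity>\<gamma>\<in>\<Gamma>. complex_of_real (weight s \<gamma> U) * (LINT x:translate \<gamma> U|\<mu>. f (act (inv\<^bsub>PGL2\<^esub> \<gamma>) (Some x)))) = \<dots>" .
  qed
  also have "\<dots> = (\<integral>y. (\<Sum>U\<in>\<U>. indicator U y *\<^sub>R h y) \<partial>\<nu>)"
    using i by simp
  also have "\<dots> = (\<integral>y. h y \<partial>\<nu>)"
  proof (rule integral_cong_AE)
    show "AE y in \<nu>. (\<Sum>U\<in>\<U>. indicator U y *\<^sub>R h y) = h y"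
      using AE_in_F
    proof eventually_elim
      case (elim y)
      then obtain U where U: "U \<in> \<U>" "y \<in> U" by (rule cell_of)
      have "(\<Sum>V\<in>\<U>. indicator V y *\<^sub>R h y) = (\<Sum>V\<in>\<U>. if V = U then h y else 0)"
        by (intro sum.cong refl) (simp add: mem_cell_iff[OF _ U] indicator_def)
      then show ?case using U finite_\<U> by simp
    qed
    show "(\<lambda>y. \<Sum>U\<in>\<U>. indicator U y *\<^sub>R h y) \<in> borel_measurable \<nu>"
      using i by (intro borel_measurable_sum) auto
  qed (rule hm)
  finally show ?thesis .
qed

lemma weighted_nn_integral_eq:
  assumes h: "h \<in> borel_measurable borel" and fh: "\<And>y. y \<in> F \<Longrightarrow> f (Some y) = h y"
  shows "weighted_nn_integral \<mu> \<Gamma> \<U> s f = (\<integral>\<^sup>+y. h y \<partial>\<nu>)"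
proof -
  have m: "(\<lambda>y. h y * indicator U y) \<in> borel_measurable borel" if "U \<in> \<U>" for U
    using borel_cell[OF that] h by measurable
  have "weighted_nn_integral \<mu> \<Gamma> \<U> s f = (\<Sum>U\<in>\<U>. \<integral>\<^sup>+y. h y * indicator U y \<partial>\<nu>)"
    unfolding weighted_nn_integral_def translate_def[symmetric]
  proof (rule sum.cong[OF refl])
    fix U assume U: "U \<in> \<U>"
    have "(\<Sum>\<^sub>\<infinity>\<gamma>\<in>\<Gamma>. ennreal (weight s \<gamma> U) * (\<integral>\<^sup>+x\<in>translate \<gamma> U. f (act (inv\<^bsub>PGL2\<^esub> \<gamma>) (Some x)) \<partial>\<mu>))
      = (\<integral>\<^sup>+\<gamma>. ennreal (weight s \<gamma> U) * (\<integral>\<^sup>+x\<in>translate \<gamma> U. f (act (inv\<^bsub>PGL2\<^esub> \<gamma>) (Some x)) \<partial>\<mu>) \<partial>count_space \<Gamma>)"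
      by (rule nn_integral_count_space_eq_infsum[OF countable_\<Gamma>, symmetric])
    also have "\<dots> = (\<integral>\<^sup>+\<gamma>. ennreal (weight s \<gamma> U) *
        (\<integral>\<^sup>+x\<in>translate \<gamma> U. (h (mob (inv\<^bsub>PGL2\<^esub> \<gamma>) x) * indicator U (mob (inv\<^bsub>PGL2\<^esub> \<gamma>) x)) \<partial>\<mu>) \<partial>count_space \<Gamma>)"
    proof -
      have "f (act (inv\<^bsub>PGL2\<^esub> \<gamma>) (Some x)) = h (mob (inv\<^bsub>PGL2\<^esub> \<gamma>) x) * indicator U (mob (inv\<^bsub>PGL2\<^esub> \<gamma>) x)"
        if "\<gamma> \<in> \<Gamma>" "x \<in> translate \<gamma> U" for \<gamma> x
        using act_inv_translate[OF that] fh cell_subset[OF U] by auto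
      then have "f (act (inv\<^bsub>PGL2\<^esub> \<gamma>) (Some x)) * indicator (translate \<gamma> U) x
          = h (mob (inv\<^bsub>PGL2\<^esub> \<gamma>) x) * indicator U (mob (inv\<^bsub>PGL2\<^esub> \<gamma>) x) * indicator (translate \<gamma> U) x"
        if "\<gamma> \<in> \<Gamma>" for \<gamma> x
        using that by (cases "x \<in> translate \<gamma> U") (simp_all add: indicator_def)
      then have "(\<integral>\<^sup>+x\<in>translate \<gamma> U. f (act (inv\<^bsub>PGL2\<^esub> \<gamma>) (Some x)) \<partial>\<mu>)
          = (\<integral>\<^sup>+x\<in>translate \<gamma> U. (h (mob (inv\<^bsub>PGL2\<^esub> \<gamma>) x) * indicator U (mob (inv\<^bsub>PGL2\<^esub> \<gamma>) x)) \<partial>\<mu>)"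
        if "\<gamma> \<in> \<Gamma>" for \<gamma>
        using that by (intro nn_integral_cong) blast
      then show ?thesis by (intro nn_integral_cong) (simp only: space_count_space)
    qed
    also have "\<dots> = (\<integral>\<^sup>+y. h y * indicator U y \<partial>\<nu>)"
      by (rule nn_integral_cell_measure[OF m[OF U] U, symmetric]) simp
    finally show "(\<Sum>\<^sub>\<infinity>\<gamma>\<in>\<Gamma>. ennreal (weight s \<gamma> U) * (\<integral>\<^sup>+x\<in>translate \<gamma> U. f (act (inv\<^bsub>PGL2\<^esub> \<gamma>) (Some x)) \<partial>\<mu>)) = \<dots>" .
  qed
  also have "\<dots> = (\<integral>\<^sup>+y. (\<Sum>U\<in>\<U>. h y * indicator U y) \<partial>\<nu>)"
    using m measurable_cong_sets[OF sets_cell_measure refl] by (intro nn_integral_sum[symmetric]) blast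
  also have "\<dots> = (\<integral>\<^sup>+y. h y \<partial>\<nu>)"
  proof (rule nn_integral_cong_AE)
    show "AE y in \<nu>. (\<Sum>U\<in>\<U>. h y * indicator U y) = h y"
      using AE_in_F
    proof eventually_elim
      case (elim y)
      then obtain U where U: "U \<in> \<U>" "y \<in> U" by (rule cell_of)
      have "(\<Sum>V\<in>\<U>. h y * indicator V y) = (\<Sum>V\<in>\<U>. if V = U then h y else 0)"
        by (intro sum.cong refl) (simp add: mem_cell_iff[OF _ U] indicator_def)
      then show ?case using U finite_\<U> by simp
    qed
  qed
  finally show ?thesis .
qed

text \<open>
  The exceptional set lies in the union of the countably many translates of \<open>E\<close>, all of which are null.
\<close>

lemma AE_regular_domainI:
  assumes E: "E \<in> sets borel" "E \<subseteq> F" "emeasure \<mu> E = 0"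
    and P: "\<And>\<gamma> y. \<gamma> \<in> \<Gamma> \<Longrightarrow> y \<in> F \<Longrightarrow> y \<notin> E \<Longrightarrow> P (act \<gamma> (Some y))"
  shows "AE x in \<mu>. Some x \<in> regular_domain \<Gamma> \<longrightarrow> P (Some x)"
proof (rule AE_I')
  have "translate \<gamma> E \<in> null_sets \<mu>" if "\<gamma> \<in> \<Gamma>" for \<gamma>
    using translate_null[OF haar carrier[OF that] E(1,3)] borel_translate[OF carrier[OF that] E(1)] sets_\<mu> by auto
  then show "(\<Union>\<gamma>\<in>\<Gamma>. translate \<gamma> E) \<in> null_sets \<mu>" by (intro null_sets_UN' countable_\<Gamma>)
  show "{x \<in> space \<mu>. \<not> (Some x \<in> regular_domain \<Gamma> \<longrightarrow> P (Some x))} \<subseteq> (\<Union>\<gamma>\<in>\<Gamma>. translate \<gamma> E)"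
  proof
    fix x assume "x \<in> {x \<in> space \<mu>. \<not> (Some x \<in> regular_domain \<Gamma> \<longrightarrow> P (Some x))}"
    then have x: "Some x \<in> regular_domain \<Gamma>" "\<not> P (Some x)" by auto
    from x(1) obtain \<gamma> U y where y: "\<gamma> \<in> \<Gamma>" "U \<in> \<U>" "y \<in> U" "Some x = act \<gamma> (Some y)" by (rule regular_domainE)
    then have "y \<in> F" using cell_subset by blast
    then have "y \<in> E" using P[OF y(1), of y] x(2) y(4) by auto
    then have "x \<in> translate \<gamma> E" using y(4) unfolding translate_def finite_points_def by auto
    then show "x \<in> (\<Union>\<gamma>\<in>\<Gamma>. translate \<gamma> E)" using y(1) by blast
  qed
qed

lemma ae_eq_iff:
  assumes "periodic \<Gamma> \<U> f" "periodic \<Gamma> \<U> g" "measurable_on_domain \<Gamma> f" "measurable_on_domain \<Gamma> g"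
  shows "ae_eq \<mu> \<Gamma> f g \<longleftrightarrow> (AE y in \<nu>. local_part f y = local_part g y)"
proof -
  define E where "E = {y. local_part f y \<noteq> local_part g y}"
  note [measurable] = measurable_local_part[OF assms(3)] measurable_local_part[OF assms(4)]
  have E: "E \<in> sets borel" unfolding E_def by measurable
  have EF: "E \<subseteq> F" by (auto simp: E_def local_part_def split: if_splits)
  have AE_N: "(AE y in \<nu>. local_part f y = local_part g y) \<longleftrightarrow> emeasure \<mu> E = 0"
    using E null_iff[OF E EF] by (subst AE_iff_measurable[of E]) (auto simp: E_def)
  show ?thesis
    unfolding AE_N
  proof
    assume "ae_eq \<mu> \<Gamma> f g"
    then have "AE x in \<mu>. x \<notin> E"
      unfolding ae_eq_def by eventually_elim (use Some_regular in \<open>auto simp: E_def local_part_def split: if_splits\<close>)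
    then show "emeasure \<mu> E = 0" using E sets_\<mu> haar_measureD(2)[OF haar] by (subst (asm) AE_iff_measurable[of E]) auto
  next
    assume "emeasure \<mu> E = 0"
    then show "ae_eq \<mu> \<Gamma> f g"
      unfolding ae_eq_def
    proof (rule AE_regular_domainI[OF E EF])
      fix \<gamma> y assume y: "\<gamma> \<in> \<Gamma>" "y \<in> F" "y \<notin> E"
      then show "f (act \<gamma> (Some y)) = g (act \<gamma> (Some y))"
        using assms(1,2) unfolding periodic_iff by (auto simp: E_def local_part_def)
    qed
  qed
qed

end

section \<open>The Hilbert space\<close>

context schottky_cells
begin

abbreviation "L2 \<equiv> L2_space \<mu> \<Gamma> \<U> s"
abbreviation "L2norm \<equiv> L2_norm \<mu> \<Gamma> \<U> s"
abbreviation "scal \<equiv> ip \<mu> \<Gamma> \<U> s"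

lemma measurable_cell_measure: "\<phi> \<in> borel_measurable \<nu> \<longleftrightarrow> \<phi> \<in> borel_measurable borel"
  using measurable_cong_sets[OF sets_cell_measure refl] by blast

lemma L2_iff: "f \<in> L2 \<longleftrightarrow>
  periodic \<Gamma> \<U> f \<and> measurable_on_domain \<Gamma> f \<and> sq_integrable \<nu> (local_part f)"
proof -
  have "weighted_nn_integral \<mu> \<Gamma> \<U> s (\<lambda>x. ennreal ((norm (f x))\<^sup>2)) < \<infinity> \<longleftrightarrow> sq_integrable \<nu> (local_part f)"
    if "measurable_on_domain \<Gamma> f"
  proof -
    have m [measurable]: "local_part f \<in> borel_measurable borel" by (rule measurable_local_part[OF that])
    have "weighted_nn_integral \<mu> \<Gamma> \<U> s (\<lambda>x. ennreal ((norm (f x))\<^sup>2)) = (\<integral>\<^sup>+y. ennreal ((norm (local_part f y))\<^sup>2) \<partial>\<nu>)"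
      by (rule weighted_nn_integral_eq) (measurable, simp add: local_part_def)
    moreover have "(\<lambda>y. (norm (local_part f y))\<^sup>2) \<in> borel_measurable \<nu>"
      unfolding measurable_cell_measure by measurable
    ultimately show ?thesis
      using m by (simp add: sq_integrable_def integrable_iff_bounded measurable_cell_measure)
  qed
  then show ?thesis unfolding L2_space_def by blast
qed

lemma scal_eq:
  assumes "f \<in> L2" "g \<in> L2"
  shows "scal f g = (\<integral>y. local_part f y * cnj (local_part g y) \<partial>\<nu>)"
  unfolding ip_def
proof (rule weighted_integral_eq)
  show "integrable \<nu> (\<lambda>y. local_part f y * cnj (local_part g y))"
    using assms by (intro sq_integrable_mult) (simp_all add: L2_iff)
qed (simp add: local_part_def)

lemma scal_self:
  assumes "f \<in> L2"
  shows "scal f f = complex_of_real (\<integral>y. (norm (local_part f y))\<^sup>2 \<partial>\<nu>)"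
  unfolding scal_eq[OF assms assms] by (simp only: complex_norm_square[symmetric] integral_complex_of_real)

lemma L2_norm_eq:
  assumes "f \<in> L2"
  shows "L2norm f = sqrt (\<integral>y. (norm (local_part f y))\<^sup>2 \<partial>\<nu>)"
  by (simp only: L2_norm_def scal_self[OF assms] Re_complex_of_real)

lemma measurable_on_domain_lincomb:
  assumes "measurable_on_domain \<Gamma> f" "measurable_on_domain \<Gamma> g"
  shows "measurable_on_domain \<Gamma> (\<lambda>x. a * f x + b * g x)"
  using assms unfolding measurable_on_domain_def by (intro borel_measurable_add borel_measurable_times) auto

lemma measurable_on_domain_const: "measurable_on_domain \<Gamma> (\<lambda>x. a)"
  unfolding measurable_on_domain_def by simp

lemma local_part_lincomb: "local_part (\<lambda>x. a * f x + b * g x) = (\<lambda>y. a * local_part f y + b * local_part g y)"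
  by (auto simp: local_part_def)

lemma L2_lincomb:
  assumes "f \<in> L2" "g \<in> L2"
  shows "(\<lambda>x. a * f x + b * g x) \<in> L2"
proof -
  have "sq_integrable \<nu> (\<lambda>y. a * local_part f y + b * local_part g y)"
    using assms by (intro sq_integrable_lincomb) (simp_all add: L2_iff)
  moreover have "measurable_on_domain \<Gamma> (\<lambda>x. a * f x + b * g x)"
    using assms by (intro measurable_on_domain_lincomb) (simp_all add: L2_iff)
  ultimately show ?thesis using assms unfolding L2_iff periodic_iff local_part_lincomb by simp
qed

lemma ae_eq_L2_iff:
  assumes "f \<in> L2" "g \<in> L2"
  shows "ae_eq \<mu> \<Gamma> f g \<longleftrightarrow> (AE y in \<nu>. local_part f y = local_part g y)"
  using assms by (intro ae_eq_iff) (auto simp: L2_iff)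

text \<open>
  Each set on which \<open>\<bar>f\<bar>\<^sup>2\<close> is at least \<open>1/(n+1)\<close> has finite \<open>\<nu>\<close>-measure, hence measure 0 by the
  dichotomy.
\<close>

lemma L2_trivial:
  assumes inf: "\<not> finite_measure \<nu>" and f: "f \<in> L2"
  shows "AE y in \<nu>. local_part f y = 0"
proof -
  have sq: "sq_integrable \<nu> (local_part f)" using f by (simp add: L2_iff)
  then have [measurable]: "local_part f \<in> borel_measurable borel"
    using sq_integrableD(1) measurable_cell_measure by blast
  define E where "E n = {y. inverse (real (Suc n)) \<le> (norm (local_part f y))\<^sup>2}" for n
  have E: "E n \<in> sets borel" for n unfolding E_def by measurable
  have EF: "E n \<subseteq> F" for n
    by (auto simp: E_def local_part_def split: if_splits)
  have "emeasure \<nu> (E n) < \<infinity>" for n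
  proof -
    have "ennreal (inverse (real (Suc n))) * emeasure \<nu> (E n)
        = (\<integral>\<^sup>+y. ennreal (inverse (real (Suc n))) * indicator (E n) y \<partial>\<nu>)"
      using E by (subst nn_integral_cmult_indicator) auto
    also have "\<dots> \<le> (\<integral>\<^sup>+y. ennreal ((norm (local_part f y))\<^sup>2) \<partial>\<nu>)"
      by (intro nn_integral_mono) (auto simp: E_def split: split_indicator intro!: ennreal_leI)
    also have "\<dots> < \<infinity>"
      using sq_integrableD(2)[OF sq] by (simp add: integrable_iff_bounded)
    finally show ?thesis by (auto simp: ennreal_mult_less_top)
  qed
  then have "emeasure \<mu> (E n) = 0" for n
    using cell_measure_dichotomy[OF inf E EF, of n] by (metis less_irrefl)
  then have "emeasure \<nu> (E n) = 0" for n using null_iff[OF E EF] by blast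
  then have "E n \<in> null_sets \<nu>" for n using E by (auto intro: null_setsI)
  then have "(\<Union>n. E n) \<in> null_sets \<nu>" by (rule null_sets_UN)
  moreover have "{y \<in> space \<nu>. \<not> local_part f y = 0} \<subseteq> (\<Union>n. E n)"
  proof
    fix y assume "y \<in> {y \<in> space \<nu>. \<not> local_part f y = 0}"
    then have "0 < (norm (local_part f y))\<^sup>2" by simp
    then obtain n where "inverse (real (Suc n)) < (norm (local_part f y))\<^sup>2" using reals_Archimedean by blast
    then show "y \<in> (\<Union>n. E n)" by (auto simp: E_def intro!: exI[of _ n])
  qed
  ultimately show ?thesis by (rule AE_I')
qed

text \<open>
  An everywhere defined symmetric operator is self-adjoint: if \<open>(g, h)\<close> is in the graph of the adjoint,
  then \<open>k = h - T g\<close> is orthogonal to itself.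
\<close>

lemma self_adjoint_onI:
  assumes closed: "\<And>f. f \<in> L2 \<Longrightarrow> T f \<in> L2"
    and symm: "\<And>f g. f \<in> L2 \<Longrightarrow> g \<in> L2 \<Longrightarrow> scal (T f) g = scal f (T g)"
  shows "self_adjoint_on L2 (ae_eq \<mu> \<Gamma>) scal T"
  unfolding self_adjoint_on_def
proof (intro ballI iffI)
  fix g h assume g: "g \<in> L2" and h: "h \<in> L2"
    and adj: "\<forall>f\<in>L2. scal (T f) g = scal f h"
  note Tg = closed[OF g]
  define k where "k = (\<lambda>x. 1 * h x + (- 1) * T g x)"
  have k: "k \<in> L2" unfolding k_def by (rule L2_lincomb[OF h Tg])
  have lk: "local_part k y = local_part h y - local_part (T g) y" for y
    unfolding k_def local_part_lincomb by simp
  have i: "integrable \<nu> (\<lambda>y. local_part k y * cnj (local_part h y))"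
    "integrable \<nu> (\<lambda>y. local_part k y * cnj (local_part (T g) y))"
    using k h Tg by (auto intro!: sq_integrable_mult simp: L2_iff)
  have "scal k k = (\<integral>y. local_part k y * cnj (local_part h y) - local_part k y * cnj (local_part (T g) y) \<partial>\<nu>)"
    unfolding scal_eq[OF k k] by (intro Bochner_Integration.integral_cong refl) (simp add: lk algebra_simps)
  also have "\<dots> = scal k h - scal k (T g)"
    unfolding scal_eq[OF k h] scal_eq[OF k Tg] by (rule Bochner_Integration.integral_diff[OF i])
  also have "\<dots> = 0" using adj k symm[OF k g] by simp
  finally have "(\<integral>y. (norm (local_part k y))\<^sup>2 \<partial>\<nu>) = 0" unfolding scal_self[OF k] by simp
  then have "AE y in \<nu>. local_part k y = 0"
    using sq_integral_zero_iff[of \<nu> "local_part k"] k by (simp add: L2_iff)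
  then show "ae_eq \<mu> \<Gamma> h (T g)" unfolding ae_eq_L2_iff[OF h Tg] by eventually_elim (simp add: lk)
next
  fix g h f assume g: "g \<in> L2" and h: "h \<in> L2" and f: "f \<in> L2"
    and eq: "ae_eq \<mu> \<Gamma> h (T g)"
  have "scal f (T g) = scal f h"
    unfolding scal_eq[OF f closed[OF g]] scal_eq[OF f h]
  proof (rule integral_cong_AE)
    show "AE y in \<nu>. local_part f y * cnj (local_part (T g) y) = local_part f y * cnj (local_part h y)"
      using eq unfolding ae_eq_L2_iff[OF h closed[OF g]] by eventually_elim simp
  qed (use f g h closed[OF g] in \<open>auto intro!: borel_measurable_integrable sq_integrable_mult simp: L2_iff\<close>)
  then show "scal (T f) g = scal f h" using symm[OF f g] by simp
qed

text \<open>
  Linearity and the bound imply that \<open>T\<close> respects equality almost everywhere, since the difference of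
  two equal functions has norm 0.
\<close>

lemma bounded_linear_operator_onI:
  assumes closed: "\<And>f. f \<in> L2 \<Longrightarrow> T f \<in> L2"
    and lin: "\<And>f g a b. f \<in> L2 \<Longrightarrow> g \<in> L2 \<Longrightarrow>
      AE y in \<nu>. local_part (T (\<lambda>x. a * f x + b * g x)) y = a * local_part (T f) y + b * local_part (T g) y"
    and bound: "\<And>f. f \<in> L2 \<Longrightarrow> (\<integral>y. (norm (local_part (T f) y))\<^sup>2 \<partial>\<nu>)
      \<le> C\<^sup>2 * (\<integral>y. (norm (local_part f y))\<^sup>2 \<partial>\<nu>)" and C: "0 \<le> C"
  shows "bounded_linear_operator_on L2 (ae_eq \<mu> \<Gamma>) (L2norm) T"
  unfolding bounded_linear_operator_on_def
proof (intro conjI ballI allI impI)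
  show "T f \<in> L2" if "f \<in> L2" for f by (rule closed[OF that])
  show "ae_eq \<mu> \<Gamma> (T (\<lambda>x. a * f x + b * g x)) (\<lambda>x. a * T f x + b * T g x)"
    if fg: "f \<in> L2" "g \<in> L2" for f g a b
    unfolding ae_eq_L2_iff[OF closed[OF L2_lincomb[OF fg]] L2_lincomb[OF closed[OF fg(1)] closed[OF fg(2)]]] local_part_lincomb
    by (rule lin[OF fg])
  show "ae_eq \<mu> \<Gamma> (T f) (T g)"
    if fg: "f \<in> L2" "g \<in> L2" and eq: "ae_eq \<mu> \<Gamma> f g" for f g
  proof -
    define k where "k = (\<lambda>x. 1 * f x + (- 1) * g x)"
    have k: "k \<in> L2" unfolding k_def by (rule L2_lincomb[OF fg])
    have "AE y in \<nu>. local_part k y = 0"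
      using eq unfolding ae_eq_L2_iff[OF fg] k_def local_part_lincomb by eventually_elim simp
    then have "(\<integral>y. (norm (local_part k y))\<^sup>2 \<partial>\<nu>) = 0"
      using sq_integral_zero_iff[of \<nu> "local_part k"] k by (simp add: L2_iff)
    then have "(\<integral>y. (norm (local_part (T k) y))\<^sup>2 \<partial>\<nu>) \<le> 0" using bound[OF k] by simp
    then have "(\<integral>y. (norm (local_part (T k) y))\<^sup>2 \<partial>\<nu>) = 0"
      by (intro antisym integral_nonneg_AE) auto
    then have "AE y in \<nu>. local_part (T k) y = 0"
      using sq_integral_zero_iff[of \<nu> "local_part (T k)"] closed[OF k] by (simp add: L2_iff)
    moreover have "AE y in \<nu>. local_part (T k) y = 1 * local_part (T f) y + (- 1) * local_part (T g) y"
      unfolding k_def by (rule lin[OF fg])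
    ultimately show ?thesis unfolding ae_eq_L2_iff[OF closed[OF fg(1)] closed[OF fg(2)]]
      by eventually_elim simp
  qed
  show "\<exists>C. \<forall>f\<in>L2. L2norm (T f) \<le> C * L2norm f"
  proof (intro exI[of _ C] ballI)
    fix f assume f: "f \<in> L2"
    have "L2norm (T f) \<le> sqrt (C\<^sup>2 * (\<integral>y. (norm (local_part f y))\<^sup>2 \<partial>\<nu>))"
      unfolding L2_norm_eq[OF closed[OF f]] using bound[OF f] by (rule real_sqrt_le_mono)
    then show "L2norm (T f) \<le> C * L2norm f"
      using C unfolding L2_norm_eq[OF f] by (simp add: real_sqrt_mult)
  qed
qed

end

section \<open>The kernel is constant on pairs of cells\<close>

locale schottky_operator = schottky_cells +
  fixes A :: "'a set \<Rightarrow> 'a set \<Rightarrow> real" and \<alpha> :: real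
  assumes vert: "verticial \<U>"
    and A_sym: "\<And>U V. U \<in> \<U> \<Longrightarrow> V \<in> \<U> \<Longrightarrow> A U V = A V U"
    and A_diag: "\<And>U. U \<in> \<U> \<Longrightarrow> A U U = 0"
begin

abbreviation "\<D> \<equiv> D_operator \<mu> \<Gamma> \<U> s A \<alpha>"

definition cell_point :: "'a set \<Rightarrow> 'a" where
  "cell_point U = (SOME x. x \<in> U)"

definition coeff :: "'a set \<Rightarrow> 'a set \<Rightarrow> real" where
  "coeff U V = A U V * dist (cell_point U) (cell_point V) powr \<alpha>"

lemma coeff_sym: "U \<in> \<U> \<Longrightarrow> V \<in> \<U> \<Longrightarrow> coeff U V = coeff V U"
  using A_sym by (simp add: coeff_def dist_commute)

text \<open>
  For \<open>U = V\<close> both sides vanish; otherwise the distance is constant on \<open>U \<times> V\<close>.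
\<close>

lemma coeff_eq:
  assumes "U \<in> \<U>" "V \<in> \<U>" "x \<in> U" "y \<in> V"
  shows "A U V * absK (x - y) powr \<alpha> = coeff U V"
proof (cases "U = V")
  case True
  then show ?thesis using A_diag assms by (simp add: coeff_def)
next
  case False
  then obtain d where d: "\<forall>x\<in>U. \<forall>y\<in>V. dist x y = d"
    using verticial_dist_const2[OF vert disjoint_\<U> assms(1,2)] by blast
  have "cell_point U \<in> U" "cell_point V \<in> V" unfolding cell_point_def using assms by (auto intro: someI)
  then have "dist (cell_point U) (cell_point V) = dist x y" using d assms by simp
  then show ?thesis by (simp add: coeff_def dist_absK)
qed

lemma kernel_eq_coeff:
  assumes "\<gamma> \<in> \<Gamma>" "U \<in> \<U>" "x \<in> U" "\<delta> \<in> \<Gamma>" "V \<in> \<U>" "y \<in> V"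
  shows "kernel \<Gamma> \<U> A \<alpha> (act \<gamma> (Some x)) (act \<delta> (Some y)) = coeff U V"
proof -
  define t where "t U' V' p = absK (the (act (inv\<^bsub>PGL2\<^esub> (fst p)) (act \<gamma> (Some x))) - the (act (inv\<^bsub>PGL2\<^esub> (snd p)) (act \<delta> (Some y)))) powr \<alpha>
     * indicator (act (fst p) ` Some ` U') (act \<gamma> (Some x)) * indicator (act (snd p) ` Some ` V') (act \<delta> (Some y))"
    for U' V' and p :: "('a^2^2) set \<times> ('a^2^2) set"
  have t0: "t U' V' p = 0" if "U' \<in> \<U>" "V' \<in> \<U>" "p \<in> \<Gamma> \<times> \<Gamma>" "\<not> (p = (\<gamma>, \<delta>) \<and> U' = U \<and> V' = V)" for U' V' p
  proof -
    have "act \<gamma> (Some x) \<notin> act (fst p) ` Some ` U' \<or> act \<delta> (Some y) \<notin> act (snd p) ` Some ` V'"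
      using act_mem_translate_iff[OF assms(1) _ assms(2) that(1) assms(3), of "fst p"]
        act_mem_translate_iff[OF assms(4) _ assms(5) that(2) assms(6), of "snd p"] that(3,4)
      by (cases p) auto
    then show ?thesis by (auto simp: t_def)
  qed
  have t1: "t U V (\<gamma>, \<delta>) = absK (x - y) powr \<alpha>"
    using act_mem_translate_iff[OF assms(1,1,2,2,3)] act_mem_translate_iff[OF assms(4,4,5,5,6)]
    by (simp add: t_def act_inv(1)[OF carrier[OF assms(1)]] act_inv(1)[OF carrier[OF assms(4)]])
  have inf: "(\<Sum>\<^sub>\<infinity>p\<in>\<Gamma> \<times> \<Gamma>. t U' V' p) = (if U' = U \<and> V' = V then absK (x - y) powr \<alpha> else 0)"
    if "U' \<in> \<U>" "V' \<in> \<U>" for U' V'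
  proof (cases "U' = U \<and> V' = V")
    case True
    have "(\<Sum>\<^sub>\<infinity>p\<in>\<Gamma> \<times> \<Gamma>. t U' V' p) = (\<Sum>\<^sub>\<infinity>p\<in>{(\<gamma>, \<delta>)}. t U' V' p)"
    proof (rule infsum_cong_neutral)
      fix p assume "p \<in> \<Gamma> \<times> \<Gamma> - {(\<gamma>, \<delta>)}"
      then show "t U' V' p = 0" by (intro t0 that) auto
    qed (use assms in auto)
    then show ?thesis using True t1 by simp
  next
    case False
    have "(\<Sum>\<^sub>\<infinity>p\<in>\<Gamma> \<times> \<Gamma>. t U' V' p) = 0"
      using t0[OF that] False by (intro infsum_0) blast
    then show ?thesis using False by auto
  qed
  have "kernel \<Gamma> \<U> A \<alpha> (act \<gamma> (Some x)) (act \<delta> (Some y)) = (\<Sum>U'\<in>\<U>. \<Sum>V'\<in>\<U>. A U' V' * (\<Sum>\<^sub>\<infinity>p\<in>\<Gamma> \<times> \<Gamma>. t U' V' p))"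
    unfolding kernel_def t_def by (simp add: case_prod_beta')
  also have "\<dots> = (\<Sum>U'\<in>\<U>. \<Sum>V'\<in>\<U>. if V' = V then (if U' = U then A U V * absK (x - y) powr \<alpha> else 0) else 0)"
    by (intro sum.cong refl) (auto simp: inf)
  also have "\<dots> = A U V * absK (x - y) powr \<alpha>" using assms(2,5) finite_\<U> by simp
  also have "\<dots> = coeff U V" by (rule coeff_eq[OF assms(2,5,3,6)])
  finally show ?thesis .
qed

section \<open>The operator on the space\<close>

definition kernel_row :: "'a set \<Rightarrow> 'a \<Rightarrow> complex" where
  "kernel_row U y = (\<Sum>V\<in>\<U>. complex_of_real (coeff U V) * indicator V y)"

lemma kernel_row_cell:
  assumes "V \<in> \<U>" "y \<in> V"
  shows "kernel_row U y = complex_of_real (coeff U V)"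
proof -
  have "kernel_row U y = (\<Sum>V'\<in>\<U>. if V' = V then complex_of_real (coeff U V) else 0)"
    unfolding kernel_row_def by (intro sum.cong refl) (simp add: mem_cell_iff[OF _ assms] indicator_def)
  then show ?thesis using assms finite_\<U> by simp
qed

lemma measurable_kernel_row [measurable]: "kernel_row U \<in> borel_measurable borel"
  unfolding kernel_row_def[abs_def] using borel_cell
  by (intro borel_measurable_sum borel_measurable_times borel_measurable_indicator borel_measurable_const)

lemma D_integrand_eq:
  assumes "\<gamma> \<in> \<Gamma>" "U \<in> \<U>" "x \<in> U" "y \<in> F"
  shows "D_integrand \<Gamma> \<U> A \<alpha> f (act \<gamma> (Some x)) (Some y) = kernel_row U y * (f (Some y) - f (act \<gamma> (Some x)))"
proof -
  obtain V where V: "V \<in> \<U>" "y \<in> V" using cell_of[OF assms(4)] .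
  have "kernel \<Gamma> \<U> A \<alpha> (act \<gamma> (Some x)) (Some y) = coeff U V"
    using kernel_eq_coeff[OF assms(1-3) one_\<Gamma> V] by (simp add: act_one)
  then show ?thesis unfolding D_integrand_def kernel_row_cell[OF V] by simp
qed

lemma measurable_D_integrand:
  assumes "\<gamma> \<in> \<Gamma>" "U \<in> \<U>" "x \<in> U" "measurable_on_domain \<Gamma> f"
  shows "measurable_on_domain \<Gamma> (D_integrand \<Gamma> \<U> A \<alpha> f (act \<gamma> (Some x)))"
proof (rule measurable_periodic)
  let ?c = "f (act \<gamma> (Some x))"
  fix \<delta> y assume \<delta>: "\<delta> \<in> \<Gamma>" and "y \<in> F"
  then obtain V where V: "V \<in> \<U>" "y \<in> V" using cell_of by blast
  have "(\<Sum>V'\<in>\<U>. indicator V' y * (complex_of_real (coeff U V') * f (act \<delta> (Some y)) + (- ?c) * complex_of_real (coeff U V')))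
     = (\<Sum>V'\<in>\<U>. if V' = V then complex_of_real (coeff U V) * (f (act \<delta> (Some y)) - ?c) else 0)"
    by (intro sum.cong refl) (simp add: mem_cell_iff[OF _ V] indicator_def algebra_simps)
  also have "\<dots> = D_integrand \<Gamma> \<U> A \<alpha> f (act \<gamma> (Some x)) (act \<delta> (Some y))"
    using V finite_\<U> kernel_eq_coeff[OF assms(1-3) \<delta> V] by (simp add: D_integrand_def)
  finally show "D_integrand \<Gamma> \<U> A \<alpha> f (act \<gamma> (Some x)) (act \<delta> (Some y)) =
    (\<Sum>V'\<in>\<U>. indicator V' y * (complex_of_real (coeff U V') * f (act \<delta> (Some y)) + (- ?c) * complex_of_real (coeff U V')))" ..
next
  fix V
  show "measurable_on_domain \<Gamma> (\<lambda>z. complex_of_real (coeff U V) * f z + (- f (act \<gamma> (Some x))) * complex_of_real (coeff U V))"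
    by (intro measurable_on_domain_lincomb assms(4) measurable_on_domain_const)
qed

lemma D_operator_eq:
  assumes "\<gamma> \<in> \<Gamma>" "U \<in> \<U>" "x \<in> U"
  shows "\<D> f (act \<gamma> (Some x)) =
    weighted_integral \<mu> \<Gamma> \<U> s (\<lambda>z. kernel_row U (the z) * (local_part f (the z) - f (act \<gamma> (Some x))))"
  unfolding D_operator_def using D_integrand_eq[OF assms]
  by (intro weighted_integral_cong) (simp add: local_part_def)

text \<open>
  The values of \<open>\<D> f\<close> on the orbit of a cell are an affine function of those of \<open>f\<close>, in the finite as
  well as in the infinite case.
\<close>

lemma D_operator_periodic:
  assumes f: "periodic \<Gamma> \<U> f" "measurable_on_domain \<Gamma> f"
    and I: "\<And>\<gamma> U x. \<gamma> \<in> \<Gamma> \<Longrightarrow> U \<in> \<U> \<Longrightarrow> x \<in> U \<Longrightarrow>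
      \<D> f (act \<gamma> (Some x)) = I U - f (act \<gamma> (Some x)) * J U"
  shows "periodic \<Gamma> \<U> (\<D> f)" "measurable_on_domain \<Gamma> (\<D> f)"
proof -
  show "periodic \<Gamma> \<U> (\<D> f)"
    unfolding periodic_iff
  proof (intro ballI)
    fix \<gamma> y assume \<gamma>: "\<gamma> \<in> \<Gamma>" and y: "y \<in> F"
    obtain U where U: "U \<in> \<U>" "y \<in> U" using cell_of[OF y] .
    show "\<D> f (act \<gamma> (Some y)) = \<D> f (Some y)"
      using I[OF \<gamma> U] I[OF one_\<Gamma> U] f(1) \<gamma> y by (simp add: act_one periodic_iff)
  qed
  show "measurable_on_domain \<Gamma> (\<D> f)"
  proof (rule measurable_periodic)
    fix \<gamma> y assume \<gamma>: "\<gamma> \<in> \<Gamma>" and y: "y \<in> F"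
    obtain V where V: "V \<in> \<U>" "y \<in> V" using cell_of[OF y] .
    have "(\<Sum>U\<in>\<U>. indicator U y * ((- J U) * f (act \<gamma> (Some y)) + 1 * I U)) = (\<Sum>U\<in>\<U>. if U = V then I V - f (act \<gamma> (Some y)) * J V else 0)"
      by (intro sum.cong refl) (simp add: mem_cell_iff[OF _ V] indicator_def)
    then show "\<D> f (act \<gamma> (Some y)) = (\<Sum>U\<in>\<U>. indicator U y * ((- J U) * f (act \<gamma> (Some y)) + 1 * I U))"
      using I[OF \<gamma> V] V finite_\<U> by simp
  next
    fix U
    show "measurable_on_domain \<Gamma> (\<lambda>z. (- J U) * f z + 1 * I U)"
      by (intro measurable_on_domain_lincomb f measurable_on_domain_const)
  qed
qed

section \<open>Finite total mass\<close>

text \<open>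
  Almost everywhere on \<open>F\<close> the operator is the block operator of the matrix \<open>coeff\<close>.
\<close>

lemma finite_case:
  assumes fin: "finite_measure \<nu>"
  shows "\<And>f x. f \<in> L2 \<Longrightarrow> x \<in> regular_domain \<Gamma> \<Longrightarrow>
      weighted_integrable \<mu> \<Gamma> \<U> s (D_integrand \<Gamma> \<U> A \<alpha> f x)"
    and "bounded_linear_operator_on L2 (ae_eq \<mu> \<Gamma>) (L2norm) (\<D>)"
    and "self_adjoint_on L2 (ae_eq \<mu> \<Gamma>) scal (\<D>)"
proof -
  interpret B: block_operator \<nu> \<U> coeff
    using fin finite_\<U> borel_cell coeff_sym by (simp add: block_operator_def block_operator_axioms_def)
  have sq: "sq_integrable \<nu> (local_part f)" if "f \<in> L2" for f using that by (simp add: L2_iff)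
  have ind: "integrable \<nu> (\<lambda>y. indicator V y * \<phi> y)" if "integrable \<nu> \<phi>" "V \<in> \<U>" for V and \<phi> :: "'a \<Rightarrow> complex"
    using integrable_mult_indicator[OF _ that(1), of V] borel_cell[OF that(2)] by (simp add: scaleR_conv_of_real of_real_indicator)
  have kernel_row_mult: "kernel_row U y * z = (\<Sum>V\<in>\<U>. complex_of_real (coeff U V) * (indicator V y * z))" for U y z
    by (simp add: kernel_row_def sum_distrib_right mult.assoc)
  have int: "integrable \<nu> (\<lambda>y. kernel_row U y * (local_part f y - c))" if "f \<in> L2" for U f c
    unfolding kernel_row_mult using B.sq_integrable_integrable[OF sq[OF that]]
    by (intro Bochner_Integration.integrable_sum integrable_mult_right ind Bochner_Integration.integrable_diff) auto
  show "weighted_integrable \<mu> \<Gamma> \<U> s (D_integrand \<Gamma> \<U> A \<alpha> f x)"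
    if f: "f \<in> L2" and "x \<in> regular_domain \<Gamma>" for f x
  proof -
    obtain \<gamma> U y where y: "\<gamma> \<in> \<Gamma>" "U \<in> \<U>" "y \<in> U" "x = act \<gamma> (Some y)" by (rule regular_domainE[OF \<open>x \<in> regular_domain \<Gamma>\<close>])
    let ?h = "\<lambda>y. kernel_row U y * (local_part f y - f x)"
    have m: "?h \<in> borel_measurable borel" using borel_measurable_integrable[OF int[OF f, of U "f x"]] unfolding measurable_cell_measure .
    have "weighted_nn_integral \<mu> \<Gamma> \<U> s (\<lambda>z. ennreal (norm (D_integrand \<Gamma> \<U> A \<alpha> f x z))) = (\<integral>\<^sup>+y. ennreal (norm (?h y)) \<partial>\<nu>)"
    proof (rule weighted_nn_integral_eq)
      show "(\<lambda>y. ennreal (norm (?h y))) \<in> borel_measurable borel"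
        by (rule measurable_compose[OF measurable_compose[OF m borel_measurable_norm] measurable_ennreal])
      show "ennreal (norm (D_integrand \<Gamma> \<U> A \<alpha> f x (Some y'))) = ennreal (norm (?h y'))" if "y' \<in> F" for y'
        using D_integrand_eq[OF y(1-3) that, of f] that unfolding y(4) by (simp add: local_part_def)
    qed
    also have "\<dots> < \<infinity>" using int[OF f, of U "f x"] by (simp add: integrable_iff_bounded)
    finally show ?thesis
      using measurable_D_integrand[OF y(1-3), of f] f unfolding weighted_integrable_def y(4) by (simp add: L2_iff)
  qed
  have D: "\<D> f (act \<gamma> (Some x)) = (\<Sum>V\<in>\<U>. complex_of_real (coeff U V) * B.block_integral V (local_part f))
      - f (act \<gamma> (Some x)) * (\<Sum>V\<in>\<U>. complex_of_real (coeff U V) * complex_of_real (measure \<nu> V))"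
    if f: "f \<in> L2" and x: "\<gamma> \<in> \<Gamma>" "U \<in> \<U>" "x \<in> U" for f \<gamma> U x
  proof -
    let ?c = "f (act \<gamma> (Some x))"
    have lf: "integrable \<nu> (local_part f)" by (rule B.sq_integrable_integrable[OF sq[OF f]])
    have "\<D> f (act \<gamma> (Some x)) = (\<integral>y. kernel_row U y * (local_part f y - ?c) \<partial>\<nu>)"
      unfolding D_operator_eq[OF x] by (rule weighted_integral_eq[OF int[OF f]]) simp
    also have "\<dots> = (\<Sum>V\<in>\<U>. complex_of_real (coeff U V) * (\<integral>y. indicator V y * (local_part f y - ?c) \<partial>\<nu>))"
      unfolding kernel_row_mult using ind[OF Bochner_Integration.integrable_diff[OF lf]] by simp
    also have "\<dots> = (\<Sum>V\<in>\<U>. complex_of_real (coeff U V) * (B.block_integral V (local_part f) - ?c * complex_of_real (measure \<nu> V)))"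
    proof (intro sum.cong refl arg_cong2[where f = "(*)"])
      fix V assume V: "V \<in> \<U>"
      have "(\<integral>y. indicator V y * (local_part f y - ?c) \<partial>\<nu>)
         = (\<integral>y. indicator V y * local_part f y - indicator V y * ?c \<partial>\<nu>)"
        by (simp add: right_diff_distrib)
      also have "\<dots> = B.block_integral V (local_part f) - (\<integral>y. indicator V y * ?c \<partial>\<nu>)"
        unfolding B.block_integral_def using ind[OF lf V] ind[OF B.integrable_const V, of ?c]
        by (rule Bochner_Integration.integral_diff)
      also have "(\<integral>y. indicator V y * ?c \<partial>\<nu>) = (\<integral>y. indicator V y *\<^sub>R ?c \<partial>\<nu>)"
        by (simp add: scaleR_conv_of_real of_real_indicator)
      also have "\<dots> = ?c * complex_of_real (measure \<nu> V)"
        using B.emeasure_finite borel_cell[OF V] by (simp add: scaleR_conv_of_real mult.commute)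
      finally show "(\<integral>y. indicator V y * (local_part f y - ?c) \<partial>\<nu>) = B.block_integral V (local_part f) - ?c * complex_of_real (measure \<nu> V)" .
    qed
    finally show ?thesis by (simp add: right_diff_distrib sum_subtractf sum_distrib_left ac_simps)
  qed
  have D_block: "AE y in \<nu>. local_part (\<D> f) y = B.block_op (local_part f) y" if f: "f \<in> L2" for f
    using AE_in_F
  proof eventually_elim
    case (elim y)
    then obtain U where U: "U \<in> \<U>" "y \<in> U" by (rule cell_of)
    let ?t = "\<Sum>V\<in>\<U>. complex_of_real (coeff U V) * (B.block_integral V (local_part f) - complex_of_real (measure \<nu> V) * local_part f y)"
    have "B.block_op (local_part f) y = (\<Sum>U'\<in>\<U>. if U' = U then ?t else 0)"
      unfolding B.block_op_def by (intro sum.cong refl) (simp add: mem_cell_iff[OF _ U] indicator_def)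
    also have "\<dots> = ?t" using U finite_\<U> by simp
    also have "\<dots> = local_part (\<D> f) y"
      using D[OF f one_\<Gamma> U] elim by (simp add: act_one local_part_def right_diff_distrib sum_subtractf sum_distrib_left ac_simps)
    finally show ?case by simp
  qed
  have per: "periodic \<Gamma> \<U> (\<D> f)" "measurable_on_domain \<Gamma> (\<D> f)" if f: "f \<in> L2" for f
    using f D_operator_periodic[OF _ _ D[OF f]] by (auto simp: L2_iff)
  have m: "local_part (\<D> f) \<in> borel_measurable \<nu>" if "f \<in> L2" for f
    using measurable_local_part[OF per(2)[OF that]] measurable_cell_measure by blast
  have mb: "B.block_op (local_part f) \<in> borel_measurable \<nu>" if "f \<in> L2" for f
    by (rule B.measurable_block_op[OF sq[OF that]])
  have closed: "\<D> f \<in> L2" if f: "f \<in> L2" for f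
  proof -
    have "integrable \<nu> (\<lambda>y. (norm (local_part (\<D> f) y))\<^sup>2)"
    proof (rule integrable_cong_AE_imp)
      show "integrable \<nu> (\<lambda>y. (norm (B.block_op (local_part f) y))\<^sup>2)"
        using sq_integrableD(2)[OF B.sq_integrable_block_op[OF sq[OF f]]] .
      show "(\<lambda>y. (norm (local_part (\<D> f) y))\<^sup>2) \<in> borel_measurable \<nu>" using m[OF f] by measurable
      show "AE y in \<nu>. (norm (B.block_op (local_part f) y))\<^sup>2 = (norm (local_part (\<D> f) y))\<^sup>2"
        using D_block[OF f] by eventually_elim simp
    qed
    then show ?thesis using per[OF f] m[OF f] by (simp add: L2_iff sq_integrable_def)
  qed
  have norm_D: "(\<integral>y. (norm (local_part (\<D> f) y))\<^sup>2 \<partial>\<nu>) = (\<integral>y. (norm (B.block_op (local_part f) y))\<^sup>2 \<partial>\<nu>)"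
    if f: "f \<in> L2" for f
  proof (rule integral_cong_AE)
    show "AE y in \<nu>. (norm (local_part (\<D> f) y))\<^sup>2 = (norm (B.block_op (local_part f) y))\<^sup>2"
      using D_block[OF f] by eventually_elim simp
  qed (use m[OF f] mb[OF f] in measurable)
  have block_lin: "B.block_op (\<lambda>y. a * \<phi> y + b * \<psi> y) y = a * B.block_op \<phi> y + b * B.block_op \<psi> y"
    if "sq_integrable \<nu> \<phi>" "sq_integrable \<nu> \<psi>" for a b \<phi> \<psi> y
  proof -
    have "B.block_integral V (\<lambda>y. a * \<phi> y + b * \<psi> y) = a * B.block_integral V \<phi> + b * B.block_integral V \<psi>" if V: "V \<in> \<U>" for V
    proof -
      have i: "integrable \<nu> (\<lambda>y. a * (indicator V y * \<phi> y))" "integrable \<nu> (\<lambda>y. b * (indicator V y * \<psi> y))"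
        using ind[OF B.sq_integrable_integrable V] \<open>sq_integrable \<nu> \<phi>\<close> \<open>sq_integrable \<nu> \<psi>\<close> by auto
      have "B.block_integral V (\<lambda>y. a * \<phi> y + b * \<psi> y) = (\<integral>y. a * (indicator V y * \<phi> y) + b * (indicator V y * \<psi> y) \<partial>\<nu>)"
        unfolding B.block_integral_def by (simp add: algebra_simps)
      also have "\<dots> = a * B.block_integral V \<phi> + b * B.block_integral V \<psi>"
        unfolding Bochner_Integration.integral_add[OF i] B.block_integral_def by simp
      finally show ?thesis .
    qed
    then show ?thesis
      unfolding B.block_op_def sum_distrib_left sum.distrib[symmetric]
      by (intro sum.cong refl) (simp add: algebra_simps)
  qed
  show "bounded_linear_operator_on L2 (ae_eq \<mu> \<Gamma>) (L2norm) \<D>"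
  proof (rule bounded_linear_operator_onI[OF closed])
    show "AE y in \<nu>. local_part (\<D> (\<lambda>x. a * f x + b * g x)) y = a * local_part (\<D> f) y + b * local_part (\<D> g) y"
      if fg: "f \<in> L2" "g \<in> L2" for f g a b
      using D_block[OF fg(1)] D_block[OF fg(2)] D_block[OF L2_lincomb[OF fg, of a b]]
      by eventually_elim (simp add: local_part_lincomb block_lin[OF sq[OF fg(1)] sq[OF fg(2)]])
    show "(\<integral>y. (norm (local_part (\<D> f) y))\<^sup>2 \<partial>\<nu>)
      \<le> (2 * B.block_bound * measure \<nu> (space \<nu>))\<^sup>2 * (\<integral>y. (norm (local_part f y))\<^sup>2 \<partial>\<nu>)"
      if f: "f \<in> L2" for f
      unfolding norm_D[OF f] by (rule B.block_op_bounded[OF sq[OF f]])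
    show "0 \<le> 2 * B.block_bound * measure \<nu> (space \<nu>)" using B.block_bound_nonneg by simp
  qed
  show "self_adjoint_on L2 (ae_eq \<mu> \<Gamma>) scal \<D>"
  proof (rule self_adjoint_onI[OF closed])
    fix f g assume f: "f \<in> L2" and g: "g \<in> L2"
    have lm: "local_part f \<in> borel_measurable \<nu>" "local_part g \<in> borel_measurable \<nu>"
      using sq_integrableD(1)[OF sq[OF f]] sq_integrableD(1)[OF sq[OF g]] .
    note [measurable] = lm m[OF f] m[OF g] mb[OF f] mb[OF g]
    have "scal (\<D> f) g = (\<integral>y. B.block_op (local_part f) y * cnj (local_part g y) \<partial>\<nu>)"
      unfolding scal_eq[OF closed[OF f] g]
    proof (rule integral_cong_AE)
      show "AE y in \<nu>. local_part (\<D> f) y * cnj (local_part g y) = B.block_op (local_part f) y * cnj (local_part g y)"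
        using D_block[OF f] by eventually_elim simp
    qed measurable
    also have "\<dots> = (\<integral>y. local_part f y * cnj (B.block_op (local_part g) y) \<partial>\<nu>)"
      by (rule B.block_op_symmetric[OF sq[OF f] sq[OF g]])
    also have "\<dots> = scal f (\<D> g)"
      unfolding scal_eq[OF f closed[OF g]]
    proof (rule integral_cong_AE)
      show "AE y in \<nu>. local_part f y * cnj (B.block_op (local_part g) y) = local_part f y * cnj (local_part (\<D> g) y)"
        using D_block[OF g] by eventually_elim simp
    qed measurable
    finally show "scal (\<D> f) g = scal f (\<D> g)" .
  qed
qed

end

section \<open>Infinite total mass\<close>

context schottky_operator
begin

text \<open>
  If \<open>\<nu>\<close> is infinite, the rows of the kernel need not be integrable, so this cannot be read off from
  the integral against \<open>\<nu>\<close>; instead the integrals over the single translates agree.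
\<close>

lemma weighted_integral_cong_AE:
  assumes m: "\<phi> \<in> borel_measurable borel" "\<psi> \<in> borel_measurable borel"
    and eq: "AE y in \<nu>. \<phi> y = \<psi> y"
  shows "weighted_integral \<mu> \<Gamma> \<U> s (\<lambda>z. \<phi> (the z)) = weighted_integral \<mu> \<Gamma> \<U> s (\<lambda>z. \<psi> (the z))"
  unfolding weighted_integral_def translate_def[symmetric] mob_def[symmetric]
proof (intro sum.cong infsum_cong refl arg_cong2[where f = "(*)"])
  fix U \<gamma> assume U: "U \<in> \<U>" and \<gamma>: "\<gamma> \<in> \<Gamma>"
  let ?\<gamma>' = "inv\<^bsub>PGL2\<^esub> \<gamma>"
  define E where "E = {y\<in>F. \<phi> y \<noteq> \<psi> y}"
  note [measurable] = m
  have "E = F \<inter> {y. \<phi> y \<noteq> \<psi> y}" by (auto simp: E_def)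
  also have "\<dots> \<in> sets borel" by (intro sets.Int borel_F) measurable
  finally have E: "E \<in> sets borel" "E \<subseteq> F" by (auto simp: E_def)
  have "AE y in \<nu>. y \<notin> E" using eq by eventually_elim (simp add: E_def)
  then have "emeasure \<nu> E = 0" using E by (subst (asm) AE_iff_measurable[of E]) auto
  then have "emeasure \<mu> E = 0" using null_iff[OF E] by blast
  then have null: "translate \<gamma> E \<in> null_sets \<mu>"
    using translate_null[OF haar carrier[OF \<gamma>] E(1)] borel_translate[OF carrier[OF \<gamma>] E(1)] sets_\<mu> by auto
  note [measurable] = borel_measurable_mob[OF inv_carrier[OF \<gamma>]] borel_translate_cell[OF \<gamma> U]
  show "(LINT x:translate \<gamma> U|\<mu>. \<phi> (mob ?\<gamma>' x)) = (LINT x:translate \<gamma> U|\<mu>. \<psi> (mob ?\<gamma>' x))"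
    unfolding set_lebesgue_integral_def
  proof (rule integral_cong_AE)
    show "AE x in \<mu>. indicator (translate \<gamma> U) x *\<^sub>R \<phi> (mob ?\<gamma>' x) = indicator (translate \<gamma> U) x *\<^sub>R \<psi> (mob ?\<gamma>' x)"
    proof (rule AE_I'[OF null], rule subsetI)
      fix x assume "x \<in> {x \<in> space \<mu>. \<not> indicator (translate \<gamma> U) x *\<^sub>R \<phi> (mob ?\<gamma>' x) = indicator (translate \<gamma> U) x *\<^sub>R \<psi> (mob ?\<gamma>' x)}"
      then have "x \<in> translate \<gamma> U" "\<phi> (mob ?\<gamma>' x) \<noteq> \<psi> (mob ?\<gamma>' x)" by (auto split: split_indicator_asm)
      then show "x \<in> translate \<gamma> E"
        using cell_subset[OF U] unfolding translate_eq_vimage[OF carrier[OF \<gamma>]] E_def by auto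
    qed
  qed measurable
qed

text \<open>
  All functions in the space vanish almost everywhere, and \<open>\<D> f\<close> is a multiple of \<open>f\<close> on the orbit of
  each cell, with a factor that does not depend on \<open>f\<close>.
\<close>

lemma infinite_case:
  assumes inf: "\<not> finite_measure \<nu>"
  shows "\<And>f. f \<in> L2 \<Longrightarrow> AE x in \<mu>. Some x \<in> regular_domain \<Gamma> \<longrightarrow>
      weighted_integrable \<mu> \<Gamma> \<U> s (D_integrand \<Gamma> \<U> A \<alpha> f (Some x))"
    and "bounded_linear_operator_on L2 (ae_eq \<mu> \<Gamma>) (L2norm) (\<D>)"
    and "self_adjoint_on L2 (ae_eq \<mu> \<Gamma>) scal (\<D>)"
proof -
  have mf: "local_part f \<in> borel_measurable borel" if "f \<in> L2" for f
    using that measurable_local_part by (simp add: L2_iff)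
  show "AE x in \<mu>. Some x \<in> regular_domain \<Gamma> \<longrightarrow> weighted_integrable \<mu> \<Gamma> \<U> s (D_integrand \<Gamma> \<U> A \<alpha> f (Some x))"
    if f: "f \<in> L2" for f
  proof -
    define E where "E = {y. local_part f y \<noteq> 0}"
    note [measurable] = mf[OF f]
    have E: "E \<in> sets borel" unfolding E_def by measurable
    have EF: "E \<subseteq> F" by (auto simp: E_def local_part_def split: if_splits)
    have "emeasure \<nu> E = 0"
      using L2_trivial[OF inf f] E by (subst (asm) AE_iff_measurable[of E]) (auto simp: E_def)
    then have "emeasure \<mu> E = 0" using null_iff[OF E EF] by blast
    then show ?thesis
    proof (rule AE_regular_domainI[OF E EF])
      fix \<gamma> y assume \<gamma>: "\<gamma> \<in> \<Gamma>" and y: "y \<in> F" "y \<notin> E"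
      obtain U where U: "U \<in> \<U>" "y \<in> U" using cell_of[OF y(1)] .
      let ?x = "act \<gamma> (Some y)"
      have "f ?x = f (Some y)" using f \<gamma> y(1) by (simp add: L2_iff periodic_iff)
      then have fx: "f ?x = 0" using y by (simp add: E_def local_part_def)
      have "(\<lambda>z. kernel_row U z * local_part f z) \<in> borel_measurable borel" by measurable
      note m = measurable_compose[OF measurable_compose[OF this borel_measurable_norm] measurable_ennreal]
      have "weighted_nn_integral \<mu> \<Gamma> \<U> s (\<lambda>z. ennreal (norm (D_integrand \<Gamma> \<U> A \<alpha> f ?x z)))
          = (\<integral>\<^sup>+z. ennreal (norm (kernel_row U z * local_part f z)) \<partial>\<nu>)"
        using D_integrand_eq[OF \<gamma> U, of _ f] by (intro weighted_nn_integral_eq[OF m]) (simp add: fx local_part_def)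
      also have "\<dots> = (\<integral>\<^sup>+z. 0 \<partial>\<nu>)"
      proof (rule nn_integral_cong_AE)
        show "AE z in \<nu>. ennreal (norm (kernel_row U z * local_part f z)) = 0"
          using L2_trivial[OF inf f] by eventually_elim simp
      qed
      finally show "weighted_integrable \<mu> \<Gamma> \<U> s (D_integrand \<Gamma> \<U> A \<alpha> f ?x)"
        using measurable_D_integrand[OF \<gamma> U, of f] f unfolding weighted_integrable_def by (simp add: L2_iff)
    qed
  qed
  have D: "\<D> f (act \<gamma> (Some x)) = 0 - f (act \<gamma> (Some x)) * weighted_integral \<mu> \<Gamma> \<U> s (\<lambda>z. kernel_row U (the z))"
    if f: "f \<in> L2" and x: "\<gamma> \<in> \<Gamma>" "U \<in> \<U>" "x \<in> U" for f \<gamma> U x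
  proof -
    let ?c = "f (act \<gamma> (Some x))"
    note [measurable] = mf[OF f]
    have "weighted_integral \<mu> \<Gamma> \<U> s (\<lambda>z. kernel_row U (the z) * (local_part f (the z) - ?c)) = weighted_integral \<mu> \<Gamma> \<U> s (\<lambda>z. (- ?c) * kernel_row U (the z))"
    proof (rule weighted_integral_cong_AE)
      show "AE y in \<nu>. kernel_row U y * (local_part f y - ?c) = - ?c * kernel_row U y"
        using L2_trivial[OF inf f] by eventually_elim simp
      show "(\<lambda>y. kernel_row U y * (local_part f y - ?c)) \<in> borel_measurable borel"
        by (intro borel_measurable_times borel_measurable_diff measurable_kernel_row mf[OF f] borel_measurable_const)
      show "(\<lambda>y. - ?c * kernel_row U y) \<in> borel_measurable borel"
        by (intro borel_measurable_times measurable_kernel_row borel_measurable_const)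
    qed
    then show ?thesis unfolding D_operator_eq[OF x] weighted_integral_cmult by simp
  qed
  have per: "periodic \<Gamma> \<U> (\<D> f)" "measurable_on_domain \<Gamma> (\<D> f)" if f: "f \<in> L2" for f
    using f D_operator_periodic[OF _ _ D[OF f]] by (auto simp: L2_iff)
  have zero: "AE y in \<nu>. local_part (\<D> f) y = 0" if f: "f \<in> L2" for f
    using AE_in_F L2_trivial[OF inf f]
  proof eventually_elim
    case (elim y)
    then obtain U where U: "U \<in> \<U>" "y \<in> U" using cell_of by blast
    show ?case using D[OF f one_\<Gamma> U] elim by (simp add: act_one local_part_def)
  qed
  have closed: "\<D> f \<in> L2" if f: "f \<in> L2" for f
  proof -
    have "local_part (\<D> f) \<in> borel_measurable \<nu>"
      using measurable_local_part[OF per(2)[OF f]] measurable_cell_measure by blast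
    then show ?thesis using per[OF f] sq_integrable_AE_zero[OF _ zero[OF f]] by (simp add: L2_iff)
  qed
  show "bounded_linear_operator_on L2 (ae_eq \<mu> \<Gamma>) (L2norm) \<D>"
  proof (rule bounded_linear_operator_onI[OF closed, where C = 0])
    show "AE y in \<nu>. local_part (\<D> (\<lambda>x. a * f x + b * g x)) y = a * local_part (\<D> f) y + b * local_part (\<D> g) y"
      if fg: "f \<in> L2" "g \<in> L2" for f g a b
      using zero[OF fg(1)] zero[OF fg(2)] zero[OF L2_lincomb[OF fg, of a b]] by eventually_elim simp
    show "(\<integral>y. (norm (local_part (\<D> f) y))\<^sup>2 \<partial>\<nu>) \<le> 0\<^sup>2 * (\<integral>y. (norm (local_part f y))\<^sup>2 \<partial>\<nu>)"
      if f: "f \<in> L2" for f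
      using sq_integral_zero_iff[of \<nu> "local_part (\<D> f)"] closed[OF f] zero[OF f] by (simp add: L2_iff)
    show "(0::real) \<le> 0" by simp
  qed
  have scal0: "scal f g = 0" if fg: "f \<in> L2" "g \<in> L2" for f g
    unfolding scal_eq[OF fg]
  proof (rule integral_eq_zero_AE)
    show "AE y in \<nu>. local_part f y * cnj (local_part g y) = 0"
      using L2_trivial[OF inf fg(1)] by eventually_elim simp
  qed
  show "self_adjoint_on L2 (ae_eq \<mu> \<Gamma>) scal \<D>"
    by (rule self_adjoint_onI[OF closed]) (simp_all add: scal0 closed)
qed

end

section \<open>Boundedness and self-adjointness\<close>

theorem lemma6p6:
  fixes \<mu> :: "'a::nonarch_local_field measure"
    and \<Gamma> :: "('a^2^2) set set"
    and F :: "'a set"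
    and \<U> :: "'a set set"
    and A :: "'a set \<Rightarrow> 'a set \<Rightarrow> real"
    and g :: nat
    and \<alpha> s :: real
  assumes "haar_measure \<mu>"
    and "schottky_group \<Gamma> g"
    and "fundamental_domain \<Gamma> F" and "compact F" and "open F" and "closed F"
    and "\<U> \<in> Cov F" and "verticial \<U>"
    and "\<forall>U\<in>\<U>. \<forall>V\<in>\<U>. A U V = A V U"
    and "\<forall>U\<in>\<U>. \<forall>V\<in>\<U>. A U V \<ge> 0"
    and "\<forall>U\<in>\<U>. A U U = 0"
    and "s > 1"
  shows "(\<forall>f \<in> L2_space \<mu> \<Gamma> \<U> s. AE x in \<mu>. Some x \<in> regular_domain \<Gamma> \<longrightarrow>
             weighted_integrable \<mu> \<Gamma> \<U> s (D_integrand \<Gamma> \<U> A \<alpha> f (Some x))) \<and>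
         bounded_linear_operator_on (L2_space \<mu> \<Gamma> \<U> s) (ae_eq \<mu> \<Gamma>) (L2_norm \<mu> \<Gamma> \<U> s)
           (D_operator \<mu> \<Gamma> \<U> s A \<alpha>) \<and>
         self_adjoint_on (L2_space \<mu> \<Gamma> \<U> s) (ae_eq \<mu> \<Gamma>) (ip \<mu> \<Gamma> \<U> s)
           (D_operator \<mu> \<Gamma> \<U> s A \<alpha>)"
proof -
  have sub: "subgroup \<Gamma> PGL2" using assms(2) by (simp add: schottky_group_def)
  obtain S where S: "finite S" "generate PGL2 S = \<Gamma>"
    using assms(2) unfolding schottky_group_def freely_generated_def by blast
  have cov: "\<forall>U\<in>\<U>. holed_disc U" "disjoint \<U>" "\<Union>\<U> = F" using assms(7) by (auto simp: Cov_def)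
  interpret schottky_operator \<mu> \<Gamma> F \<U> s A \<alpha>
  proof
    show "\<Gamma> \<subseteq> carrier PGL2" using sub by (rule subgroup.subset)
    show "\<one>\<^bsub>PGL2\<^esub> \<in> \<Gamma>" using sub by (rule subgroup.one_closed)
    show "countable \<Gamma>" using countable_generate[OF countable_finite[OF S(1)], of PGL2] S(2) by simp
    show "finite \<U>" by (rule finite_Cov[OF assms(4,7)])
    show "open U" "closed U" if "U \<in> \<U>" for U using cov(1) that holed_disc_clopen by blast+
  qed (use assms cov in auto)
  show ?thesis
  proof (cases "finite_measure \<nu>")
    case True
    then show ?thesis using finite_case by (intro conjI ballI AE_I2 impI) auto
  next
    case False
    then show ?thesis using infinite_case by (intro conjI ballI) auto
  qed
qed

end
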